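(* There exist absolute constants $c_0, C>0$ such that the following holds. Let $1\le r\le n$ be integers, let $\mathbb{F}$ be a field, let $X$ be the $2n\times 2n$ skew-symmetric matrix of indeterminates $x_{i,j}$ ($1\le i<j\le 2n$), and let $I^{\mathrm{pfaff}}_{2n,2r}\subseteq\mathbb{F}[X]=\mathbb{F}[x_{i,j}\mid 1\le i<j\le 2n]$ be the ideal generated by the Pfaffians of the $2r\times 2r$ principal submatrices of $X$. Let $f\in I^{\mathrm{pfaff}}_{2n,2r}$ be a nonzero polynomial of (total) degree $d$. Let $g(y_1,\dots,y_\ell)\in\mathbb{F}[y_1,\dots,y_\ell]$ be a polynomial computable by an algebraic branching program with at most $r$ vertices. Assume $|\mathbb{F}|\ge c_0d^3n^3$. Then there is a depth-three $f$-oracle circuit $\Phi$ over $\mathbb{F}$ of size at most $C\,d^4\ell n^5 r$, whose top gate is an addition gate, such that: \begin{itemize} \item if $\operatorname{char}(\mathbb{F})=0$, then $\Phi$ computes $g(y_1,\dots,y_\ell)$; \item if $\operatorname{char}(\mathbb{F})=p>0$, then $\Phi$ computes $g(y_1,\dots,y_\ell)^{p^k}$ for some integer $0\le k\le\lfloor\log_p(d)\rfloor$. \end{itemize}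
   Context: Skew-symmetric matrix of indeterminates: $X=(x_{i,j})_{1\le i,j\le 2n}$ where $x_{i,j}$, $i<j$, are independent indeterminates, $x_{j,i}=-x_{i,j}$, and $x_{i,i}=0$. The Pfaffian of a $2k\times 2k$ skew-symmetric matrix $A=(a_{i,j})$ (with zero diagonal) is the polynomial with coefficients $\pm1$ given by $\mathrm{pfaff}_{2k}(A)=\frac{1}{2^kk!}\sum_{\pi\in S_{2k}}\operatorname{sgn}(\pi)\prod_{i=1}^k a_{\pi(2i-1),\pi(2i)}$ (each monomial occurs $2^kk!$ times, so this makes sense over any field); its square is $\det(A)$. A principal submatrix is one with equal row and column index sets. An algebraic circuit over $\mathbb{F}$ is a directed acyclic graph whose input gates are labelled by variables or constants of $\mathbb{F}$ and whose internal gates are addition and multiplication gates with unbounded fan-in and fan-out; wires may carry scalars from $\mathbb{F}$ that multiply the value passing along them at no cost (so an addition gate can output any $\mathbb{F}$-linear combination of its inputs). For a polynomial $f\in\mathbb{F}[x_1,\dots,x_N]$, an $f$-oracle circuit may in addition use $f$-gates: an $f$-gate with inputs $g_1,\dots,g_N$ outputs $f(g_1,\dots,g_N)$ (here the variables of $f$ are the $x_{i,j}$ with $i<j$). The size of a circuit is its number of gates plus its number of wires; its depth is the number of layers of non-input gates (length of a longest directed path from an input gate to the output). An algebraic branching program (ABP) over $\mathbb{F}[\overline{y}]$ is a directed acyclic graph whose vertices are partitioned into nonempty layers $V_0\sqcup\cdots\sqcup V_e$ ($e\ge 0$), with $V_0=\{s\}$ and $V_e=\{t\}$, each edge going from $V_{i-1}$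 to $V_i$ for some $i$ and labelled by a polynomial in $\mathbb{F}[\overline{y}]$ of degree at most one. It computes the sum, over all directed paths from $s$ to $t$, of the product of the edge labels on the path. *)

theory Defs
  imports
    Complex_Main
    "HOL-Library.Poly_Mapping"
    "HOL-Combinatorics.Permutations"
    "HOL-Computational_Algebra.Computational_Algebra"
begin

section \<open>Multivariate polynomials\<close>

text \<open>A monomial is a finitely supported exponent function; the ring operations on polynomials
  are those of \<^theory>\<open>HOL-Library.Poly_Mapping\<close>.\<close>

type_synonym ('v, 'a) mpoly = "('v \<Rightarrow>\<^sub>0 nat) \<Rightarrow>\<^sub>0 'a"

definition mvar :: "'v \<Rightarrow> ('v, 'a::zero_neq_one) mpoly" where
  "mvar v = Poly_Mapping.single (Poly_Mapping.single v 1) 1"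

definition mconst :: "'a \<Rightarrow> ('v, 'a::zero) mpoly" where
  "mconst c = Poly_Mapping.single 0 c"

definition mvars :: "('v, 'a::zero) mpoly \<Rightarrow> 'v set" where
  "mvars p = (\<Union>m\<in>Poly_Mapping.keys p. Poly_Mapping.keys m)"

definition polys_in :: "'v set \<Rightarrow> ('v, 'a::zero) mpoly set" where
  "polys_in V = {p. mvars p \<subseteq> V}"

definition monomial_degree :: "('v \<Rightarrow>\<^sub>0 nat) \<Rightarrow> nat" where
  "monomial_degree m = (\<Sum>v\<in>Poly_Mapping.keys m. Poly_Mapping.lookup m v)"

text \<open>The zero polynomial gets degree 0.\<close>

definition total_degree :: "('v, 'a::zero) mpoly \<Rightarrow> nat" where
  "total_degree p = Max (insert 0 (monomial_degree ` Poly_Mapping.keys p))"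

definition msubst :: "('v, 'a::comm_ring_1) mpoly \<Rightarrow> ('v \<Rightarrow> ('w, 'a) mpoly) \<Rightarrow> ('w, 'a) mpoly" where
  "msubst f q = (\<Sum>m\<in>Poly_Mapping.keys f.
     mconst (Poly_Mapping.lookup f m) * (\<Prod>v\<in>Poly_Mapping.keys m. q v ^ Poly_Mapping.lookup m v))"

text \<open>The ideal of the subring \<open>R\<close> generated by a finite set \<open>G \<subseteq> R\<close>.\<close>

definition ideal_generated :: "'b::comm_ring_1 set \<Rightarrow> 'b set \<Rightarrow> 'b set" where
  "ideal_generated R G = {\<Sum>g\<in>G. h g * g | h. \<forall>g\<in>G. h g \<in> R}"


section \<open>Pfaffians\<close>

text \<open>The indeterminate \<open>x\<^bsub>i,j\<^esub>\<close> is \<open>mvar (i, j)\<close>, for \<open>1 \<le> i < j \<le> 2 n\<close> only.\<close>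

definition skew_vars :: "nat \<Rightarrow> (nat \<times> nat) set" where
  "skew_vars n = {(i, j). 1 \<le> i \<and> i < j \<and> j \<le> 2 * n}"

definition skew_entry :: "nat \<Rightarrow> nat \<Rightarrow> (nat \<times> nat, 'a::comm_ring_1) mpoly" where
  "skew_entry i j = (if i < j then mvar (i, j) else if j < i then - mvar (j, i) else 0)"

text \<open>Pfaffian of a skew-symmetric \<open>2 k \<times> 2 k\<close> matrix (indices starting at 1) over a polynomial
  ring with integer coefficients. Every coefficient of the sum over all permutations is a multiple
  of \<open>2\<^sup>k k!\<close>, so the factor \<open>1 / (2\<^sup>k k!)\<close> is an exact coefficientwise integer division.\<close>

definition pfaffian_int :: "nat \<Rightarrow> (nat \<Rightarrow> nat \<Rightarrow> ('v, int) mpoly) \<Rightarrow> ('v, int) mpoly" where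
  "pfaffian_int k A = Poly_Mapping.map (\<lambda>c. c div (2 ^ k * fact k))
     (\<Sum>\<pi> | \<pi> permutes {1..2 * k}. of_int (sign \<pi>) * (\<Prod>i=1..k. A (\<pi> (2 * i - 1)) (\<pi> (2 * i))))"

text \<open>Pfaffian of the principal submatrix of \<open>X\<close> with index set \<open>S\<close>, where \<open>card S = 2 k\<close>. It is
  computed over the integers and its coefficients are then mapped to the base ring, which makes
  sense in every characteristic.\<close>

definition principal_pfaffian :: "nat \<Rightarrow> nat set \<Rightarrow> (nat \<times> nat, 'a::comm_ring_1) mpoly" where
  "principal_pfaffian k S = Poly_Mapping.map of_int
     (pfaffian_int k (\<lambda>a b. skew_entry (sorted_list_of_set S ! (a - 1)) (sorted_list_of_set S ! (b - 1))))"

definition pfaffian_ideal :: "nat \<Rightarrow> nat \<Rightarrow> (nat \<times> nat, 'a::comm_ring_1) mpoly set" where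
  "pfaffian_ideal n r = ideal_generated (polys_in (skew_vars n))
     {principal_pfaffian r S | S. S \<subseteq> {1..2 * n} \<and> card S = 2 * r}"


section \<open>Oracle circuits\<close>

text \<open>The gates of a circuit are numbered by their positions in a list. A wire is given at the gate
  it enters, as a pair \<open>(c, j)\<close>: it carries the scalar \<open>c\<close> and comes from gate \<open>j\<close>. Wires into
  addition and multiplication gates form a list, so parallel wires are possible. An oracle gate has
  one wire for each variable of the oracle polynomial; the values of its function outside the set
  of these variables are irrelevant.\<close>

datatype ('v, 'a) gate =
    Input_Var nat
  | Input_Const 'a
  | Add_Gate "('a \<times> nat) list"
  | Mult_Gate "('a \<times> nat) list"
  | Oracle_Gate "'v \<Rightarrow> 'a \<times> nat"

record ('v, 'a) circuit =
  gates :: "('v, 'a) gate list"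
  out_gate :: nat

text \<open>In all of the following, \<open>V\<close> is the set of variables of the oracle polynomial.\<close>

fun is_input :: "('v, 'a) gate \<Rightarrow> bool" where
  "is_input (Input_Var k) = True"
| "is_input (Input_Const c) = True"
| "is_input _ = False"

fun is_addition :: "('v, 'a) gate \<Rightarrow> bool" where
  "is_addition (Add_Gate ws) = True"
| "is_addition _ = False"

fun sources :: "'v set \<Rightarrow> ('v, 'a) gate \<Rightarrow> nat set" where
  "sources V (Input_Var k) = {}"
| "sources V (Input_Const c) = {}"
| "sources V (Add_Gate ws) = snd ` set ws"
| "sources V (Mult_Gate ws) = snd ` set ws"
| "sources V (Oracle_Gate w) = (\<lambda>v. snd (w v)) ` V"

fun fan_in :: "'v set \<Rightarrow> ('v, 'a) gate \<Rightarrow> nat" where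
  "fan_in V (Input_Var k) = 0"
| "fan_in V (Input_Const c) = 0"
| "fan_in V (Add_Gate ws) = length ws"
| "fan_in V (Mult_Gate ws) = length ws"
| "fan_in V (Oracle_Gate w) = card V"

definition wire_rel :: "'v set \<Rightarrow> ('v, 'a) circuit \<Rightarrow> (nat \<times> nat) set" where
  "wire_rel V C = {(i, j). j < length (gates C) \<and> i \<in> sources V (gates C ! j)}"

text \<open>Well-formed circuits with input variables \<open>y\<^sub>1, \<dots>, y\<^sub>l\<close>: the wires form a directed acyclic graph
  on the gates whose sources are exactly the input gates.\<close>

definition wf_circuit :: "'v set \<Rightarrow> nat \<Rightarrow> ('v, 'a) circuit \<Rightarrow> bool" where
  "wf_circuit V l C \<longleftrightarrow>
     out_gate C < length (gates C) \<and>
     acyclic (wire_rel V C) \<and>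
     (\<forall>G\<in>set (gates C).
        sources V G \<subseteq> {..<length (gates C)} \<and>
        (is_input G \<longleftrightarrow> fan_in V G = 0) \<and>
        (\<forall>k. G = Input_Var k \<longrightarrow> k \<in> {1..l}))"

definition circuit_size :: "'v set \<Rightarrow> ('v, 'a) circuit \<Rightarrow> nat" where
  "circuit_size V C = length (gates C) + (\<Sum>G\<leftarrow>gates C. fan_in V G)"

text \<open>The non-input gates on a path from an input gate are as many as its wires.\<close>

definition circuit_depth :: "'v set \<Rightarrow> ('v, 'a) circuit \<Rightarrow> nat" where
  "circuit_depth V C = Max {k. \<exists>i<length (gates C).
     is_input (gates C ! i) \<and> (i, out_gate C) \<in> wire_rel V C ^^ k}"

text \<open>The polynomial at a gate, given the polynomials \<open>val j\<close> at the other gates.\<close>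

fun gate_value :: "'v set \<Rightarrow> ('v, 'a::comm_ring_1) mpoly \<Rightarrow> (nat \<Rightarrow> (nat, 'a) mpoly) \<Rightarrow>
    ('v, 'a) gate \<Rightarrow> (nat, 'a) mpoly" where
  "gate_value V f val (Input_Var k) = mvar k"
| "gate_value V f val (Input_Const c) = mconst c"
| "gate_value V f val (Add_Gate ws) = (\<Sum>(c, j)\<leftarrow>ws. mconst c * val j)"
| "gate_value V f val (Mult_Gate ws) = (\<Prod>(c, j)\<leftarrow>ws. mconst c * val j)"
| "gate_value V f val (Oracle_Gate w) = msubst f (\<lambda>v. mconst (fst (w v)) * val (snd (w v)))"

text \<open>By acyclicity, the gate equations determine \<open>val\<close> uniquely on the gates of a well-formed
  circuit, provided that \<open>f \<in> polys_in V\<close>.\<close>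

definition computes :: "'v set \<Rightarrow> ('v, 'a::comm_ring_1) mpoly \<Rightarrow> ('v, 'a) circuit \<Rightarrow>
    (nat, 'a) mpoly \<Rightarrow> bool" where
  "computes V f C p \<longleftrightarrow> (\<exists>val.
     (\<forall>i<length (gates C). val i = gate_value V f val (gates C ! i)) \<and> val (out_gate C) = p)"


section \<open>Algebraic branching programs\<close>

text \<open>The layers are \<open>layer 0, \<dots>, layer (top_layer)\<close>.\<close>

record (overloaded) 'a abp =
  top_layer :: nat
  layer :: "nat \<Rightarrow> nat set"
  source :: nat
  sink :: nat
  edges :: "(nat \<times> nat) set"
  label :: "nat \<Rightarrow> nat \<Rightarrow> (nat, 'a) mpoly"

definition abp_vertices :: "'a abp \<Rightarrow> nat set" where
  "abp_vertices P = (\<Union>i\<le>top_layer P. layer P i)"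

definition wf_abp :: "nat \<Rightarrow> 'a::comm_ring_1 abp \<Rightarrow> bool" where
  "wf_abp l P \<longleftrightarrow>
     (\<forall>i\<le>top_layer P. finite (layer P i) \<and> layer P i \<noteq> {}) \<and>
     (\<forall>i\<le>top_layer P. \<forall>j\<le>top_layer P. i \<noteq> j \<longrightarrow> layer P i \<inter> layer P j = {}) \<and>
     layer P 0 = {source P} \<and> layer P (top_layer P) = {sink P} \<and>
     edges P \<subseteq> (\<Union>i<top_layer P. layer P i \<times> layer P (Suc i)) \<and>
     (\<forall>(u, v)\<in>edges P. label P u v \<in> polys_in {1..l} \<and> total_degree (label P u v) \<le> 1)"

definition abp_paths :: "'a abp \<Rightarrow> nat list set" where
  "abp_paths P = {p. p \<noteq> [] \<and> hd p = source P \<and> last p = sink P \<and>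
     successively (\<lambda>u v. (u, v) \<in> edges P) p}"

definition abp_poly :: "'a::comm_ring_1 abp \<Rightarrow> (nat, 'a) mpoly" where
  "abp_poly P = (\<Sum>p\<in>abp_paths P. \<Prod>i<length p - 1. label P (p ! i) (p ! Suc i))"

definition abp_computable :: "nat \<Rightarrow> nat \<Rightarrow> (nat, 'a::comm_ring_1) mpoly \<Rightarrow> bool" where
  "abp_computable l m g \<longleftrightarrow>
     (\<exists>P. wf_abp l P \<and> card (abp_vertices P) \<le> m \<and> abp_poly P = g)"


section \<open>Absolute constants\<close>

text \<open>A type variable for the field is quantified outside of the whole theorem, so constants under
  a plain existential quantifier could depend on the field. Requiring them to lie below one fixed
  number makes them absolute: both enter the theorem monotonically, so that number itself
  works for every field.\<close>

definition constant_bound :: real where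
  "constant_bound = 10 ^ 9"

end

theory Submission
  imports Defs "HOL-Algebra.Exponent"
begin

text \<open>
  Pull \<open>f\<close> back along \<open>(P, Q) \<mapsto> \<Sum>\<^sub>a P\<^sub>a \<and> Q\<^sub>a\<close>, the sum of the wedge products of the columns of two
  \<open>2 n \<times> 2 n\<close> matrices. The pullback \<open>h\<close> is nonzero, and since \<open>f\<close> vanishes on skew-symmetric matrices of
  rank less than \<open>2 r\<close>, every monomial of \<open>h\<close> involves a column \<open>P\<^sub>i\<close> with \<open>i \<ge> r\<close>. Write the branching
  program as a matrix \<open>B = L D U\<close> with \<open>L\<close>, \<open>U\<close> unitriangular and \<open>D\<close> the identity except for the entry
  \<open>1 + u g\<close> at \<open>i\<close>; all entries of \<open>B\<close> are affine in \<open>y\<close>, although those of \<open>L\<close> and \<open>D\<close> are not. In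
  \<open>\<Sum> B\<^sub>a\<^sub>b P\<^sub>a \<and> Q\<^sub>b\<close> the columns are scaled by powers of \<open>u\<close> that increase with the column index. Then the off-diagonal
  entries of \<open>L\<close> and \<open>U\<close> contribute only to higher powers of \<open>u\<close>, so the part of least weight of \<open>f\<close> is
  that of \<open>h\<close> at constant columns, multiplied by \<open>(1 + u g)\<^sup>e\<close> with \<open>1 \<le> e \<le> deg f\<close>. Its coefficient at \<open>u\<^sup>q\<close>
  is a multiple of \<open>g\<^sup>q\<close>, nonzero when \<open>q = 1\<close> in characteristic 0 and when \<open>q\<close> is the largest power of
  \<open>p\<close> dividing \<open>e\<close> in characteristic \<open>p\<close>, and interpolation in \<open>u\<close> extracts it by a linear combination
  of values of \<open>f\<close>.
\<close>

section \<open>Evaluation of multivariate polynomials\<close>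

text \<open>Let \<open>N\<close> be the matrix of edge labels. The path sum \<open>g\<close> is an
  entry of the inverse of \<open>I - N\<close>, which is not affine in the labels, whereas
  \<open>B = I - N + u E\<close>, with \<open>E\<close> having a single 1 at row \<open>i\<close>
  and column \<open>s\<close>, becomes affine once \<open>u\<close> is a scalar. If
  \<open>\<gamma>\<close> is row \<open>s\<close> of the inverse, then
  \<open>B = (I + u T) (I - N)\<close>, where row \<open>i\<close> of \<open>T\<close> is
  \<open>\<gamma>\<close> and its other rows are 0. As the sink sits at position \<open>i\<close>,
  the diagonal entry there is \<open>1 + u g\<close>. The position \<open>i\<close> is imposed by
  \<open>f\<close>; \<open>i \<ge> r\<close> leaves room for all vertices of the program at
  positions up to \<open>i\<close>. Keeping \<open>P\<close> and \<open>Q\<close> apart lets each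
  triangular factor act on one of them only.

  The spacing of the powers of \<open>u\<close> has two purposes, each costing a factor
  \<open>K = deg f + 1\<close>: column indices must outweigh the degree in column \<open>i\<close>,
  and off-diagonal contributions must stay above the powers up to \<open>u^e\<close> from which
  \<open>(1 + u g)^e\<close> is read off. The value of \<open>f\<close> then has degree O(n d^3) in
  \<open>u\<close>, which fixes the number of interpolation points, the demand on the field and the
  number of oracle gates.\<close>

definition ring_morphism :: "('a::comm_ring_1 \<Rightarrow> 'b::comm_ring_1) \<Rightarrow> bool" where
  "ring_morphism \<phi> \<longleftrightarrow> \<phi> 1 = 1 \<and> (\<forall>a b. \<phi> (a + b) = \<phi> a + \<phi> b) \<and> (\<forall>a b. \<phi> (a * b) = \<phi> a * \<phi> b)"

lemma ring_morphismI:
  assumes "\<phi> 1 = 1" "\<And>a b. \<phi> (a + b) = \<phi> a + \<phi> b" "\<And>a b. \<phi> (a * b) = \<phi> a * \<phi> b"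
  shows "ring_morphism \<phi>"
  using assms by (simp add: ring_morphism_def)

context
  fixes \<phi> :: "'a::comm_ring_1 \<Rightarrow> 'b::comm_ring_1"
  assumes rm: "ring_morphism \<phi>"
begin

lemma rm_one: "\<phi> 1 = 1"
  and rm_add: "\<phi> (a + b) = \<phi> a + \<phi> b"
  and rm_mult: "\<phi> (a * b) = \<phi> a * \<phi> b"
  using rm by (auto simp: ring_morphism_def)

lemma rm_zero: "\<phi> 0 = 0"
  using rm_add[of 0 0] by simp

lemma rm_uminus: "\<phi> (- a) = - \<phi> a"
  using rm_add[of a "- a"] rm_zero by (simp add: eq_neg_iff_add_eq_0 add.commute)

lemma rm_diff: "\<phi> (a - b) = \<phi> a - \<phi> b"
  using rm_add[of a "- b"] by (simp add: rm_uminus)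

lemma rm_power: "\<phi> (a ^ n) = \<phi> a ^ n"
  by (induction n) (simp_all add: rm_one rm_mult)

lemma rm_sum: "\<phi> (sum h A) = (\<Sum>x\<in>A. \<phi> (h x))"
  by (induction A rule: infinite_finite_induct) (simp_all add: rm_zero rm_add)

lemma rm_prod: "\<phi> (prod h A) = (\<Prod>x\<in>A. \<phi> (h x))"
  by (induction A rule: infinite_finite_induct) (simp_all add: rm_one rm_mult)

lemma rm_of_nat: "\<phi> (of_nat n) = of_nat n"
  by (induction n) (simp_all add: rm_zero rm_one rm_add)

lemma rm_of_int: "\<phi> (of_int n) = of_int n"
  by (cases n rule: int_diff_cases) (simp add: rm_diff rm_of_nat)

end

lemma ring_morphism_id: "ring_morphism (\<lambda>x. x)"
  by (rule ring_morphismI) auto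

lemma ring_morphism_comp:
  "ring_morphism \<phi> \<Longrightarrow> ring_morphism \<psi> \<Longrightarrow> ring_morphism (\<lambda>x. \<phi> (\<psi> x))"
  by (simp add: ring_morphism_def)

lemma ring_morphism_of_int: "ring_morphism (of_int :: int \<Rightarrow> 'b::comm_ring_1)"
  by (rule ring_morphismI) auto

lemma ring_morphism_mconst: "ring_morphism (mconst :: 'a::comm_ring_1 \<Rightarrow> ('v, 'a) mpoly)"
  by (rule ring_morphismI) (auto simp: mconst_def single_add mult_single)

lemma mconst_0 [simp]: "mconst 0 = 0" and mconst_1 [simp]: "mconst 1 = (1 :: ('v, 'a::comm_ring_1) mpoly)"
  by (simp_all add: mconst_def)

lemma ring_morphism_const_poly: "ring_morphism (\<lambda>c::'a::comm_ring_1. [:c:])"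
  by (rule ring_morphismI) auto

lemma ring_morphism_poly: "ring_morphism (\<lambda>p. poly p (c::'a::comm_ring_1))"
  by (rule ring_morphismI) auto

definition monomial_value :: "('v \<Rightarrow> 'b::comm_ring_1) \<Rightarrow> ('v \<Rightarrow>\<^sub>0 nat) \<Rightarrow> 'b" where
  "monomial_value x m = (\<Prod>v\<in>Poly_Mapping.keys m. x v ^ Poly_Mapping.lookup m v)"

lemma monomial_value_superset:
  assumes "finite V" "Poly_Mapping.keys m \<subseteq> V"
  shows "monomial_value x m = (\<Prod>v\<in>V. x v ^ Poly_Mapping.lookup m v)"
  unfolding monomial_value_def
  by (rule prod.mono_neutral_left) (use assms in \<open>auto simp: in_keys_iff\<close>)

lemma monomial_value_0 [simp]: "monomial_value x 0 = 1"
  by (simp add: monomial_value_def)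

lemma monomial_value_single: "monomial_value x (Poly_Mapping.single v k) = x v ^ k"
  by (cases "k = 0") (auto simp: monomial_value_def)

lemma monomial_value_add: "monomial_value x (m + m') = monomial_value x m * monomial_value x m'"
proof -
  let ?V = "Poly_Mapping.keys m \<union> Poly_Mapping.keys m'"
  have "Poly_Mapping.keys (m + m') \<subseteq> ?V" by (rule keys_add)
  then show ?thesis
    by (simp add: monomial_value_superset[where V = ?V] lookup_add power_add prod.distrib)
qed

lemma monomial_value_mult:
  "monomial_value (\<lambda>v. x v * y v) m = monomial_value x m * monomial_value y m"
  by (simp add: monomial_value_def power_mult_distrib prod.distrib)

lemma rm_monomial_value:
  assumes "ring_morphism \<phi>"
  shows "\<phi> (monomial_value x m) = monomial_value (\<lambda>v. \<phi> (x v)) m"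
  using assms by (simp add: monomial_value_def rm_prod rm_power)

text \<open>\<open>\<phi>\<close> carries the coefficients into the target ring, so one evaluation
  serves several uses: values over the field, specialisation of integer polynomials, substitution
  (with \<open>mconst\<close>), and polynomials in \<open>u\<close> over \<open>F[y]\<close>, where
  a coefficient becomes a constant of a constant.\<close>

definition meval :: "('a::zero \<Rightarrow> 'b::comm_ring_1) \<Rightarrow> ('v, 'a) mpoly \<Rightarrow> ('v \<Rightarrow> 'b) \<Rightarrow> 'b" where
  "meval \<phi> p x = (\<Sum>m\<in>Poly_Mapping.keys p. \<phi> (Poly_Mapping.lookup p m) * monomial_value x m)"

lemma msubst_eq_meval: "msubst f q = meval mconst f q"
  by (simp add: msubst_def meval_def monomial_value_def)

lemma meval_superset:
  assumes "finite M" "Poly_Mapping.keys p \<subseteq> M" "\<phi> 0 = 0"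
  shows "meval \<phi> p x = (\<Sum>m\<in>M. \<phi> (Poly_Mapping.lookup p m) * monomial_value x m)"
  unfolding meval_def
  by (rule sum.mono_neutral_left) (use assms in \<open>auto simp: in_keys_iff\<close>)

lemma meval_cong:
  assumes "\<And>v. v \<in> mvars p \<Longrightarrow> x v = y v"
  shows "meval \<phi> p x = meval \<phi> p y"
proof -
  have "x v = y v" if "m \<in> Poly_Mapping.keys p" "v \<in> Poly_Mapping.keys m" for m v
    using that by (intro assms) (auto simp: mvars_def)
  then have "monomial_value x m = monomial_value y m" if "m \<in> Poly_Mapping.keys p" for m
    unfolding monomial_value_def using that by (intro prod.cong) simp_all
  then show ?thesis
    unfolding meval_def by (intro sum.cong) simp_all
qed

lemma rm_meval:
  assumes "ring_morphism \<rho>"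
  shows "\<rho> (meval \<phi> p x) = meval (\<lambda>a. \<rho> (\<phi> a)) p (\<lambda>v. \<rho> (x v))"
  using assms by (simp add: meval_def rm_sum rm_mult rm_monomial_value)

lemma meval_single: "\<phi> 0 = 0 \<Longrightarrow> meval \<phi> (Poly_Mapping.single m c) x = \<phi> c * monomial_value x m"
  by (cases "c = 0") (auto simp: meval_def)

lemma meval_mconst: "\<phi> 0 = 0 \<Longrightarrow> meval \<phi> (mconst c) x = \<phi> c"
  by (simp add: mconst_def meval_single)

lemma meval_mvar: "\<phi> 0 = 0 \<Longrightarrow> \<phi> 1 = 1 \<Longrightarrow> meval \<phi> (mvar v) x = x v"
  by (simp add: mvar_def meval_single monomial_value_single)

lemma meval_add:
  assumes "ring_morphism \<phi>"
  shows "meval \<phi> (p + q) x = meval \<phi> p x + meval \<phi> q x"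
proof -
  let ?M = "Poly_Mapping.keys p \<union> Poly_Mapping.keys q"
  have "Poly_Mapping.keys (p + q) \<subseteq> ?M" by (rule keys_add)
  then show ?thesis
    using rm_zero[OF assms]
    by (simp add: meval_superset[where M = ?M] lookup_add rm_add[OF assms] algebra_simps sum.distrib)
qed

lemma meval_sum:
  assumes "ring_morphism \<phi>"
  shows "meval \<phi> (sum p A) x = (\<Sum>i\<in>A. meval \<phi> (p i) x)"
  by (induction A rule: infinite_finite_induct) (simp_all add: meval_add[OF assms], simp_all add: meval_def)

lemma meval_mult:
  fixes \<phi> :: "'a::comm_ring_1 \<Rightarrow> 'b::comm_ring_1"
  assumes "ring_morphism \<phi>"
  shows "meval \<phi> (p * q) x = meval \<phi> p x * meval \<phi> q x"
proof -
  let ?s = "\<lambda>p m. Poly_Mapping.single m (Poly_Mapping.lookup p m)"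
  note z = rm_zero[OF assms]
  have dec: "p = sum (?s p) (Poly_Mapping.keys p)" for p :: "('v, 'a) mpoly"
    by (rule poly_mapping_eqI) (simp add: lookup_sum lookup_single when_def in_keys_iff sum.delta')
  have "p * q = (\<Sum>m\<in>Poly_Mapping.keys p. \<Sum>m'\<in>Poly_Mapping.keys q. ?s p m * ?s q m')"
    by (subst dec[of p], subst dec[of q]) (simp add: sum_product)
  then have "meval \<phi> (p * q) x =
      (\<Sum>m\<in>Poly_Mapping.keys p. \<Sum>m'\<in>Poly_Mapping.keys q. meval \<phi> (?s p m * ?s q m') x)"
    by (simp add: meval_sum[OF assms])
  also have "\<dots> = meval \<phi> p x * meval \<phi> q x"
    unfolding meval_def[of _ p] meval_def[of _ q] sum_product
    by (intro sum.cong refl)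
       (simp add: mult_single meval_single z rm_mult[OF assms] monomial_value_add mult_ac)
  finally show ?thesis .
qed

lemma ring_morphism_meval: "ring_morphism \<phi> \<Longrightarrow> ring_morphism (\<lambda>p. meval \<phi> p x)"
  by (rule ring_morphismI) (simp_all add: meval_add meval_mult, simp add: meval_def rm_one)

lemma meval_msubst:
  assumes "ring_morphism \<phi>"
  shows "meval \<phi> (msubst f q) x = meval \<phi> f (\<lambda>v. meval \<phi> (q v) x)"
  unfolding msubst_eq_meval
  by (subst rm_meval[OF ring_morphism_meval[OF assms]]) (simp add: meval_mconst rm_zero[OF assms])

section \<open>Weighted degrees\<close>

definition weight :: "('v \<Rightarrow> nat) \<Rightarrow> ('v \<Rightarrow>\<^sub>0 nat) \<Rightarrow> nat" where
  "weight w m = (\<Sum>v\<in>Poly_Mapping.keys m. w v * Poly_Mapping.lookup m v)"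

lemma weight_superset:
  assumes "finite V" "Poly_Mapping.keys m \<subseteq> V"
  shows "weight w m = (\<Sum>v\<in>V. w v * Poly_Mapping.lookup m v)"
  unfolding weight_def
  by (rule sum.mono_neutral_left) (use assms in \<open>auto simp: in_keys_iff\<close>)

lemma weight_0 [simp]: "weight w 0 = 0"
  by (simp add: weight_def)

lemma weight_single [simp]: "weight w (Poly_Mapping.single v k) = w v * k"
  by (cases "k = 0") (auto simp: weight_def)

lemma weight_plus: "weight w (m + m') = weight w m + weight w m'"
proof -
  let ?V = "Poly_Mapping.keys m \<union> Poly_Mapping.keys m'"
  have "Poly_Mapping.keys (m + m') \<subseteq> ?V" by (rule keys_add)
  then show ?thesis
    by (simp add: weight_superset[where V = ?V] lookup_add algebra_simps sum.distrib)
qed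

lemma monomial_value_power: "monomial_value (\<lambda>v. t ^ w v) m = t ^ weight w m"
  by (simp add: monomial_value_def weight_def power_sum flip: power_mult)

text \<open>With weights 0 and 1 this bounds the degree in selected variables, and with bound 0 it
  excludes variables; so the closure lemmas below also serve \<open>polys_in\<close>.\<close>

definition weight_at_most :: "('v \<Rightarrow> nat) \<Rightarrow> nat \<Rightarrow> ('v, 'a::zero) mpoly set" where
  "weight_at_most w k = {p. \<forall>m\<in>Poly_Mapping.keys p. weight w m \<le> k}"

lemma weight_at_most_mono: "p \<in> weight_at_most w k \<Longrightarrow> k \<le> k' \<Longrightarrow> p \<in> weight_at_most w k'"
  by (force simp: weight_at_most_def)

lemma weight_at_most_add:
  "p \<in> weight_at_most w k \<Longrightarrow> q \<in> weight_at_most w k \<Longrightarrow> p + q \<in> weight_at_most w k"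
  using keys_add[of p q] by (auto simp: weight_at_most_def)

lemma weight_at_most_uminus:
  "(p :: ('v, 'a::ab_group_add) mpoly) \<in> weight_at_most w k \<Longrightarrow> - p \<in> weight_at_most w k"
  by (auto simp: weight_at_most_def in_keys_iff)

lemma weight_at_most_diff:
  "(p :: ('v, 'a::ab_group_add) mpoly) \<in> weight_at_most w k \<Longrightarrow> q \<in> weight_at_most w k \<Longrightarrow>
    p - q \<in> weight_at_most w k"
  unfolding diff_conv_add_uminus by (intro weight_at_most_add weight_at_most_uminus)

lemma weight_at_most_sum:
  "(\<And>i. i \<in> A \<Longrightarrow> p i \<in> weight_at_most w k) \<Longrightarrow> sum p A \<in> weight_at_most w k"
  by (induction A rule: infinite_finite_induct) (simp_all add: weight_at_most_add, simp_all add: weight_at_most_def)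

lemma weight_at_most_mult:
  assumes "p \<in> weight_at_most w k" "q \<in> weight_at_most w k'"
  shows "p * q \<in> weight_at_most w (k + k')"
proof -
  have "weight w m \<le> k + k'" if m: "m \<in> Poly_Mapping.keys (p * q)" for m
  proof -
    obtain a b where "a \<in> Poly_Mapping.keys p" "b \<in> Poly_Mapping.keys q" "m = a + b"
      using keys_mult[of p q] m by auto
    then show ?thesis
      using assms by (auto simp: weight_at_most_def weight_plus intro: add_mono)
  qed
  then show ?thesis by (simp add: weight_at_most_def)
qed

lemma weight_at_most_mconst: "mconst c \<in> weight_at_most w k"
  by (cases "c = 0") (auto simp: weight_at_most_def mconst_def)

lemma weight_at_most_1: "(1 :: ('v, 'a::comm_ring_1) mpoly) \<in> weight_at_most w k"
  by (simp add: weight_at_most_def)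

lemma weight_at_most_mvar: "w v \<le> k \<Longrightarrow> (mvar v :: ('v, 'a::comm_ring_1) mpoly) \<in> weight_at_most w k"
  by (auto simp: weight_at_most_def mvar_def)

lemma weight_at_most_power:
  "(p :: ('v, 'a::comm_ring_1) mpoly) \<in> weight_at_most w k \<Longrightarrow> p ^ j \<in> weight_at_most w (k * j)"
proof (induction j)
  case 0
  then show ?case by (simp add: weight_at_most_1)
next
  case (Suc j)
  then show ?case using weight_at_most_mult[of p w k "p ^ j" "k * j"] by simp
qed

lemma weight_at_most_prod:
  fixes p :: "'i \<Rightarrow> ('v, 'a::comm_ring_1) mpoly"
  assumes "\<And>i. i \<in> A \<Longrightarrow> p i \<in> weight_at_most w (k i)"
  shows "prod p A \<in> weight_at_most w (sum k A)"
  using assms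
proof (induction A rule: infinite_finite_induct)
  case (insert x F)
  then show ?case by (simp add: weight_at_most_mult)
qed (simp_all add: weight_at_most_1)

lemma monomial_degree_le_total_degree:
  "m \<in> Poly_Mapping.keys p \<Longrightarrow> monomial_degree m \<le> total_degree p"
  by (auto simp: total_degree_def intro!: Max_ge)

lemma weight_at_most_msubst:
  fixes f :: "('v, 'a::comm_ring_1) mpoly" and q :: "'v \<Rightarrow> ('w, 'a) mpoly"
  assumes "\<And>v. q v \<in> weight_at_most w k"
  shows "msubst f q \<in> weight_at_most w (k * total_degree f)"
  unfolding msubst_def
proof (rule weight_at_most_sum)
  fix m assume m: "m \<in> Poly_Mapping.keys f"
  have "(\<Prod>v\<in>Poly_Mapping.keys m. q v ^ Poly_Mapping.lookup m v)
      \<in> weight_at_most w (\<Sum>v\<in>Poly_Mapping.keys m. k * Poly_Mapping.lookup m v)"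
    by (intro weight_at_most_prod weight_at_most_power assms)
  then have "mconst (Poly_Mapping.lookup f m) * (\<Prod>v\<in>Poly_Mapping.keys m. q v ^ Poly_Mapping.lookup m v)
      \<in> weight_at_most w (0 + k * monomial_degree m)"
    unfolding monomial_degree_def sum_distrib_left by (intro weight_at_most_mult weight_at_most_mconst)
  then show "mconst (Poly_Mapping.lookup f m) * (\<Prod>v\<in>Poly_Mapping.keys m. q v ^ Poly_Mapping.lookup m v)
      \<in> weight_at_most w (k * total_degree f)"
    by (rule weight_at_most_mono) (simp add: monomial_degree_le_total_degree[OF m])
qed

lemma degree_meval_le:
  fixes f :: "('v, 'a::comm_ring_1) mpoly" and x :: "'v \<Rightarrow> 'b::comm_ring_1 poly"
  assumes "\<And>a. degree (\<phi> a) = 0" "\<And>v. degree (x v) \<le> k"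
  shows "degree (meval \<phi> f x) \<le> k * total_degree f"
  unfolding meval_def
proof (rule degree_sum_le)
  fix m assume m: "m \<in> Poly_Mapping.keys f"
  have "degree (monomial_value x m) \<le> (\<Sum>v\<in>Poly_Mapping.keys m. degree (x v ^ Poly_Mapping.lookup m v))"
    unfolding monomial_value_def by (rule order.trans[OF degree_prod_sum_le]) (simp_all add: o_def)
  also have "\<dots> \<le> (\<Sum>v\<in>Poly_Mapping.keys m. k * Poly_Mapping.lookup m v)"
    by (intro sum_mono order.trans[OF degree_power_le] mult_right_mono assms) auto
  also have "\<dots> = k * monomial_degree m" by (simp add: monomial_degree_def sum_distrib_left)
  also have "\<dots> \<le> k * total_degree f"
    by (simp add: monomial_degree_le_total_degree[OF m])
  finally have *: "degree (monomial_value x m) \<le> k * total_degree f" .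
  have "degree (\<phi> (Poly_Mapping.lookup f m) * monomial_value x m)
      \<le> degree (\<phi> (Poly_Mapping.lookup f m)) + degree (monomial_value x m)"
    by (rule degree_mult_le)
  with * show "degree (\<phi> (Poly_Mapping.lookup f m) * monomial_value x m) \<le> k * total_degree f"
    by (simp add: assms)
qed simp

section \<open>Non-vanishing and interpolation\<close>

lemma exists_nonvanishing_point:
  fixes c :: "'i \<Rightarrow> 'a::field" and E :: "'i \<Rightarrow> 'v \<Rightarrow> nat"
  assumes "finite W" "finite I" "i\<^sub>0 \<in> I" "c i\<^sub>0 \<noteq> 0" "D < card (A :: 'a set)"
    and "\<And>i j. i \<in> I \<Longrightarrow> j \<in> I \<Longrightarrow> (\<And>v. v \<in> W \<Longrightarrow> E i v = E j v) \<Longrightarrow> i = j"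
    and "\<And>i v. i \<in> I \<Longrightarrow> v \<in> W \<Longrightarrow> E i v \<le> D"
  shows "\<exists>x::'v \<Rightarrow> 'a. (\<Sum>i\<in>I. c i * (\<Prod>v\<in>W. x v ^ E i v)) \<noteq> 0"
  using assms
proof (induction W arbitrary: I rule: finite_induct)
  case empty
  then have "I = {i\<^sub>0}" by auto
  with empty show ?case by auto
next
  case (insert w W)
  define J where "J = {i \<in> I. E i w = E i\<^sub>0 w}"
  have "\<exists>x::'v \<Rightarrow> 'a. (\<Sum>i\<in>J. c i * (\<Prod>v\<in>W. x v ^ E i v)) \<noteq> 0"
  proof (rule insert.IH)
    fix i j assume ij: "i \<in> J" "j \<in> J" "\<And>v. v \<in> W \<Longrightarrow> E i v = E j v"
    have "E i v = E j v" if "v \<in> insert w W" for v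
      using that ij by (cases "v = w") (auto simp: J_def)
    with ij show "i = j" by (intro insert.prems(5)) (simp_all add: J_def)
  next
    show "finite J" "i\<^sub>0 \<in> J" using insert.prems by (simp_all add: J_def)
    show "E i v \<le> D" if "i \<in> J" "v \<in> W" for i v
      using that insert.prems by (simp add: J_def)
  qed (fact insert.prems)+
  then obtain x where x: "(\<Sum>i\<in>J. c i * (\<Prod>v\<in>W. x v ^ E i v)) \<noteq> 0" by auto
  define p where "p = (\<Sum>i\<in>I. monom (c i * (\<Prod>v\<in>W. x v ^ E i v)) (E i w))"
  have "coeff p (E i\<^sub>0 w) = (\<Sum>i\<in>I. if E i w = E i\<^sub>0 w then c i * (\<Prod>v\<in>W. x v ^ E i v) else 0)"
    by (simp add: p_def coeff_sum)
  also have "\<dots> = (\<Sum>i\<in>J. c i * (\<Prod>v\<in>W. x v ^ E i v))"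
    unfolding J_def by (simp add: sum.inter_filter[OF insert.prems(1)])
  finally have "p \<noteq> 0" using x by auto
  have "degree p \<le> D" unfolding p_def
    by (intro degree_sum_le insert.prems order.trans[OF degree_monom_le]) auto
  with \<open>p \<noteq> 0\<close> insert.prems(4) obtain t where t: "poly p t \<noteq> 0"
    using poly_eqI_degree[of A p 0] by (force intro: le_less_trans)
  have "(\<Sum>i\<in>I. c i * (\<Prod>v\<in>insert w W. (x(w := t)) v ^ E i v)) = poly p t"
    unfolding p_def poly_sum poly_monom
  proof (intro sum.cong refl)
    fix i assume "i \<in> I"
    have "(\<Prod>v\<in>W. (x(w := t)) v ^ E i v) = (\<Prod>v\<in>W. x v ^ E i v)"
      using insert.hyps by (intro prod.cong) auto
    then show "c i * (\<Prod>v\<in>insert w W. (x(w := t)) v ^ E i v) =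
        c i * (\<Prod>v\<in>W. x v ^ E i v) * t ^ E i w"
      using insert.hyps by (simp add: mult_ac)
  qed
  with t show ?case by metis
qed

lemma exists_nonvanishing_point_monomials:
  fixes c :: "('v \<Rightarrow>\<^sub>0 nat) \<Rightarrow> 'a::field"
  assumes "finite M" "m\<^sub>0 \<in> M" "c m\<^sub>0 \<noteq> 0" "D < card (A :: 'a set)"
    and "\<And>m v. m \<in> M \<Longrightarrow> Poly_Mapping.lookup m v \<le> D"
  shows "\<exists>x. (\<Sum>m\<in>M. c m * monomial_value x m) \<noteq> 0"
proof -
  define W where "W = (\<Union>m\<in>M. Poly_Mapping.keys m)"
  have W: "finite W" using assms by (auto simp: W_def)
  have "\<exists>x::'v \<Rightarrow> 'a. (\<Sum>m\<in>M. c m * (\<Prod>v\<in>W. x v ^ Poly_Mapping.lookup m v)) \<noteq> 0"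
  proof (rule exists_nonvanishing_point[where c = c and D = D and A = A and i\<^sub>0 = m\<^sub>0])
    fix m m' assume "m \<in> M" "m' \<in> M" and eq: "\<And>v. v \<in> W \<Longrightarrow> Poly_Mapping.lookup m v = Poly_Mapping.lookup m' v"
    have "Poly_Mapping.lookup m v = Poly_Mapping.lookup m' v" for v
    proof (cases "v \<in> W")
      case False
      then show ?thesis using \<open>m \<in> M\<close> \<open>m' \<in> M\<close> by (auto simp: W_def in_keys_iff)
    qed (rule eq)
    then show "m = m'" by (rule poly_mapping_eqI)
  qed (use assms W in auto)
  moreover have "monomial_value x m = (\<Prod>v\<in>W. x v ^ Poly_Mapping.lookup m v)" if "m \<in> M" for m and x :: "'v \<Rightarrow> 'a"
    using that W by (intro monomial_value_superset) (auto simp: W_def)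
  ultimately show ?thesis by simp
qed

text \<open>Lagrange interpolation, reading off coefficient \<open>N\<close> of each basis
  polynomial. The points, and hence the weights \<open>c k\<close>, lie in the field although
  \<open>H\<close> has coefficients in \<open>F[y]\<close>; so an addition gate can form the
  right-hand side.\<close>

lemma coeff_interpolation:
  fixes u :: "nat \<Rightarrow> 'a::field"
  assumes "inj_on u {..D}"
  shows "\<exists>c. \<forall>H :: (nat, 'a) mpoly poly. degree H \<le> D \<longrightarrow>
    coeff H N = (\<Sum>k\<le>D. mconst (c k) * poly H (mconst (u k)))"
proof -
  define L where "L k = smult (inverse (\<Prod>j\<in>{..D} - {k}. u k - u j)) (\<Prod>j\<in>{..D} - {k}. [:- u j, 1:])" for k
  have degL: "degree (L k) \<le> D" if "k \<le> D" for k
  proof -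
    have "degree (\<Prod>j\<in>{..D} - {k}. [:- u j, 1:]) \<le> (\<Sum>j\<in>{..D} - {k}. degree [:- u j, 1:])"
      by (rule order.trans[OF degree_prod_sum_le]) (simp_all add: o_def)
    also have "\<dots> = D" using that by simp
    finally show ?thesis unfolding L_def by (rule order.trans[OF degree_smult_le])
  qed
  have polyL: "poly (L k) (u j) = (if j = k then 1 else 0)" if "k \<le> D" "j \<le> D" for k j
  proof (cases "j = k")
    case True
    have "(\<Prod>j\<in>{..D} - {k}. u k - u j) \<noteq> 0"
      using that assms by (auto simp: inj_on_def)
    then show ?thesis using True by (simp add: L_def poly_prod)
  next
    case False
    then have "(\<Prod>i\<in>{..D} - {k}. u j - u i) = 0"
      using that by (intro prod_zero bexI[of _ j]) auto
    then show ?thesis using False by (simp add: L_def poly_prod)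
  qed
  \<comment> \<open>Both sides have degree at most \<open>D\<close> and agree at
    \<open>D + 1\<close> points. Comparing coefficients at \<open>N\<close> then inverts the
    Vandermonde system.\<close>
  have power: "(\<Sum>k\<le>D. smult (u k ^ j) (L k)) = monom 1 j" if "j \<le> D" for j
  proof (rule poly_eqI_degree[where A = "u ` {..D}"])
    fix x assume "x \<in> u ` {..D}"
    then obtain i where i: "i \<le> D" "x = u i" by auto
    have "poly (\<Sum>k\<le>D. smult (u k ^ j) (L k)) x = (\<Sum>k\<le>D. if i = k then u k ^ j else 0)"
      unfolding poly_sum using i by (intro sum.cong) (simp_all add: polyL)
    also have "\<dots> = u i ^ j" using i by simp
    finally show "poly (\<Sum>k\<le>D. smult (u k ^ j) (L k)) x = poly (monom 1 j) x"
      using i by (simp add: poly_monom)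
  next
    have "degree (\<Sum>k\<le>D. smult (u k ^ j) (L k)) \<le> D"
      by (intro degree_sum_le order.trans[OF degree_smult_le] degL) auto
    then show "degree (\<Sum>k\<le>D. smult (u k ^ j) (L k)) < card (u ` {..D})"
      by (simp add: card_image assms)
    show "degree (monom (1::'a) j) < card (u ` {..D})"
      using that by (simp add: card_image assms degree_monom_eq)
  qed
  have sum1: "(\<Sum>k\<le>D. coeff (L k) N * u k ^ j) = (if j = N then 1 else 0)" if "j \<le> D" for j
    using arg_cong[OF power[OF that], of "\<lambda>p. coeff p N"] by (simp add: coeff_sum mult.commute)
  note rm = ring_morphism_mconst
  have evalH: "poly H y = (\<Sum>j\<le>D. coeff H j * y ^ j)" if "degree H \<le> D" for H :: "(nat, 'a) mpoly poly" and y
    unfolding poly_altdef using that by (intro sum.mono_neutral_left) (auto simp: coeff_eq_0)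
  have "coeff H N = (\<Sum>k\<le>D. mconst (coeff (L k) N) * poly H (mconst (u k)))"
    if "degree H \<le> D" for H :: "(nat, 'a) mpoly poly"
  proof -
    have "(\<Sum>k\<le>D. mconst (coeff (L k) N) * poly H (mconst (u k))) =
       (\<Sum>k\<le>D. \<Sum>j\<le>D. mconst (coeff (L k) N) * (coeff H j * mconst (u k) ^ j))"
      by (simp add: evalH[OF that] sum_distrib_left)
    also have "\<dots> = (\<Sum>j\<le>D. coeff H j * mconst (\<Sum>k\<le>D. coeff (L k) N * u k ^ j))"
      unfolding rm_sum[OF rm] rm_mult[OF rm] rm_power[OF rm] sum_distrib_left
      by (subst sum.swap) (intro sum.cong refl mult.left_commute)
    also have "\<dots> = (\<Sum>j\<le>D. if j = N then coeff H j else 0)"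
      by (rule sum.cong) (auto simp: sum1)
    also have "\<dots> = coeff H N"
      using that by (cases "N \<le> D") (auto intro!: coeff_eq_0)
    finally show ?thesis by (rule sym)
  qed
  then show ?thesis by (intro exI[of _ "\<lambda>k. coeff (L k) N"]) simp
qed

section \<open>Pfaffians of skew-symmetric matrices of small rank\<close>

text \<open>Every orbit has exactly \<open>card I\<close> elements, and \<open>T\<close> is constant
  on it. The action is described pointwise, so \<open>I\<close> needs no group structure; inverses
  are replaced by counting, since an orbit contained in another of the same size equals it.\<close>

lemma free_action_dvd_sum:
  fixes T :: "'p \<Rightarrow> 'r::comm_ring_1"
  assumes fin: "finite \<Omega>" "finite I"
    and act: "\<And>i \<pi>. i \<in> I \<Longrightarrow> \<pi> \<in> \<Omega> \<Longrightarrow> act i \<pi> \<in> \<Omega>"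
    and inv: "\<And>i \<pi>. i \<in> I \<Longrightarrow> \<pi> \<in> \<Omega> \<Longrightarrow> T (act i \<pi>) = T \<pi>"
    and inj: "\<And>\<pi>. \<pi> \<in> \<Omega> \<Longrightarrow> inj_on (\<lambda>i. act i \<pi>) I"
    and id: "\<And>\<pi>. \<pi> \<in> \<Omega> \<Longrightarrow> \<exists>i\<in>I. act i \<pi> = \<pi>"
    and comp: "\<And>i j \<pi>. i \<in> I \<Longrightarrow> j \<in> I \<Longrightarrow> \<pi> \<in> \<Omega> \<Longrightarrow> \<exists>k\<in>I. act i (act j \<pi>) = act k \<pi>"
  shows "of_nat (card I) dvd (\<Sum>\<pi>\<in>\<Omega>. T \<pi>)"
proof -
  define orb where "orb \<pi> = (\<lambda>i. act i \<pi>) ` I" for \<pi>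
  have card_orb: "card (orb \<pi>) = card I" if "\<pi> \<in> \<Omega>" for \<pi>
    by (simp add: orb_def card_image inj that)
  have fin_orb: "finite (orb \<pi>)" for \<pi>
    by (simp add: orb_def fin)
  have self: "\<pi> \<in> orb \<pi>" if "\<pi> \<in> \<Omega>" for \<pi>
    using id[OF that] by (force simp: orb_def)
  have same: "orb \<rho> = orb \<pi>" if "\<pi> \<in> \<Omega>" "\<rho> \<in> orb \<pi>" for \<pi> \<rho>
  proof (rule card_subset_eq[OF fin_orb])
    from that obtain j where j: "j \<in> I" "\<rho> = act j \<pi>" by (auto simp: orb_def)
    then show "orb \<rho> \<subseteq> orb \<pi>" using comp[OF _ j(1) that(1)] by (auto simp: orb_def)
    show "card (orb \<rho>) = card (orb \<pi>)" using j that act by (simp add: card_orb)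
  qed
  have Un: "\<Omega> = \<Union> (orb ` \<Omega>)" using self act by (auto simp: orb_def)
  have disj: "Q \<inter> Q' = {}" if "Q \<in> orb ` \<Omega>" "Q' \<in> orb ` \<Omega>" "Q \<noteq> Q'" for Q Q'
    using that same by blast
  have "(\<Sum>\<pi>\<in>\<Omega>. T \<pi>) = (\<Sum>Q\<in>orb ` \<Omega>. sum T Q)"
    by (subst Un, subst sum.Union_disjoint) (use fin_orb disj in auto)
  moreover have "of_nat (card I) dvd sum T Q" if "Q \<in> orb ` \<Omega>" for Q
  proof -
    obtain \<pi> where \<pi>: "\<pi> \<in> \<Omega>" "Q = orb \<pi>" using \<open>Q \<in> orb ` \<Omega>\<close> by auto
    have "sum T Q = (\<Sum>\<rho>\<in>orb \<pi>. T \<pi>)"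
      unfolding \<pi> by (rule sum.cong) (use inv \<pi> in \<open>auto simp: orb_def\<close>)
    then show ?thesis using \<pi> by (simp add: card_orb)
  qed
  ultimately show ?thesis by (simp add: dvd_sum)
qed

section \<open>Permutations of the pairs \<open>{2 i - 1, 2 i}\<close> and flips inside them\<close>

definition double_perm :: "(nat \<Rightarrow> nat) \<Rightarrow> nat \<Rightarrow> nat" where
  "double_perm \<sigma> j = (if odd j then 2 * \<sigma> ((j + 1) div 2) - 1 else 2 * \<sigma> (j div 2))"

text \<open>\<open>(j + 1) div 2\<close> is the \<open>i\<close> whose pair
  \<open>{2 i - 1, 2 i}\<close> contains \<open>j\<close>. The argument 0 is fixed even if
  \<open>0 \<in> E\<close>, by truncated subtraction.\<close>

definition flip_pairs :: "nat set \<Rightarrow> nat \<Rightarrow> nat" where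
  "flip_pairs E j = (if (j + 1) div 2 \<in> E then (if odd j then j + 1 else j - 1) else j)"

lemma pair_cases [case_names zero odd even]:
  obtains "(j::nat) = 0" | i where "1 \<le> i" "j = 2 * i - 1" | i where "1 \<le> i" "j = 2 * i"
proof -
  have "j = 0 \<or> (\<exists>i\<ge>1. j = 2 * i - 1) \<or> (\<exists>i\<ge>1. j = 2 * i)"
  proof (cases "even j")
    case True
    then show ?thesis by (cases "j = 0") (auto elim!: evenE)
  next
    case False
    then obtain b where "j = 2 * b + 1" by (auto elim!: oddE)
    then have "j = 2 * (b + 1) - 1" "1 \<le> b + 1" by auto
    then show ?thesis by blast
  qed
  then show thesis by (elim disjE exE conjE) (fact that)+
qed

lemma double_perm_odd: "1 \<le> i \<Longrightarrow> double_perm \<sigma> (2 * i - 1) = 2 * \<sigma> i - 1"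
  and double_perm_even: "double_perm \<sigma> (2 * i) = 2 * \<sigma> i"
  by (auto simp: double_perm_def)

lemma flip_pairs_odd: "1 \<le> i \<Longrightarrow> flip_pairs E (2 * i - 1) = (if i \<in> E then 2 * i else 2 * i - 1)"
  and flip_pairs_even: "flip_pairs E (2 * i) = (if i \<in> E then 2 * i - 1 else 2 * i)"
  by (auto simp: flip_pairs_def)

lemma double_perm_0: "double_perm \<sigma> 0 = 2 * \<sigma> 0"
  and flip_pairs_0: "flip_pairs E 0 = 0"
  by (simp_all add: double_perm_def flip_pairs_def)

lemmas pair_simps = double_perm_odd double_perm_even flip_pairs_odd flip_pairs_even

lemma permutes_pos: "\<sigma> permutes {1..k} \<Longrightarrow> 1 \<le> i \<Longrightarrow> 1 \<le> \<sigma> (i::nat)"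
  using permutes_in_image[of \<sigma> "{1..k}" i] permutes_not_in[of \<sigma> "{1..k}" i] by (cases "i \<le> k") auto

lemma permutes_zero: "\<sigma> permutes {1..k} \<Longrightarrow> \<sigma> (0::nat) = 0"
  by (simp add: permutes_not_in)

text \<open>Positive indices must stay positive, because truncated subtraction makes
  \<open>2 * 0 - 1\<close> even; this is what the two hypotheses provide.\<close>

lemma double_perm_comp:
  assumes "\<sigma> permutes {1..k}" "\<tau> permutes {1..k}"
  shows "double_perm (\<sigma> \<circ> \<tau>) = double_perm \<sigma> \<circ> double_perm \<tau>"
proof
  fix j
  show "double_perm (\<sigma> \<circ> \<tau>) j = (double_perm \<sigma> \<circ> double_perm \<tau>) j"
  proof (cases j rule: pair_cases)
    case zero
    then show ?thesis using permutes_zero[OF assms(1)] permutes_zero[OF assms(2)] by (simp add: double_perm_0)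
  next
    case (odd i)
    then show ?thesis by (simp add: pair_simps permutes_pos[OF assms(2)] del: One_nat_def)
  next
    case (even i)
    then show ?thesis by (simp add: pair_simps)
  qed
qed

lemma double_perm_transpose:
  assumes "1 \<le> a" "1 \<le> b"
  shows "double_perm (transpose a b) = transpose (2 * a - 1) (2 * b - 1) \<circ> transpose (2 * a) (2 * b)"
proof
  fix j
  have [simp]: "2 * i - 1 \<noteq> 2 * (i'::nat)" if "1 \<le> i" for i i' using that by presburger
  have [simp]: "2 * i \<noteq> 2 * (i'::nat) - 1" if "1 \<le> i'" for i i' using that by presburger
  have [simp]: "(2 * i - 1 = 2 * (i'::nat) - 1) = (i = i')" if "1 \<le> i" "1 \<le> i'" for i i' using that by presburger
  show "double_perm (transpose a b) j = (transpose (2 * a - 1) (2 * b - 1) \<circ> transpose (2 * a) (2 * b)) j"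
  proof (cases j rule: pair_cases)
    case zero
    then show ?thesis using assms by (simp add: double_perm_0 transpose_def)
  next
    case (odd i)
    then show ?thesis using assms by (simp add: pair_simps transpose_def del: One_nat_def)
  next
    case (even i)
    then show ?thesis using assms by (simp add: pair_simps transpose_def del: One_nat_def)
  qed
qed

text \<open>Swapping two pairs is a product of two transpositions, hence even; the rest is induction
  over transpositions.\<close>

lemma double_perm_permutes:
  assumes "\<sigma> permutes {1..k}"
  shows "double_perm \<sigma> permutes {1..2 * k} \<and> sign (double_perm \<sigma>) = 1"
  using assms finite_atLeastAtMost[of 1 k]
proof (induction rule: permutes_induct)
  case id
  have "double_perm id = id"
  proof
    show "double_perm id j = id j" for j
      by (cases j rule: pair_cases) (simp_all add: pair_simps double_perm_0 del: One_nat_def)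
  qed
  then show ?case by (simp only: permutes_id sign_id simp_thms)
next
  case (swap a b p)
  have eq: "double_perm (transpose a b \<circ> p) =
      transpose (2 * a - 1) (2 * b - 1) \<circ> (transpose (2 * a) (2 * b) \<circ> double_perm p)"
    using swap.hyps by (subst double_perm_comp[where k = k])
      (auto simp: double_perm_transpose permutes_swap_id o_assoc)
  have p1: "transpose (2 * a) (2 * b) permutes {1..2 * k}"
    and p2: "transpose (2 * a - 1) (2 * b - 1) permutes {1..2 * k}"
    using swap.hyps by (auto intro!: permutes_swap_id)
  note p3 = permutes_compose[OF conjunct1[OF swap.IH] p1]
  note perm = permutes_imp_permutation[OF finite_atLeastAtMost]
  have "2 * a \<noteq> 2 * b" "2 * a - 1 \<noteq> 2 * b - 1" using swap.hyps by auto
  then have "sign (double_perm (transpose a b \<circ> p)) = 1"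
    unfolding eq using swap.IH
    by (simp only: sign_compose[OF perm[OF p2] perm[OF p3]]
        sign_compose[OF perm[OF p1] perm[OF conjunct1[OF swap.IH]]] sign_swap_id) simp
  then show ?case unfolding eq using permutes_compose[OF p3 p2] by blast
qed

lemma flip_pairs_permutes:
  assumes "E \<subseteq> {1..k}"
  shows "flip_pairs E permutes {1..2 * k} \<and> sign (flip_pairs E) = (- 1) ^ card E"
proof -
  have "finite E" using assms finite_subset by blast
  then show ?thesis using assms
  proof (induction E rule: finite_induct)
    case empty
    have "flip_pairs {} = id" by (auto simp: flip_pairs_def)
    then show ?case by (simp only: permutes_id sign_id card.empty power_0 simp_thms)
  next
    case (insert i E)
    have eq: "flip_pairs (insert i E) = transpose (2 * i - 1) (2 * i) \<circ> flip_pairs E"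
    proof
      fix j
      have "1 \<le> i" using insert.prems by simp
      have ne: "2 * a - 1 \<noteq> 2 * b" if "1 \<le> a" for a b :: nat using that by presburger
      show "flip_pairs (insert i E) j = (transpose (2 * i - 1) (2 * i) \<circ> flip_pairs E) j"
      proof (cases j rule: pair_cases)
        case zero
        with \<open>1 \<le> i\<close> show ?thesis by (simp add: flip_pairs_0 transpose_def)
      next
        case (odd a)
        then have "a \<noteq> i \<Longrightarrow> 2 * a - 1 \<noteq> 2 * i - 1" using \<open>1 \<le> i\<close> by linarith
        with odd \<open>1 \<le> i\<close> insert.hyps ne ne[symmetric] show ?thesis
          by (cases "a = i") (simp_all add: pair_simps transpose_def del: One_nat_def)
      next
        case (even a)
        then have "a \<noteq> i \<Longrightarrow> 2 * a - 1 \<noteq> 2 * i - 1" using \<open>1 \<le> i\<close> by linarith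
        with even \<open>1 \<le> i\<close> insert.hyps ne ne[symmetric] show ?thesis
          by (cases "a = i") (simp_all add: pair_simps transpose_def del: One_nat_def)
      qed
    qed
    have IH: "flip_pairs E permutes {1..2 * k}" "sign (flip_pairs E) = (- 1) ^ card E"
      using insert by auto
    have p: "transpose (2 * i - 1) (2 * i) permutes {1..2 * k}"
      using insert.prems by (intro permutes_swap_id) auto
    note perm = permutes_imp_permutation[OF finite_atLeastAtMost]
    have "2 * i - 1 \<noteq> 2 * i" using insert.prems by auto
    then have "sign (transpose (2 * i - 1) (2 * i) \<circ> flip_pairs E) = (- 1) ^ card (insert i E)"
      unfolding sign_compose[OF perm[OF p] perm[OF IH(1)]] sign_swap_id IH(2) using insert.hyps by simp
    then show ?case unfolding eq using permutes_compose[OF IH(1) p] by blast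
  qed
qed

text \<open>This commutation rule makes the products
  \<open>double_perm \<sigma> \<circ> flip_pairs E\<close> closed under composition, as in a
  semidirect product.\<close>

lemma flip_pairs_double_perm:
  assumes "\<sigma> permutes {1..k}"
  shows "flip_pairs E \<circ> double_perm \<sigma> = double_perm \<sigma> \<circ> flip_pairs (\<sigma> -` E)"
proof
  fix j
  show "(flip_pairs E \<circ> double_perm \<sigma>) j = (double_perm \<sigma> \<circ> flip_pairs (\<sigma> -` E)) j"
    by (cases j rule: pair_cases)
      (simp_all add: pair_simps double_perm_0 flip_pairs_0 permutes_pos[OF assms] permutes_zero[OF assms]
        del: One_nat_def)
qed

lemma flip_pairs_comp:
  "flip_pairs E \<circ> flip_pairs E' = flip_pairs ((E - E') \<union> (E' - E))"
proof
  fix j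
  show "(flip_pairs E \<circ> flip_pairs E') j = flip_pairs ((E - E') \<union> (E' - E)) j"
    by (cases j rule: pair_cases)
      (simp_all add: pair_simps flip_pairs_0 del: One_nat_def)
qed

text \<open>The permutations of the pairs and the flips inside the pairs act freely on the terms.\<close>

lemma pfaffian_sum_dvd:
  fixes A :: "nat \<Rightarrow> nat \<Rightarrow> 'r::comm_ring_1"
  assumes skew: "\<And>i j. A j i = - A i j"
  shows "of_nat (2 ^ k * fact k) dvd
    (\<Sum>\<pi> | \<pi> permutes {1..2 * k}. of_int (sign \<pi>) * (\<Prod>i=1..k. A (\<pi> (2 * i - 1)) (\<pi> (2 * i))))"
proof -
  let ?T = "\<lambda>\<pi>. of_int (sign \<pi>) * (\<Prod>i=1..k. A (\<pi> (2 * i - 1)) (\<pi> (2 * i)))"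
  define I where "I = {\<sigma>. \<sigma> permutes {1..k}} \<times> Pow {1..k}"
  define h where "h x = double_perm (fst x) \<circ> flip_pairs (snd x)" for x
  have hp: "h x permutes {1..2 * k}" "sign (h x) = (- 1) ^ card (snd x)" if "x \<in> I" for x
  proof -
    have d: "double_perm (fst x) permutes {1..2 * k}" "sign (double_perm (fst x)) = 1"
      and f: "flip_pairs (snd x) permutes {1..2 * k}" "sign (flip_pairs (snd x)) = (- 1) ^ card (snd x)"
      using that double_perm_permutes[of "fst x" k] flip_pairs_permutes[of "snd x" k] by (auto simp: I_def)
    show "h x permutes {1..2 * k}" unfolding h_def by (rule permutes_compose[OF f(1) d(1)])
    show "sign (h x) = (- 1) ^ card (snd x)" unfolding h_def
      using sign_compose[OF permutes_imp_permutation[OF _ d(1)] permutes_imp_permutation[OF _ f(1)]]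
      by (simp add: d f)
  qed
  have "of_nat (card I) dvd (\<Sum>\<pi> | \<pi> permutes {1..2 * k}. ?T \<pi>)"
  proof (rule free_action_dvd_sum[where act = "\<lambda>x \<pi>. \<pi> \<circ> h x"])
    show "finite {\<pi>. \<pi> permutes {1..2 * k}}" by (simp add: finite_permutations)
    show "finite I" by (simp add: I_def finite_permutations)
  next
    fix x \<pi> assume x: "x \<in> I" and \<pi>: "\<pi> \<in> {\<pi>. \<pi> permutes {1..2 * k}}"
    then show "\<pi> \<circ> h x \<in> {\<pi>. \<pi> permutes {1..2 * k}}"
      using permutes_compose[OF hp(1)[OF x]] by auto
    have \<sigma>: "fst x permutes {1..k}" and E: "snd x \<subseteq> {1..k}" using x by (auto simp: I_def)
    \<comment> \<open>Each flip changes the sign of the permutation and, by skew-symmetry, the sign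
      of one factor; in every term the two changes cancel.\<close>
    have sgn: "sign (\<pi> \<circ> h x) = sign \<pi> * (- 1) ^ card (snd x)"
      using sign_compose[of \<pi> "h x"] \<pi> hp[OF x] permutes_imp_permutation[of "{1..2 * k}"] by auto
    have "(\<Prod>i=1..k. A ((\<pi> \<circ> h x) (2 * i - 1)) ((\<pi> \<circ> h x) (2 * i))) =
       (\<Prod>i=1..k. (if i \<in> snd x then - 1 else 1) * A (\<pi> (2 * fst x i - 1)) (\<pi> (2 * fst x i)))"
    proof (rule prod.cong)
      fix i assume "i \<in> {1..k}"
      then show "A ((\<pi> \<circ> h x) (2 * i - 1)) ((\<pi> \<circ> h x) (2 * i)) =
          (if i \<in> snd x then - 1 else 1) * A (\<pi> (2 * fst x i - 1)) (\<pi> (2 * fst x i))"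
        using skew[of "\<pi> (2 * fst x i - 1)" "\<pi> (2 * fst x i)"] by (simp add: h_def pair_simps del: One_nat_def)
    qed simp
    also have "\<dots> = (\<Prod>i=1..k. (if i \<in> snd x then - 1 else 1)) * (\<Prod>i=1..k. A (\<pi> (2 * fst x i - 1)) (\<pi> (2 * fst x i)))"
      by (rule prod.distrib)
    also have "(\<Prod>i=1..k. (if i \<in> snd x then - 1 else 1::'r)) = (- 1) ^ card (snd x)"
      using E by (simp add: prod.If_cases Int_absorb1)
    also have "(\<Prod>i=1..k. A (\<pi> (2 * fst x i - 1)) (\<pi> (2 * fst x i))) = (\<Prod>i=1..k. A (\<pi> (2 * i - 1)) (\<pi> (2 * i)))"
      using prod.permute[OF \<sigma>, of "\<lambda>i. A (\<pi> (2 * i - 1)) (\<pi> (2 * i))"] by (simp add: o_def)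
    finally have *: "(\<Prod>i=1..k. A ((\<pi> \<circ> h x) (2 * i - 1)) ((\<pi> \<circ> h x) (2 * i))) =
      (- 1) ^ card (snd x) * (\<Prod>i=1..k. A (\<pi> (2 * i - 1)) (\<pi> (2 * i)))" .
    show "?T (\<pi> \<circ> h x) = ?T \<pi>"
      unfolding * sgn by (cases "even (card (snd x))") simp_all
  next
    fix \<pi> assume \<pi>: "\<pi> \<in> {\<pi>. \<pi> permutes {1..2 * k}}"
    show "inj_on (\<lambda>x. \<pi> \<circ> h x) I"
    proof (rule inj_onI)
      fix x y assume x: "x \<in> I" and y: "y \<in> I" and eq: "\<pi> \<circ> h x = \<pi> \<circ> h y"
      have inj: "inj \<pi>" using \<pi> permutes_inj by auto
      then have hh: "h x j = h y j" for j using fun_cong[OF eq, of j] by (simp add: inj_eq)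
      \<comment> \<open>For \<open>i\<close> in \<open>{1..k}\<close>, the value of
        \<open>h x\<close> at \<open>2 * i\<close> reveals the image of the pair, and its parity
        reveals whether \<open>i\<close> is flipped.\<close>
      have "fst x i = fst y i \<and> (i \<in> snd x \<longleftrightarrow> i \<in> snd y)" for i
      proof (cases "i \<in> {1..k}")
        case True
        then have "1 \<le> i" by simp
        then have "1 \<le> fst x i" "1 \<le> fst y i"
          using x y permutes_pos[of "fst x" k] permutes_pos[of "fst y" k] by (auto simp: I_def)
        with \<open>1 \<le> i\<close> hh[of "2 * i"] show ?thesis
          by (auto simp: h_def pair_simps split: if_splits simp del: One_nat_def) presburger+
      next
        case False
        then show ?thesis using x y permutes_not_in[of "fst x" "{1..k}" i] permutes_not_in[of "fst y" "{1..k}" i]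
          by (auto simp: I_def)
      qed
      then show "x = y" by (auto simp: prod_eq_iff)
    qed
    have "h (id, {}) = id"
    proof
      show "h (id, {}) j = id j" for j
        by (cases j rule: pair_cases)
          (simp_all add: h_def pair_simps double_perm_0 flip_pairs_0 del: One_nat_def)
    qed
    then show "\<exists>x\<in>I. \<pi> \<circ> h x = \<pi>"
      by (intro bexI[of _ "(id, {})"]) (auto simp: I_def permutes_id)
  next
    fix x y \<pi> assume x: "x \<in> I" and y: "y \<in> I" and "\<pi> \<in> {\<pi>. \<pi> permutes {1..2 * k}}"
    obtain \<sigma> E \<tau> F where xy: "x = (\<sigma>, E)" "y = (\<tau>, F)" by (cases x, cases y)
    have \<sigma>\<tau>: "\<sigma> permutes {1..k}" "\<tau> permutes {1..k}" "E \<subseteq> {1..k}" "F \<subseteq> {1..k}"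
      using x y by (auto simp: I_def xy)
    define G where "G = (\<sigma> -` F - E) \<union> (E - \<sigma> -` F)"
    have pre: "\<sigma> -` F \<subseteq> {1..k}" using \<sigma>\<tau> permutes_in_image[of \<sigma> "{1..k}"] by blast
    have "h y \<circ> h x = double_perm \<tau> \<circ> (flip_pairs F \<circ> double_perm \<sigma>) \<circ> flip_pairs E"
      by (simp add: h_def xy o_assoc)
    also have "\<dots> = (double_perm \<tau> \<circ> double_perm \<sigma>) \<circ> (flip_pairs (\<sigma> -` F) \<circ> flip_pairs E)"
      by (simp add: flip_pairs_double_perm[OF \<sigma>\<tau>(1)] o_assoc)
    also have "\<dots> = h (\<tau> \<circ> \<sigma>, G)"
      by (simp add: h_def double_perm_comp[OF \<sigma>\<tau>(2,1)] G_def flip_pairs_comp)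
    finally have "(\<pi> \<circ> h y) \<circ> h x = \<pi> \<circ> h (\<tau> \<circ> \<sigma>, G)" by (simp add: o_assoc[symmetric])
    moreover have "(\<tau> \<circ> \<sigma>, G) \<in> I"
      using \<sigma>\<tau> pre by (auto simp: I_def G_def permutes_compose)
    ultimately show "\<exists>z\<in>I. (\<pi> \<circ> h y) \<circ> h x = \<pi> \<circ> h z" by blast
  qed
  also have "card I = 2 ^ k * fact k"
    by (simp add: I_def card_cartesian_product card_permutations card_Pow)
  finally show ?thesis .
qed

text \<open>A determinant with two equal rows: composing with the transposition of \<open>s\<close>
  and \<open>t\<close> negates every term, so twice the sum is 0. The condition \<open>two\<close>
  is met by integer polynomial rings, where the lemma is eventually applied.\<close>

lemma alternating_sum_eq_0:
  fixes v :: "'s \<Rightarrow> 'i \<Rightarrow> 'r::comm_ring_1"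
  assumes "finite S" "s \<in> S" "t \<in> S" "s \<noteq> t" "c s = c t"
    and two: "\<And>x::'r. x + x = 0 \<Longrightarrow> x = 0"
  shows "(\<Sum>\<pi> | \<pi> permutes S. of_int (sign \<pi>) * (\<Prod>j\<in>S. v (c j) (\<pi> j))) = 0"
proof -
  let ?g = "\<lambda>\<pi>. of_int (sign \<pi>) * (\<Prod>j\<in>S. v (c j) (\<pi> j))"
  let ?t = "transpose s t"
  have t: "?t permutes S" using assms by (simp add: permutes_swap_id)
  have "?g (\<pi> \<circ> ?t) = - ?g \<pi>" if \<pi>: "\<pi> permutes S" for \<pi>
  proof -
    have "sign (\<pi> \<circ> ?t) = - sign \<pi>"
      unfolding sign_compose[OF permutes_imp_permutation[OF assms(1) \<pi>] permutes_imp_permutation[OF assms(1) t]]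
        sign_swap_id using assms(4) by simp
    moreover have "(\<Prod>j\<in>S. v (c j) ((\<pi> \<circ> ?t) j)) = (\<Prod>j\<in>S. v (c j) (\<pi> j))"
    proof -
      have "c (?t j) = c j" for j using assms(5) by (simp add: transpose_def)
      then have "(\<Prod>j\<in>S. v (c j) ((\<pi> \<circ> ?t) j)) = (\<Prod>j\<in>S. ((\<lambda>j. v (c j) (\<pi> j)) \<circ> ?t) j)"
        by (intro prod.cong refl) (simp only: o_def)
      also have "\<dots> = (\<Prod>j\<in>S. v (c j) (\<pi> j))"
        using prod.permute[OF t, of "\<lambda>j. v (c j) (\<pi> j)"] by (simp only:)
      finally show ?thesis .
    qed
    ultimately show ?thesis by (simp only: of_int_minus mult_minus_left)
  qed
  then have "(\<Sum>\<pi> | \<pi> permutes S. ?g (\<pi> \<circ> ?t)) = (\<Sum>\<pi> | \<pi> permutes S. - ?g \<pi>)"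
    by (intro sum.cong) auto
  then have "sum ?g {\<pi>. \<pi> permutes S} = - sum ?g {\<pi>. \<pi> permutes S}"
    using sum_permutations_compose_right[OF t, of ?g] by (simp only: sum_negf)
  then show ?thesis by (rule two[OF iffD1[OF eq_neg_iff_add_eq_0]])
qed

lemma prod_pairs: "(\<Prod>j=1..2 * k. G (j::nat)) = (\<Prod>i=1..k. G (2 * i - 1) * G (2 * i) :: 'r::comm_ring_1)"
proof (induction k)
  case (Suc k)
  have "{1..2 * Suc k} = insert (2 * k + 2) (insert (2 * k + 1) {1..2 * k})" by auto
  with Suc show ?case by (simp add: mult_ac)
qed simp

text \<open>Expanding the product chooses, for each of the \<open>k\<close> pairs, some
  \<open>a \<in> A\<close> and an order of \<open>p a\<close> and \<open>q a\<close>. As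
  \<open>card A < k\<close>, two pairs choose the same \<open>a\<close>, so \<open>p a\<close>
  stands at two positions and the alternating sum over \<open>\<pi>\<close> vanishes.\<close>

lemma pfaffian_sum_eq_0:
  fixes p q :: "'i \<Rightarrow> nat \<Rightarrow> 'r::comm_ring_1"
  assumes A: "finite A" "card A < k"
    and two: "\<And>x::'r. x + x = 0 \<Longrightarrow> x = 0"
  shows "(\<Sum>\<pi> | \<pi> permutes {1..2 * k}. of_int (sign \<pi>) *
    (\<Prod>i=1..k. \<Sum>a\<in>A. p a (\<pi> (2 * i - 1)) * q a (\<pi> (2 * i)) - q a (\<pi> (2 * i - 1)) * p a (\<pi> (2 * i)))) = 0"
proof -
  define v where "v z = (if snd z then p (fst z) else q (fst z))" for z :: "'i \<times> bool"
  define s where "s z = (if snd z then 1 else - 1 :: 'r)" for z :: "'i \<times> bool"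
  let ?Z = "A \<times> (UNIV :: bool set)"
  let ?n = "\<lambda>z::'i \<times> bool. (fst z, \<not> snd z)"
  \<comment> \<open>\<open>c \<phi> j\<close> is the vector that the choice \<open>\<phi>\<close>
    puts at position \<open>j\<close>: \<open>\<phi> i\<close> at \<open>2 i - 1\<close>, its
    partner at \<open>2 i\<close>.\<close>
  define c where "c \<phi> j = (if odd j then \<phi> ((j + 1) div 2) else ?n (\<phi> (j div 2)))" for \<phi> :: "nat \<Rightarrow> 'i \<times> bool" and j :: nat
  have expand: "(\<Sum>a\<in>A. p a x * q a y - q a x * p a y) = (\<Sum>z\<in>?Z. s z * (v z x * v (?n z) y))" for x y
    by (simp add: sum.cartesian_product' UNIV_bool v_def s_def mult.commute)
  have "(\<Sum>\<pi> | \<pi> permutes {1..2 * k}. of_int (sign \<pi>) *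
      (\<Prod>i=1..k. \<Sum>a\<in>A. p a (\<pi> (2 * i - 1)) * q a (\<pi> (2 * i)) - q a (\<pi> (2 * i - 1)) * p a (\<pi> (2 * i)))) =
    (\<Sum>\<pi> | \<pi> permutes {1..2 * k}. of_int (sign \<pi>) * (\<Sum>\<phi>\<in>PiE {1..k} (\<lambda>_. ?Z).
      \<Prod>i=1..k. s (\<phi> i) * (v (\<phi> i) (\<pi> (2 * i - 1)) * v (?n (\<phi> i)) (\<pi> (2 * i)))))"
    unfolding expand using A by (subst prod_sum_PiE) simp_all
  also have "\<dots> = (\<Sum>\<phi>\<in>PiE {1..k} (\<lambda>_. ?Z). (\<Prod>i=1..k. s (\<phi> i)) *
      (\<Sum>\<pi> | \<pi> permutes {1..2 * k}. of_int (sign \<pi>) *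
        (\<Prod>i=1..k. v (\<phi> i) (\<pi> (2 * i - 1)) * v (?n (\<phi> i)) (\<pi> (2 * i)))))"
    unfolding sum_distrib_left by (subst sum.swap) (simp add: prod.distrib mult_ac)
  also have "\<dots> = (\<Sum>\<phi>\<in>PiE {1..k} (\<lambda>_. ?Z). (\<Prod>i=1..k. s (\<phi> i)) * 0)"
  proof (intro sum.cong refl arg_cong2[where f = "(*)"])
    fix \<phi> assume \<phi>: "\<phi> \<in> PiE {1..k} (\<lambda>_. ?Z)"
    have "\<not> inj_on (\<lambda>i. fst (\<phi> i)) {1..k}"
    proof
      assume "inj_on (\<lambda>i. fst (\<phi> i)) {1..k}"
      moreover have "(\<lambda>i. fst (\<phi> i)) ` {1..k} \<subseteq> A" using \<phi> by (force simp: PiE_iff)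
      ultimately show False using card_inj_on_le[of _ "{1..k}" A] A by auto
    qed
    then obtain i i' where i: "i \<in> {1..k}" "i' \<in> {1..k}" "i \<noteq> i'" "fst (\<phi> i) = fst (\<phi> i')"
      by (auto simp: inj_on_def)
    \<comment> \<open>The position inside pair \<open>i\<close> that carries the \<open>p\<close>
      vector.\<close>
    define st where "st i = (if snd (\<phi> i) then 2 * i - 1 else 2 * i)" for i :: nat
    have "(\<Sum>\<pi> | \<pi> permutes {1..2 * k}. of_int (sign \<pi>) *
        (\<Prod>i=1..k. v (\<phi> i) (\<pi> (2 * i - 1)) * v (?n (\<phi> i)) (\<pi> (2 * i)))) =
      (\<Sum>\<pi> | \<pi> permutes {1..2 * k}. of_int (sign \<pi>) * (\<Prod>j\<in>{1..2 * k}. v (c \<phi> j) (\<pi> j)))"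
      by (intro sum.cong refl arg_cong2[where f = "(*)"])
         (subst prod_pairs, auto intro!: prod.cong simp: c_def)
    also have "\<dots> = 0"
    proof (rule alternating_sum_eq_0[OF _ _ _ _ _ two])
      show "st i \<in> {1..2 * k}" "st i' \<in> {1..2 * k}" using i by (auto simp: st_def)
      show "st i \<noteq> st i'" using i unfolding st_def by auto
      have "c \<phi> (st i) = (fst (\<phi> i), True)" if "i \<in> {1..k}" for i
      proof -
        have "2 * i - 1 + 1 = 2 * i" "odd (2 * i - 1)" using that by auto
        then have "c \<phi> (2 * i - 1) = \<phi> i" unfolding c_def by (simp only: if_True) simp
        then show ?thesis by (simp add: c_def[of _ "2 * i"] st_def prod_eq_iff del: One_nat_def)
      qed
      with i show "c \<phi> (st i) = c \<phi> (st i')" by simp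
    qed simp
    finally show "(\<Sum>\<pi> | \<pi> permutes {1..2 * k}. of_int (sign \<pi>) *
        (\<Prod>i=1..k. v (\<phi> i) (\<pi> (2 * i - 1)) * v (?n (\<phi> i)) (\<pi> (2 * i)))) = 0" .
  qed
  finally show ?thesis by simp
qed

section \<open>Variables and vanishing of the Pfaffian ideal\<close>

lemma polys_in_eq_weight: "polys_in V = weight_at_most (\<lambda>v. if v \<in> V then 0 else 1) 0"
  by (auto simp: polys_in_def mvars_def weight_at_most_def weight_def in_keys_iff)

lemma polys_in_sum: "(\<And>i. i \<in> A \<Longrightarrow> p i \<in> polys_in V) \<Longrightarrow> sum p A \<in> polys_in V"
  unfolding polys_in_eq_weight by (rule weight_at_most_sum)

lemma polys_in_mult: "p \<in> polys_in V \<Longrightarrow> q \<in> polys_in V \<Longrightarrow> p * q \<in> polys_in V"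
  unfolding polys_in_eq_weight using weight_at_most_mult[of p _ 0 q 0] by simp

lemma polys_in_prod:
  fixes p :: "'i \<Rightarrow> ('v, 'a::comm_ring_1) mpoly"
  shows "(\<And>i. i \<in> A \<Longrightarrow> p i \<in> polys_in V) \<Longrightarrow> prod p A \<in> polys_in V"
  unfolding polys_in_eq_weight using weight_at_most_prod[of A p _ "\<lambda>_. 0"] by simp

lemma mconst_of_int: "mconst (of_int c :: 'a::comm_ring_1) = (of_int c :: ('v, 'a) mpoly)"
  by (rule rm_of_int[OF ring_morphism_mconst])

lemma polys_in_of_int: "(of_int c :: ('v, 'a::comm_ring_1) mpoly) \<in> polys_in V"
  unfolding polys_in_eq_weight mconst_of_int[symmetric] by (rule weight_at_most_mconst)

lemma polys_in_map: "p \<in> polys_in V \<Longrightarrow> Poly_Mapping.map h p \<in> polys_in V"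
proof -
  assume "p \<in> polys_in V"
  moreover have "Poly_Mapping.keys (Poly_Mapping.map h p) \<subseteq> Poly_Mapping.keys p"
    by (auto simp: in_keys_iff Poly_Mapping.map.rep_eq)
  ultimately show ?thesis by (auto simp: polys_in_def mvars_def)
qed

lemma polys_in_skew_entry:
  assumes "i \<in> {1..2 * n}" "j \<in> {1..2 * n}"
  shows "(skew_entry i j :: (nat \<times> nat, 'a::comm_ring_1) mpoly) \<in> polys_in (skew_vars n)"
  unfolding polys_in_eq_weight skew_entry_def using assms
  by (auto intro!: weight_at_most_uminus weight_at_most_mvar simp: skew_vars_def)
     (simp_all add: weight_at_most_def)

lemma principal_pfaffian_polys_in:
  assumes "S \<subseteq> {1..2 * n}" "card S = 2 * k"
  shows "principal_pfaffian k S \<in> polys_in (skew_vars n)"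
proof -
  have fin: "finite S" using assms finite_subset by blast
  have nth: "sorted_list_of_set S ! (\<pi> j - 1) \<in> {1..2 * n}" if "\<pi> permutes {1..2 * k}" "j \<in> {1..2 * k}" for \<pi> j
  proof -
    have "\<pi> j \<in> {1..2 * k}" using permutes_in_image[OF that(1)] that(2) by blast
    then have "\<pi> j - 1 < length (sorted_list_of_set S)" using assms by auto
    then have "sorted_list_of_set S ! (\<pi> j - 1) \<in> S" using nth_mem fin set_sorted_list_of_set by blast
    then show ?thesis using assms by blast
  qed
  show ?thesis
    unfolding principal_pfaffian_def pfaffian_int_def
    by (intro polys_in_map polys_in_sum polys_in_mult polys_in_of_int polys_in_prod polys_in_skew_entry nth) auto
qed

lemma pfaffian_ideal_polys_in:
  assumes "f \<in> pfaffian_ideal n r"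
  shows "f \<in> polys_in (skew_vars n)"
proof -
  obtain h where "f = (\<Sum>g\<in>{principal_pfaffian r S | S. S \<subseteq> {1..2 * n} \<and> card S = 2 * r}. h g * g)"
    and "\<forall>g\<in>{principal_pfaffian r S | S. S \<subseteq> {1..2 * n} \<and> card S = 2 * r}. h g \<in> polys_in (skew_vars n)"
    using assms by (auto simp: pfaffian_ideal_def ideal_generated_def)
  then show ?thesis by (auto intro!: polys_in_sum polys_in_mult principal_pfaffian_polys_in)
qed

lemma skew_entry_antisym: "skew_entry j i = - skew_entry i j"
  by (simp add: skew_entry_def)

lemma lookup_of_nat_mult: "Poly_Mapping.lookup (of_nat N * p) m = of_nat N * Poly_Mapping.lookup p m"
  for p :: "('v, 'a::comm_ring_1) mpoly"
  by (induction N) (simp_all add: lookup_add algebra_simps)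

text \<open>Divisibility in the polynomial ring makes every coefficient an exact multiple, so the
  coefficientwise \<open>div\<close> in the definition undoes the factor without rounding.\<close>

lemma pfaffian_int_sum:
  assumes "\<And>i j. A j i = - A i j"
  shows "of_nat (2 ^ k * fact k) * pfaffian_int k A =
    (\<Sum>\<pi> | \<pi> permutes {1..2 * k}. of_int (sign \<pi>) * (\<Prod>i=1..k. A (\<pi> (2 * i - 1)) (\<pi> (2 * i))))"
proof -
  have "of_nat (2 ^ k * fact k) dvd (\<Sum>\<pi> | \<pi> permutes {1..2 * k}. of_int (sign \<pi>) *
      (\<Prod>i=1..k. A (\<pi> (2 * i - 1)) (\<pi> (2 * i))))"
    by (rule pfaffian_sum_dvd) (rule assms)
  then obtain R where R: "(\<Sum>\<pi> | \<pi> permutes {1..2 * k}. of_int (sign \<pi>) *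
      (\<Prod>i=1..k. A (\<pi> (2 * i - 1)) (\<pi> (2 * i)))) = of_nat (2 ^ k * fact k) * R"
    by (rule dvdE)
  have "pfaffian_int k A = R"
    unfolding pfaffian_int_def R
    by (rule poly_mapping_eqI)
       (simp add: Poly_Mapping.map.rep_eq lookup_of_nat_mult when_def del: of_nat_mult of_nat_power of_nat_fact,
        simp)
  with R show ?thesis by simp
qed

lemma mpoly_int_cancel:
  fixes p :: "('v, int) mpoly"
  assumes "of_nat N * p = 0" "0 < N"
  shows "p = 0"
proof (rule poly_mapping_eqI)
  show "Poly_Mapping.lookup p m = Poly_Mapping.lookup 0 m" for m
    using arg_cong[OF assms(1), of "\<lambda>p. Poly_Mapping.lookup p m"] assms(2) by (simp add: lookup_of_nat_mult)
qed

lemma meval_map_of_int: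
  fixes x :: "'v \<Rightarrow> 'b::comm_ring_1" and \<phi> :: "'a::comm_ring_1 \<Rightarrow> 'b"
  assumes "ring_morphism \<phi>"
  shows "meval \<phi> (Poly_Mapping.map of_int p) x = meval of_int p x"
proof -
  have "meval \<phi> (Poly_Mapping.map of_int p) x =
      (\<Sum>m\<in>Poly_Mapping.keys p. \<phi> (Poly_Mapping.lookup (Poly_Mapping.map of_int p) m) * monomial_value x m)"
    by (rule meval_superset) (auto simp: rm_zero[OF assms] in_keys_iff Poly_Mapping.map.rep_eq)
  then show ?thesis
    by (simp add: meval_def Poly_Mapping.map.rep_eq rm_of_int[OF assms] in_keys_iff)
qed

text \<open>To cancel \<open>2\<^sup>k k!\<close> in every characteristic, the vanishing is proved for a generic
  matrix of the given rank over the integers and then specialised.\<close>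

lemma meval_principal_pfaffian_eq_0:
  fixes P Q :: "nat \<Rightarrow> nat \<Rightarrow> 'a::comm_ring_1"
  assumes A: "finite A" "card A < k"
  shows "meval (\<lambda>c. c) (principal_pfaffian k S) (\<lambda>(i, j). \<Sum>a\<in>A. P i a * Q j a - Q i a * P j a) = 0"
proof -
  \<comment> \<open>The generic matrix of this form: \<open>True\<close> marks the entries of
    \<open>P\<close>, \<open>False\<close> those of \<open>Q\<close>, and \<open>pt\<close>
    specialises them to the given ones.\<close>
  define \<xi> :: "nat \<times> nat \<Rightarrow> (bool \<times> nat \<times> nat, int) mpoly" where
    "\<xi> = (\<lambda>(i, j). \<Sum>a\<in>A. mvar (True, i, a) * mvar (False, j, a) - mvar (False, i, a) * mvar (True, j, a))"
  define pt where "pt = (\<lambda>(b, i, a). if b then P i a else Q i a)"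
  define s where "s a = sorted_list_of_set S ! (a - 1)" for a :: nat
  define g where "g = pfaffian_int k (\<lambda>a b. skew_entry (s a) (s b))"
  note rm = ring_morphism_meval[OF ring_morphism_mconst, where x = \<xi>]
  have anti: "\<xi> (i, j) = - \<xi> (j, i)" for i j
    by (simp add: \<xi>_def sum_negf[symmetric] mult.commute)
  have diag: "\<xi> (i, i) = 0" for i
    by (simp add: \<xi>_def mult.commute)
  have skew: "meval mconst (skew_entry i j) \<xi> = \<xi> (i, j)" for i j
    using anti[of i j] diag[of i]
    by (cases i j rule: linorder_cases)
       (simp_all add: skew_entry_def meval_mvar rm_uminus[OF rm] rm_zero[OF rm])
  have "of_nat (2 ^ k * fact k) * meval mconst g \<xi> = meval mconst (of_nat (2 ^ k * fact k) * g) \<xi>"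
    by (simp only: rm_mult[OF rm] rm_of_nat[OF rm])
  also have "of_nat (2 ^ k * fact k) * g = (\<Sum>\<pi> | \<pi> permutes {1..2 * k}. of_int (sign \<pi>) *
      (\<Prod>i=1..k. skew_entry (s (\<pi> (2 * i - 1))) (s (\<pi> (2 * i)))))"
    unfolding g_def by (rule pfaffian_int_sum) (rule skew_entry_antisym)
  also have "meval mconst \<dots> \<xi> = (\<Sum>\<pi> | \<pi> permutes {1..2 * k}. of_int (sign \<pi>) *
      (\<Prod>i=1..k. \<xi> (s (\<pi> (2 * i - 1)), s (\<pi> (2 * i)))))"
    by (simp only: rm_sum[OF rm] rm_mult[OF rm] rm_prod[OF rm] rm_of_int[OF rm] skew)
  also have "\<dots> = 0"
    unfolding \<xi>_def prod.case
  proof (rule pfaffian_sum_eq_0[OF A])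
    fix x :: "(bool \<times> nat \<times> nat, int) mpoly"
    assume "x + x = 0"
    then have "of_nat 2 * x = 0" by simp
    then show "x = 0" by (rule mpoly_int_cancel) simp
  qed
  finally have zero: "meval mconst g \<xi> = 0"
    by (rule mpoly_int_cancel) simp
  note rm' = ring_morphism_meval[OF ring_morphism_of_int, where x = pt]
  have pt: "meval of_int (\<xi> v) pt = (\<lambda>(i, j). \<Sum>a\<in>A. P i a * Q j a - Q i a * P j a) v" for v
    by (cases v) (simp add: \<xi>_def rm_sum[OF rm'] rm_mult[OF rm'] rm_diff[OF rm'] meval_mvar, simp add: pt_def)
  have "meval (\<lambda>c. c) (principal_pfaffian k S) (\<lambda>v. meval of_int (\<xi> v) pt) = meval of_int g (\<lambda>v. meval of_int (\<xi> v) pt)"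
    unfolding principal_pfaffian_def g_def s_def by (rule meval_map_of_int[OF ring_morphism_id])
  also have "\<dots> = meval of_int (msubst g \<xi>) pt"
    by (rule meval_msubst[symmetric, OF ring_morphism_of_int])
  also have "\<dots> = 0"
    by (simp add: msubst_eq_meval zero) (simp add: meval_def)
  finally show ?thesis unfolding pt by simp
qed

lemma meval_pfaffian_ideal_eq_0:
  fixes P Q :: "nat \<Rightarrow> nat \<Rightarrow> 'a::comm_ring_1"
  assumes "f \<in> pfaffian_ideal n r" "finite A" "card A < r"
  shows "meval (\<lambda>c. c) f (\<lambda>(i, j). \<Sum>a\<in>A. P i a * Q j a - Q i a * P j a) = 0"
proof -
  obtain h where f: "f = (\<Sum>g\<in>{principal_pfaffian r S | S. S \<subseteq> {1..2 * n} \<and> card S = 2 * r}. h g * g)"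
    using assms(1) by (auto simp: pfaffian_ideal_def ideal_generated_def)
  show ?thesis
    unfolding f meval_sum[OF ring_morphism_id] meval_mult[OF ring_morphism_id]
    by (rule sum.neutral) (auto simp: meval_principal_pfaffian_eq_0[OF assms(2,3)])
qed

section \<open>The circuit\<close>

text \<open>Slot \<open>j < l\<close> belongs to the variable \<open>Suc j\<close> and slot
  \<open>l\<close> is the constant term. This is the order of the input gates in the circuit below,
  whose gate \<open>l\<close> is the constant 1.\<close>

definition affine_form :: "nat \<Rightarrow> (nat \<Rightarrow> 'a::comm_ring_1) \<Rightarrow> (nat, 'a) mpoly" where
  "affine_form l \<alpha> = (\<Sum>j<l. mconst (\<alpha> j) * mvar (Suc j)) + mconst (\<alpha> l)"

lemma div_mod_pair: "j < (N::nat) \<Longrightarrow> (k * N + j) div N = k \<and> (k * N + j) mod N = j"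
  by auto

lemma pair_index_less: "k < (E::nat) \<Longrightarrow> j < N \<Longrightarrow> k * N + j < E * N"
proof -
  assume "k < E" "j < N"
  then have "k * N + j < Suc k * N" by simp
  also have "\<dots> \<le> E * N" using \<open>k < E\<close> by (intro mult_right_mono) auto
  finally show ?thesis .
qed

text \<open>Four blocks of gates: the inputs, one addition gate for each affine form, one oracle
  gate for each \<open>k\<close>, and the top sum. The form for \<open>(k, v)\<close> sits at
  \<open>b + (k * N + e v)\<close>, with \<open>e\<close> numbering \<open>V\<close>. Each form
  costs \<open>l + 3\<close>: its gate, its \<open>l + 1\<close> incoming wires and the wire leaving
  it; each \<open>k\<close> costs 2 more, for the oracle gate and its wire to the top.\<close>

lemma depth_three_circuit:
  fixes f :: "('v, 'a::comm_ring_1) mpoly" and \<alpha> :: "nat \<Rightarrow> 'v \<Rightarrow> nat \<Rightarrow> 'a" and \<mu> :: "nat \<Rightarrow> 'a"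
  assumes V: "finite V" "V \<noteq> {}" and E: "0 < E" and l: "0 < l"
  shows "\<exists>\<Phi>. wf_circuit V l \<Phi> \<and> circuit_depth V \<Phi> = 3 \<and> is_addition (gates \<Phi> ! out_gate \<Phi>) \<and>
    circuit_size V \<Phi> = l + 2 + E * (card V * (l + 3) + 2) \<and>
    computes V f \<Phi> (\<Sum>k<E. mconst (\<mu> k) *
      msubst f (\<lambda>v. if v \<in> V then affine_form l (\<alpha> k v) else 0))"
proof -
  define N where "N = card V"
  have N: "0 < N" using V by (simp add: N_def card_gt_0_iff)
  obtain e where e: "bij_betw e V {0..<N}"
    using ex_bij_betw_finite_nat[OF V(1)] N_def by blast
  define e' where "e' = inv_into V e"
  have e_less: "e v < N" if "v \<in> V" for v
    using e that by (auto simp: bij_betw_def)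
  have e'_e: "e' (e v) = v" if "v \<in> V" for v
    unfolding e'_def by (rule bij_betw_inv_into_left[OF e that])
  have e'_in: "e' j \<in> V" if "j < N" for j
    using bij_betw_inv_into[OF e] that by (auto simp: bij_betw_def e'_def)
  define b where "b = Suc l"
  define b2 where "b2 = b + E * N"
  define b3 where "b3 = b2 + E"
  have ord: "l < b" "b \<le> b2" "b2 \<le> b3" "b < b2" "b2 < b3"
    using E N by (auto simp: b_def b2_def b3_def)
  \<comment> \<open>The wire \<open>(0, 0)\<close> outside \<open>V\<close> yields the value 0, as
    in the \<open>else\<close> branch of the claim.\<close>
  define G :: "nat \<Rightarrow> ('v, 'a) gate" where
    "G i = (if i < l then Input_Var (Suc i) else if i = l then Input_Const 1
       else if i < b2 then Add_Gate (map (\<lambda>j. (\<alpha> ((i - b) div N) (e' ((i - b) mod N)) j, j)) [0..<b])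
       else if i < b3 then Oracle_Gate (\<lambda>v. if v \<in> V then (1, b + ((i - b2) * N + e v)) else (0, 0))
       else Add_Gate (map (\<lambda>k. (\<mu> k, b2 + k)) [0..<E]))" for i
  have G0: "G i = Input_Var (Suc i)" if "i < l" for i using that by (simp add: G_def)
  have G1: "G l = Input_Const 1" by (simp add: G_def)
  have G2: "G i = Add_Gate (map (\<lambda>j. (\<alpha> ((i - b) div N) (e' ((i - b) mod N)) j, j)) [0..<b])"
    if "b \<le> i" "i < b2" for i using that ord by (simp add: G_def)
  have G3: "G i = Oracle_Gate (\<lambda>v. if v \<in> V then (1, b + ((i - b2) * N + e v)) else (0, 0))"
    if "b2 \<le> i" "i < b3" for i using that ord by (simp add: G_def)
  have G4: "G b3 = Add_Gate (map (\<lambda>k. (\<mu> k, b2 + k)) [0..<E])"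
    using ord by (simp add: G_def)
  define \<Phi> where "\<Phi> = \<lparr>gates = map G [0..<Suc b3], out_gate = b3\<rparr>"
  have nth: "gates \<Phi> ! i = G i" if "i < Suc b3" for i
    using that by (simp add: \<Phi>_def del: upt_Suc)
  have len: "length (gates \<Phi>) = Suc b3" by (simp add: \<Phi>_def)
  have cases: thesis
    if "i < Suc b3" "i < l \<Longrightarrow> thesis" "i = l \<Longrightarrow> thesis" "b \<le> i \<Longrightarrow> i < b2 \<Longrightarrow> thesis"
      "b2 \<le> i \<Longrightarrow> i < b3 \<Longrightarrow> thesis" "i = b3 \<Longrightarrow> thesis" for i thesis
    using that ord b_def by linarith
  have or_less: "b + ((i - b2) * N + e v) < b2" if "b2 \<le> i" "i < b3" "v \<in> V" for i v
  proof -
    have "i - b2 < E" using that by (simp add: b3_def)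
    then show ?thesis using pair_index_less[OF _ e_less[OF that(3)]] by (simp add: b2_def)
  qed
  \<comment> \<open>Every wire leads to a larger index, hence acyclicity, and climbs one level, so
    all paths from an input (level 0) to the top gate (level 3) have length exactly 3.\<close>
  define lev :: "nat \<Rightarrow> nat" where "lev i = (if i < b then 0 else if i < b2 then 1 else if i < b3 then 2 else 3)" for i
  have lev: "lev j = Suc (lev i) \<and> i < j" if "(i, j) \<in> wire_rel V \<Phi>" for i j
  proof -
    have j: "j < Suc b3" and i: "i \<in> sources V (G j)" using that nth by (auto simp: wire_rel_def len)
    from j show ?thesis
    proof (rule cases)
      assume "j < l" then show ?thesis using i by (simp add: G0)
    next
      assume "j = l" then show ?thesis using i by (simp add: G1)
    next
      assume "b \<le> j" "j < b2" then show ?thesis using i by (auto simp: G2 lev_def)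
    next
      assume *: "b2 \<le> j" "j < b3"
      then obtain v where "v \<in> V" "i = b + ((j - b2) * N + e v)" using i by (auto simp: G3)
      then show ?thesis using or_less[OF *, of v] * ord by (simp add: lev_def)
    next
      assume "j = b3"
      then obtain k where "k < E" "i = b2 + k" using i by (auto simp: G4)
      then show ?thesis using \<open>j = b3\<close> ord by (simp add: lev_def b3_def)
    qed
  qed
  have input_lev: "i < b" if "i < Suc b3" "is_input (G i)" for i
    using that(1) by (rule cases) (use that ord in \<open>auto simp: G0 G1 G2 G3 G4\<close>)
  have set_gates: "set (gates \<Phi>) = G ` {0..<Suc b3}" by (simp add: \<Phi>_def del: upt_Suc)
  have "wf_circuit V l \<Phi>"
    unfolding wf_circuit_def
  proof (intro conjI ballI)
    show "out_gate \<Phi> < length (gates \<Phi>)" by (simp add: len) (simp add: \<Phi>_def)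
    have "wire_rel V \<Phi> \<subseteq> less_than" using lev by auto
    then show "acyclic (wire_rel V \<Phi>)" using wf_acyclic[OF wf_less_than] acyclic_subset by blast
  next
    fix g assume "g \<in> set (gates \<Phi>)"
    then obtain i where i: "i < Suc b3" "g = G i" by (auto simp: set_gates)
    have "sources V (G i) \<subseteq> {..<length (gates \<Phi>)} \<and> (is_input (G i) \<longleftrightarrow> fan_in V (G i) = 0) \<and>
        (\<forall>k. G i = Input_Var k \<longrightarrow> k \<in> {1..l})"
      using i(1)
    proof (rule cases)
      assume *: "b2 \<le> i" "i < b3"
      have "b + ((i - b2) * N + e v) < Suc b3" if "v \<in> V" for v
        using or_less[OF * that] ord by simp
      then show ?thesis using * V N by (auto simp: G3 len N_def)
    next
      assume "i = b3"
      moreover have "b2 + k < Suc b3" if "k < E" for k using that by (simp add: b3_def)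
      ultimately show ?thesis using E by (auto simp: G4 len)
    qed (use ord E in \<open>auto simp: G0 G1 G2 len b_def\<close>)
    then show "sources V g \<subseteq> {..<length (gates \<Phi>)}" "is_input g \<longleftrightarrow> fan_in V g = 0"
      "\<forall>k. g = Input_Var k \<longrightarrow> k \<in> {1..l}"
      unfolding i(2) by blast+
  qed
  moreover have "circuit_depth V \<Phi> = 3"
  proof -
    have relpow: "lev j = lev i + k" if "(i, j) \<in> wire_rel V \<Phi> ^^ k" for i j k
      using that by (induction k arbitrary: j) (auto dest: lev)
    have uniq: "k = 3" if "i < length (gates \<Phi>)" "is_input (gates \<Phi> ! i)" "(i, out_gate \<Phi>) \<in> wire_rel V \<Phi> ^^ k" for i k
      using relpow[OF that(3)] input_lev[of i] that ord nth by (auto simp: len lev_def \<Phi>_def)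
    have path: "(0, out_gate \<Phi>) \<in> wire_rel V \<Phi> ^^ 3"
    proof -
      have "e' 0 \<in> V" "e (e' 0) = 0"
        using e'_in[OF N] bij_betw_inv_into_right[OF e, of 0] N by (auto simp: e'_def)
      then have "b \<in> sources V (G b2)" using ord by (force simp: G3)
      moreover have "0 \<in> sources V (G b)" using ord by (force simp: G2 b_def image_iff)
      moreover have "b2 \<in> sources V (G b3)" using E by (force simp: G4 image_iff)
      ultimately have "(0, b) \<in> wire_rel V \<Phi>" "(b, b2) \<in> wire_rel V \<Phi>" "(b2, b3) \<in> wire_rel V \<Phi>"
        using ord nth by (auto simp: wire_rel_def len)
      then show ?thesis by (auto simp: numeral_3_eq_3 \<Phi>_def)
    qed
    have inp: "is_input (gates \<Phi> ! 0)" using l nth[of 0] by (simp add: G0)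
    have "{k. \<exists>i<length (gates \<Phi>). is_input (gates \<Phi> ! i) \<and>
        (i, out_gate \<Phi>) \<in> wire_rel V \<Phi> ^^ k} = {3}"
    proof (intro equalityI subsetI)
      show "k \<in> {3}" if "k \<in> {k. \<exists>i<length (gates \<Phi>). is_input (gates \<Phi> ! i) \<and>
          (i, out_gate \<Phi>) \<in> wire_rel V \<Phi> ^^ k}" for k
        using that uniq by auto
      show "k \<in> {k. \<exists>i<length (gates \<Phi>). is_input (gates \<Phi> ! i) \<and>
          (i, out_gate \<Phi>) \<in> wire_rel V \<Phi> ^^ k}" if "k \<in> {3}" for k
        using that path inp len by (auto intro!: exI[of _ 0])
    qed
    then show ?thesis by (simp add: circuit_depth_def)
  qed
  moreover have "is_addition (gates \<Phi> ! out_gate \<Phi>)"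
    using nth[of b3] by (simp add: G4) (simp add: \<Phi>_def G4 del: upt_Suc)
  moreover have "circuit_size V \<Phi> = l + 2 + E * (card V * (l + 3) + 2)"
  proof -
    let ?F = "\<lambda>i. fan_in V (G i)"
    have "(\<Sum>g\<leftarrow>gates \<Phi>. fan_in V g) = (\<Sum>i\<in>{0..<Suc b3}. ?F i)"
      by (simp add: \<Phi>_def o_def interv_sum_list_conv_sum_set_nat del: upt_Suc)
    also have "\<dots> = (\<Sum>i\<in>{0..<b}. ?F i) + (\<Sum>i\<in>{b..<b2}. ?F i) + (\<Sum>i\<in>{b2..<b3}. ?F i) + ?F b3"
      using ord by (simp add: sum.atLeastLessThan_concat)
    also have "(\<Sum>i\<in>{0..<b}. ?F i) = 0"
    proof (rule sum.neutral, rule ballI)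
      fix i assume "i \<in> {0..<b}"
      then show "?F i = 0" by (cases "i = l") (auto simp: b_def G0 G1)
    qed
    also have "(\<Sum>i\<in>{b..<b2}. ?F i) = (\<Sum>i\<in>{b..<b2}. b)"
      by (intro sum.cong) (auto simp: G2)
    also have "(\<Sum>i\<in>{b2..<b3}. ?F i) = (\<Sum>i\<in>{b2..<b3}. N)"
      by (intro sum.cong) (auto simp: G3 N_def)
    also have "?F b3 = E" by (simp add: G4)
    finally show ?thesis
      by (simp add: circuit_size_def len b_def b2_def b3_def N_def algebra_simps)
  qed
  moreover have "computes V f \<Phi> (\<Sum>k<E. mconst (\<mu> k) *
      msubst f (\<lambda>v. if v \<in> V then affine_form l (\<alpha> k v) else 0))"
  proof -
    define orc where "orc k = msubst f (\<lambda>v. if v \<in> V then affine_form l (\<alpha> k v) else 0)" for k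
    define val :: "nat \<Rightarrow> (nat, 'a) mpoly" where "val i = (if i < l then mvar (Suc i) else if i = l then 1
       else if i < b2 then affine_form l (\<alpha> ((i - b) div N) (e' ((i - b) mod N)))
       else if i < b3 then orc (i - b2)
       else \<Sum>k<E. mconst (\<mu> k) * orc k)" for i
    have v0: "val i = mvar (Suc i)" if "i < l" for i using that by (simp add: val_def)
    have v1: "val l = 1" by (simp add: val_def)
    have v2: "val i = affine_form l (\<alpha> ((i - b) div N) (e' ((i - b) mod N)))" if "b \<le> i" "i < b2" for i
      using that ord by (simp add: val_def)
    have v3: "val i = orc (i - b2)" if "b2 \<le> i" "i < b3" for i using that ord by (simp add: val_def)
    have v4: "val b3 = (\<Sum>k<E. mconst (\<mu> k) * orc k)" using ord by (simp add: val_def)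
    have "val i = gate_value V f val (G i)" if "i < Suc b3" for i
      using that
    proof (rule cases)
      assume *: "b \<le> i" "i < b2"
      have "(\<Sum>j\<in>{0..<b}. mconst (\<beta> j) * val j) = affine_form l \<beta>" for \<beta>
      proof -
        have "(\<Sum>j\<in>{0..<b}. mconst (\<beta> j) * val j) = (\<Sum>j<l. mconst (\<beta> j) * val j) + mconst (\<beta> l) * val l"
          by (simp add: b_def lessThan_atLeast0)
        then show ?thesis by (simp add: affine_form_def v0 v1)
      qed
      then show ?thesis using *
        by (simp add: G2 v2 o_def interv_sum_list_conv_sum_set_nat)
    next
      assume *: "b2 \<le> i" "i < b3"
      have eq: "mconst (fst (if v \<in> V then (1, b + ((i - b2) * N + e v)) else (0, 0))) *
          val (snd (if v \<in> V then (1, b + ((i - b2) * N + e v)) else (0, 0))) =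
          (if v \<in> V then affine_form l (\<alpha> (i - b2) v) else 0)" for v
      proof (cases "v \<in> V")
        case True
        then have "val (b + ((i - b2) * N + e v)) = affine_form l (\<alpha> (i - b2) v)"
          using or_less[OF * True] div_mod_pair[OF e_less[OF True], of "i - b2"]
          by (subst v2) (simp_all add: e'_e)
        with True show ?thesis by simp
      qed simp
      show ?thesis unfolding G3[OF *] gate_value.simps v3[OF *] orc_def eq ..
    next
      assume "i = b3"
      have "(\<Sum>k\<in>{0..<E}. mconst (\<mu> k) * val (b2 + k)) = (\<Sum>k<E. mconst (\<mu> k) * orc k)"
        by (rule sum.cong) (auto simp: v3 b3_def)
      then show ?thesis using \<open>i = b3\<close>
        by (simp add: G4 v4 o_def interv_sum_list_conv_sum_set_nat)
    qed (simp_all add: G0 G1 v0 v1)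
    then have "\<forall>i<length (gates \<Phi>). val i = gate_value V f val (gates \<Phi> ! i)"
      using nth by (simp add: len)
    moreover have "val (out_gate \<Phi>) = (\<Sum>k<E. mconst (\<mu> k) * orc k)"
      by (simp add: \<Phi>_def v4)
    ultimately show ?thesis unfolding computes_def orc_def by blast
  qed
  ultimately show ?thesis by blast
qed

section \<open>Branching programs as triangular matrices\<close>

lemma affine_form_add: "affine_form l \<alpha> + affine_form l \<beta> = affine_form l (\<lambda>j. \<alpha> j + \<beta> j)"
  by (simp add: affine_form_def rm_add[OF ring_morphism_mconst] distrib_right sum.distrib)

lemma affine_form_cmult: "mconst c * affine_form l \<alpha> = affine_form l (\<lambda>j. c * \<alpha> j)"
  by (simp add: affine_form_def rm_mult[OF ring_morphism_mconst] distrib_left sum_distrib_left mult.assoc)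

lemma affine_form_const: "mconst c = affine_form l (\<lambda>j. if j = l then c else 0)"
  by (simp add: affine_form_def)

definition affine_forms :: "nat \<Rightarrow> (nat, 'a::comm_ring_1) mpoly set" where
  "affine_forms l = range (affine_form l)"

lemma affine_forms_add: "p \<in> affine_forms l \<Longrightarrow> q \<in> affine_forms l \<Longrightarrow> p + q \<in> affine_forms l"
  by (auto simp: affine_forms_def affine_form_add)

lemma affine_forms_cmult: "p \<in> affine_forms l \<Longrightarrow> mconst c * p \<in> affine_forms l"
  by (auto simp: affine_forms_def affine_form_cmult)

lemma affine_forms_const: "mconst c \<in> affine_forms l"
  using affine_form_const[of c l] by (simp add: affine_forms_def)

lemma affine_forms_0: "0 \<in> affine_forms l"
  using affine_forms_const[of 0 l] by simp

lemma affine_forms_uminus: "p \<in> affine_forms l \<Longrightarrow> - p \<in> affine_forms l"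
  using affine_forms_cmult[of p l "- 1"] by (simp add: rm_uminus[OF ring_morphism_mconst])

lemma affine_forms_diff: "p \<in> affine_forms l \<Longrightarrow> q \<in> affine_forms l \<Longrightarrow> p - q \<in> affine_forms l"
  unfolding diff_conv_add_uminus by (intro affine_forms_add affine_forms_uminus)

lemma affine_forms_sum: "(\<And>i. i \<in> A \<Longrightarrow> p i \<in> affine_forms l) \<Longrightarrow> sum p A \<in> affine_forms l"
  by (induction A rule: infinite_finite_induct) (simp_all add: affine_forms_add affine_forms_0)

lemma monomial_degree_le_1_cases:
  assumes "monomial_degree m \<le> 1"
  obtains "m = 0" | v where "m = Poly_Mapping.single v 1"
proof (cases "Poly_Mapping.keys m = {}")
  case True
  then have "m = 0" by (metis keys_eq_empty)
  then show ?thesis by (rule that)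
next
  case False
  then obtain v where v: "v \<in> Poly_Mapping.keys m" by blast
  have le: "(\<Sum>w\<in>Poly_Mapping.keys m. Poly_Mapping.lookup m w) \<le> 1"
    using assms by (simp add: monomial_degree_def)
  have split: "(\<Sum>w\<in>Poly_Mapping.keys m. Poly_Mapping.lookup m w) =
      Poly_Mapping.lookup m v + (\<Sum>w\<in>Poly_Mapping.keys m - {v}. Poly_Mapping.lookup m w)"
    using v by (simp add: sum.remove)
  have "0 < Poly_Mapping.lookup m v" using v by (simp add: in_keys_iff)
  then have one: "Poly_Mapping.lookup m v = 1" and "(\<Sum>w\<in>Poly_Mapping.keys m - {v}. Poly_Mapping.lookup m w) = 0"
    using le split by linarith+
  then have "\<forall>w\<in>Poly_Mapping.keys m - {v}. Poly_Mapping.lookup m w = 0" by simp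
  then have "Poly_Mapping.lookup m w = 0" if "w \<noteq> v" for w
    using that by (meson Diff_iff in_keys_iff singletonD)
  with one have "m = Poly_Mapping.single v 1"
    by (intro poly_mapping_eqI) (auto simp: lookup_single when_def)
  then show ?thesis by (rule that)
qed

lemma degree_one_affine_form:
  fixes p :: "(nat, 'a::comm_ring_1) mpoly"
  assumes "p \<in> polys_in {1..l}" "total_degree p \<le> 1"
  shows "p \<in> affine_forms l"
proof -
  define \<alpha> where "\<alpha> j = (if j = l then Poly_Mapping.lookup p 0
    else Poly_Mapping.lookup p (Poly_Mapping.single (Suc j) 1))" for j
  have prod: "mconst c * mvar j = Poly_Mapping.single (Poly_Mapping.single j 1) c" for c :: 'a and j :: nat
    by (simp add: mconst_def mvar_def mult_single)
  have lk: "Poly_Mapping.lookup (affine_form l \<alpha>) m =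
      (\<Sum>j<l. if Poly_Mapping.single (Suc j) (1::nat) = m then \<alpha> j else 0) + (if m = 0 then \<alpha> l else 0)" for m
    unfolding affine_form_def prod by (simp add: lookup_add lookup_sum lookup_single when_def mconst_def)
  have "p = affine_form l \<alpha>"
  proof (rule poly_mapping_eqI)
    fix m :: "nat \<Rightarrow>\<^sub>0 nat"
    consider "m = 0" | j where "j < l" "m = Poly_Mapping.single (Suc j) 1"
      | "m \<noteq> 0" "\<And>j. j < l \<Longrightarrow> Poly_Mapping.single (Suc j) 1 \<noteq> m" by metis
    then show "Poly_Mapping.lookup p m = Poly_Mapping.lookup (affine_form l \<alpha>) m"
    proof cases
      case 1
      have "Poly_Mapping.single (Suc j) (1::nat) \<noteq> 0" for j
        by (metis keys_single keys_zero insert_not_empty zero_neq_one)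
      with 1 show ?thesis unfolding lk by (simp add: \<alpha>_def)
    next
      case 2
      have "Poly_Mapping.single (Suc j) (1::nat) \<noteq> 0"
        by (metis keys_single keys_zero insert_not_empty zero_neq_one)
      moreover have "(Poly_Mapping.single (Suc i) (1::nat) = Poly_Mapping.single (Suc j) 1) = (i = j)" for i
        by (metis keys_single singleton_inject Suc_inject zero_neq_one)
      ultimately show ?thesis unfolding lk using 2 by (simp add: \<alpha>_def)
    next
      case 3
      have "m \<notin> Poly_Mapping.keys p"
      proof
        assume m: "m \<in> Poly_Mapping.keys p"
        then have "monomial_degree m \<le> 1"
          using monomial_degree_le_total_degree[OF m] assms(2) by simp
        then show False
        proof (cases rule: monomial_degree_le_1_cases)
          case (2 v)
          then have "v \<in> Poly_Mapping.keys m" by simp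
          then have "v \<in> {1..l}" using m assms(1) by (auto simp: polys_in_def mvars_def)
          then have "v - 1 < l" "v = Suc (v - 1)" by auto
          with 2 3 show ?thesis by metis
        qed (use 3 in simp)
      qed
      with 3 show ?thesis unfolding lk by (simp add: in_keys_iff)
    qed
  qed
  then show ?thesis by (auto simp: affine_forms_def)
qed

section \<open>Path sums in a layered graph\<close>

lemma successively_snoc:
  "successively R (xs @ [x]) \<longleftrightarrow> successively R xs \<and> (xs \<noteq> [] \<longrightarrow> R (last xs) x)"
  by (auto simp: successively_append_iff)

locale branching_program =
  fixes l :: nat and P :: "'a::comm_ring_1 abp"
  assumes wf: "wf_abp l P"
begin

abbreviation "Vs \<equiv> abp_vertices P"

definition lay :: "nat \<Rightarrow> nat" where
  "lay v = (THE j. j \<le> top_layer P \<and> v \<in> layer P j)"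

lemma layer_finite: "j \<le> top_layer P \<Longrightarrow> finite (layer P j)"
  and layer_disjoint: "i \<le> top_layer P \<Longrightarrow> j \<le> top_layer P \<Longrightarrow> i \<noteq> j \<Longrightarrow> layer P i \<inter> layer P j = {}"
  and layer_source: "layer P 0 = {source P}"
  and layer_sink: "layer P (top_layer P) = {sink P}"
  and edges_layers: "edges P \<subseteq> (\<Union>i<top_layer P. layer P i \<times> layer P (Suc i))"
  using wf by (auto simp: wf_abp_def)

lemma label_affine: "(u, v) \<in> edges P \<Longrightarrow> label P u v \<in> affine_forms l"
proof -
  assume "(u, v) \<in> edges P"
  with wf have "label P u v \<in> polys_in {1..l}" "total_degree (label P u v) \<le> 1"
    by (auto simp: wf_abp_def)
  then show ?thesis by (rule degree_one_affine_form)
qed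

lemma finite_vertices: "finite Vs"
  using layer_finite by (auto simp: abp_vertices_def)

lemma lay_eq: "j \<le> top_layer P \<Longrightarrow> v \<in> layer P j \<Longrightarrow> lay v = j"
  unfolding lay_def using layer_disjoint[of j] by (intro the_equality) blast+

lemma lay_vertex: "v \<in> Vs \<Longrightarrow> lay v \<le> top_layer P \<and> v \<in> layer P (lay v)"
  using lay_eq by (auto simp: abp_vertices_def)

lemma lay_source: "lay (source P) = 0" and source_vertex: "source P \<in> Vs"
  using lay_eq[of 0 "source P"] layer_source by (auto simp: abp_vertices_def)

lemma lay_sink: "lay (sink P) = top_layer P" and sink_vertex: "sink P \<in> Vs"
  using lay_eq[of "top_layer P" "sink P"] layer_sink by (auto simp: abp_vertices_def)

lemma edge_vertices: "(u, v) \<in> edges P \<Longrightarrow> u \<in> Vs \<and> v \<in> Vs \<and> lay v = Suc (lay u)"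
proof -
  assume "(u, v) \<in> edges P"
  then obtain i where i: "i < top_layer P" "u \<in> layer P i" "v \<in> layer P (Suc i)"
    using edges_layers by blast
  then have "lay u = i" "lay v = Suc i" using lay_eq[of i] lay_eq[of "Suc i"] by auto
  moreover have "u \<in> Vs" "v \<in> Vs" unfolding abp_vertices_def using i by (force intro: less_imp_le)+
  ultimately show ?thesis by simp
qed

definition paths_to :: "nat \<Rightarrow> nat list set" where
  "paths_to v = {p. p \<noteq> [] \<and> hd p = source P \<and> last p = v \<and> successively (\<lambda>u v. (u, v) \<in> edges P) p}"

definition path_weight :: "nat list \<Rightarrow> (nat, 'a) mpoly" where
  "path_weight p = (\<Prod>i<length p - 1. label P (p ! i) (p ! Suc i))"

definition path_sum :: "nat \<Rightarrow> (nat, 'a) mpoly" where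
  "path_sum v = (\<Sum>p\<in>paths_to v. path_weight p)"

lemma path_sum_sink: "path_sum (sink P) = abp_poly P"
  by (simp add: path_sum_def abp_poly_def paths_to_def abp_paths_def path_weight_def)

text \<open>A path from the source meets each layer up to that of its end once, so its length is
  determined by its end. This is what makes the sets of paths finite.\<close>

lemma path_layers:
  "p \<noteq> [] \<Longrightarrow> hd p = source P \<Longrightarrow> successively (\<lambda>u v. (u, v) \<in> edges P) p \<Longrightarrow>
    set p \<subseteq> Vs \<and> length p = Suc (lay (last p))"
proof (induction p rule: rev_induct)
  case (snoc x xs)
  show ?case
  proof (cases "xs = []")
    case True
    then show ?thesis using snoc.prems lay_source source_vertex by auto
  next
    case False
    then have "(last xs, x) \<in> edges P" "set xs \<subseteq> Vs \<and> length xs = Suc (lay (last xs))"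
      using snoc by (auto simp: successively_snoc)
    then show ?thesis using edge_vertices[of "last xs" x] by auto
  qed
qed simp

lemma finite_paths_to: "finite (paths_to v)"
proof (rule finite_subset)
  show "paths_to v \<subseteq> {p. set p \<subseteq> Vs \<and> length p \<le> Suc (lay v)}"
    using path_layers by (auto simp: paths_to_def)
qed (rule finite_lists_length_le[OF finite_vertices])

lemma paths_to_rec:
  "paths_to v = (if v = source P then {[v]} else {}) \<union>
    (\<Union>u\<in>{u \<in> Vs. (u, v) \<in> edges P}. (\<lambda>p. p @ [v]) ` paths_to u)" (is "_ = ?R")
proof (intro equalityI subsetI)
  fix p assume p: "p \<in> paths_to v"
  then have ne: "p \<noteq> []" by (simp add: paths_to_def)
  define ys where "ys = butlast p"
  have pys: "p = ys @ [v]" using p ne append_butlast_last_id[OF ne] by (simp add: paths_to_def ys_def)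
  show "p \<in> ?R"
  proof (cases "ys = []")
    case True
    then show ?thesis using p by (simp add: pys paths_to_def)
  next
    case False
    then have "ys \<in> paths_to (last ys)" "(last ys, v) \<in> edges P"
      using p by (auto simp: pys paths_to_def successively_snoc)
    then show ?thesis using edge_vertices[of "last ys" v] by (auto simp: pys)
  qed
next
  fix p assume "p \<in> ?R"
  then show "p \<in> paths_to v"
    by (auto simp: paths_to_def successively_snoc split: if_splits)
qed

lemma path_weight_snoc:
  assumes "p \<noteq> []"
  shows "path_weight (p @ [v]) = path_weight p * label P (last p) v"
proof -
  have len: "length (p @ [v]) - 1 = Suc (length p - 1)" using assms by (cases p) auto
  have "path_weight (p @ [v]) = (\<Prod>i<length p - 1. label P ((p @ [v]) ! i) ((p @ [v]) ! Suc i)) *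
      label P ((p @ [v]) ! (length p - 1)) ((p @ [v]) ! Suc (length p - 1))"
    unfolding path_weight_def len by (rule prod.lessThan_Suc)
  also have "(\<Prod>i<length p - 1. label P ((p @ [v]) ! i) ((p @ [v]) ! Suc i)) = path_weight p"
    unfolding path_weight_def by (intro prod.cong) (auto simp: nth_append)
  also have "(p @ [v]) ! (length p - 1) = last p" using assms by (simp add: nth_append last_conv_nth)
  also have "(p @ [v]) ! Suc (length p - 1) = v" using assms by (simp add: nth_append)
  finally show ?thesis .
qed

text \<open>Split off the last edge. Read as a row vector \<open>\<gamma>\<close>, the path sums
  satisfy \<open>\<gamma> = e\<^sub>s + \<gamma> N\<close>, that is
  \<open>\<gamma> (I - N) = e\<^sub>s\<close>.\<close>

lemma path_sum_rec:
  "path_sum v = (if v = source P then 1 else 0) +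
    (\<Sum>u\<in>Vs. path_sum u * (if (u, v) \<in> edges P then label P u v else 0))"
proof -
  let ?A = "if v = source P then {[v]} else {}"
  let ?U = "{u \<in> Vs. (u, v) \<in> edges P}"
  let ?B = "\<Union>u\<in>?U. (\<lambda>p. p @ [v]) ` paths_to u"
  have fin: "finite ?A" "finite ?U" using finite_vertices by auto
  have finB: "finite ?B" using fin finite_paths_to by auto
  have disj: "?A \<inter> ?B = {}" by (auto simp: paths_to_def)
  have A: "sum path_weight ?A = (if v = source P then 1 else 0)"
    by (simp add: path_weight_def)
  have "sum path_weight ?B = (\<Sum>u\<in>?U. sum path_weight ((\<lambda>p. p @ [v]) ` paths_to u))"
    by (rule sum.UNION_disjoint) (use fin finite_paths_to in \<open>auto simp: paths_to_def\<close>)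
  also have "\<dots> = (\<Sum>u\<in>?U. path_sum u * label P u v)"
  proof (rule sum.cong)
    fix u assume "u \<in> ?U"
    have "sum path_weight ((\<lambda>p. p @ [v]) ` paths_to u) = (\<Sum>p\<in>paths_to u. path_weight (p @ [v]))"
      by (subst sum.reindex) (auto simp: inj_on_def)
    also have "\<dots> = (\<Sum>p\<in>paths_to u. path_weight p * label P u v)"
      by (intro sum.cong refl) (auto simp: paths_to_def path_weight_snoc)
    finally show "sum path_weight ((\<lambda>p. p @ [v]) ` paths_to u) = path_sum u * label P u v"
      by (simp add: path_sum_def sum_distrib_right)
  qed simp
  also have "\<dots> = (\<Sum>u\<in>Vs. if (u, v) \<in> edges P then path_sum u * label P u v else 0)"
    by (rule sum.inter_filter[OF finite_vertices])
  also have "\<dots> = (\<Sum>u\<in>Vs. path_sum u * (if (u, v) \<in> edges P then label P u v else 0))"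
    by (intro sum.cong) auto
  finally show ?thesis
    unfolding path_sum_def[of v] paths_to_rec[of v] sum.union_disjoint[OF fin(1) finB disj] A by simp
qed

text \<open>Refining the layers makes every edge go forward; the tie-break by vertex number makes
  the order total, so that positions are distinct.\<close>

definition before :: "nat \<Rightarrow> nat \<Rightarrow> bool" where
  "before u v \<longleftrightarrow> lay u < lay v \<or> lay u = lay v \<and> u < v"

text \<open>Counted backwards from \<open>i\<close>, so that the sink, being last, lands exactly on
  \<open>i\<close> whatever the number of vertices.\<close>

definition pos :: "nat \<Rightarrow> nat \<Rightarrow> nat" where
  "pos i v = i - card {w \<in> Vs. before v w}"

lemma card_before: "v \<in> Vs \<Longrightarrow> card {w \<in> Vs. before v w} < card Vs"
  by (rule psubset_card_mono) (use finite_vertices in \<open>auto simp: before_def\<close>)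

lemma pos_mono:
  assumes "card Vs \<le> i" "u \<in> Vs" "v \<in> Vs" "before u v"
  shows "pos i u < pos i v"
proof -
  have "card {w \<in> Vs. before v w} < card {w \<in> Vs. before u w}"
    by (rule psubset_card_mono) (use assms finite_vertices in \<open>auto simp: before_def\<close>)
  then show ?thesis using card_before[OF assms(2)] assms(1) by (simp add: pos_def)
qed

lemma pos_range: "card Vs \<le> i \<Longrightarrow> v \<in> Vs \<Longrightarrow> pos i v \<in> {1..i}"
  using card_before[of v] by (auto simp: pos_def)

lemma pos_inj: "card Vs \<le> i \<Longrightarrow> inj_on (pos i) Vs"
proof (rule inj_onI)
  fix u v assume "card Vs \<le> i" "u \<in> Vs" "v \<in> Vs" "pos i u = pos i v"
  moreover have "u = v \<or> before u v \<or> before v u" unfolding before_def by linarith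
  ultimately show "u = v" using pos_mono[of i u v] pos_mono[of i v u] by auto
qed

lemma pos_sink: "pos i (sink P) = i"
proof -
  have "\<not> before (sink P) w" if "w \<in> Vs" for w
    using lay_vertex[OF that] layer_sink lay_sink by (auto simp: before_def)
  then have "{w \<in> Vs. before (sink P) w} = {}" by blast
  then show ?thesis unfolding pos_def by (simp only: card.empty diff_zero)
qed

text \<open>\<open>N\<close> is strictly upper triangular because edges go forward. Positions that
  carry no vertex have zero rows and columns in \<open>N\<close>, and setting
  \<open>\<gamma>\<close> to 0 there is consistent with the recursion.\<close>

lemma triangular_matrix:
  assumes i: "card Vs \<le> i"
  shows "\<exists>s N \<gamma>. s \<in> {1..i} \<and> (\<forall>a b. N a b \<noteq> 0 \<longrightarrow> 1 \<le> a \<and> a < b \<and> b \<le> i) \<and>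
    (\<forall>a b. N a b \<in> affine_forms l) \<and>
    (\<forall>b\<in>{1..i}. \<gamma> b = (if b = s then 1 else 0) + (\<Sum>a\<in>{1..i}. \<gamma> a * N a b)) \<and>
    \<gamma> i = abp_poly P"
proof -
  define q where "q = inv_into Vs (pos i)"
  have q: "q (pos i v) = v" if "v \<in> Vs" for v
    unfolding q_def by (rule inv_into_f_f[OF pos_inj[OF i] that])
  define I where "I = pos i ` Vs"
  define N where "N a b = (if a \<in> I \<and> b \<in> I \<and> (q a, q b) \<in> edges P then label P (q a) (q b) else 0)" for a b
  define \<gamma> where "\<gamma> a = (if a \<in> I then path_sum (q a) else 0)" for a
  have I: "I \<subseteq> {1..i}" using pos_range[OF i] by (auto simp: I_def)
  have N_pos: "N (pos i u) (pos i v) = (if (u, v) \<in> edges P then label P u v else 0)" if "u \<in> Vs" "v \<in> Vs" for u v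
    using that by (simp add: N_def q I_def)
  have \<gamma>_pos: "\<gamma> (pos i v) = path_sum v" if "v \<in> Vs" for v
    using that by (simp add: \<gamma>_def q I_def)
  have "1 \<le> a \<and> a < b \<and> b \<le> i" if "N a b \<noteq> 0" for a b
  proof -
    from that have ab: "a \<in> I" "b \<in> I" "(q a, q b) \<in> edges P" by (auto simp: N_def split: if_splits)
    then obtain u v where uv: "u \<in> Vs" "v \<in> Vs" "a = pos i u" "b = pos i v" by (auto simp: I_def)
    with ab q have "lay v = Suc (lay u)" using edge_vertices by auto
    then have "before u v" by (simp add: before_def)
    then show ?thesis using pos_mono[OF i uv(1,2)] ab I uv by auto
  qed
  moreover have "N a b \<in> affine_forms l" for a b
    by (simp add: N_def label_affine affine_forms_0)
  moreover have "\<gamma> b = (if b = pos i (source P) then 1 else 0) + (\<Sum>a\<in>{1..i}. \<gamma> a * N a b)" if "b \<in> {1..i}" for b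
  proof (cases "b \<in> I")
    case True
    then obtain v where v: "v \<in> Vs" "b = pos i v" by (auto simp: I_def)
    have "(\<Sum>a\<in>{1..i}. \<gamma> a * N a b) = (\<Sum>a\<in>I. \<gamma> a * N a b)"
      by (rule sum.mono_neutral_right) (use I in \<open>auto simp: \<gamma>_def\<close>)
    also have "\<dots> = (\<Sum>u\<in>Vs. \<gamma> (pos i u) * N (pos i u) b)"
      unfolding I_def by (subst sum.reindex[OF pos_inj[OF i]]) simp
    also have "\<dots> = (\<Sum>u\<in>Vs. path_sum u * (if (u, v) \<in> edges P then label P u v else 0))"
      by (intro sum.cong refl) (simp add: v N_pos \<gamma>_pos)
    finally have "(\<Sum>a\<in>{1..i}. \<gamma> a * N a b) = \<dots>" .
    moreover have "b = pos i (source P) \<longleftrightarrow> v = source P"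
      using inj_on_eq_iff[OF pos_inj[OF i] v(1) source_vertex] v by simp
    ultimately show ?thesis using path_sum_rec[of v] v \<gamma>_pos by simp
  next
    case False
    moreover have "b \<noteq> pos i (source P)" using False source_vertex by (auto simp: I_def)
    ultimately show ?thesis by (simp add: \<gamma>_def N_def)
  qed
  moreover have "\<gamma> i = abp_poly P"
    using \<gamma>_pos[OF sink_vertex] by (simp add: pos_sink path_sum_sink)
  moreover have "pos i (source P) \<in> {1..i}" by (rule pos_range[OF i source_vertex])
  ultimately show ?thesis by blast
qed

end

lemma abp_computable_triangular:
  assumes "abp_computable l r g" "r \<le> i"
  obtains s N \<gamma> where "s \<in> {1..i}" "\<And>a b. N a b \<noteq> 0 \<Longrightarrow> 1 \<le> a \<and> a < b \<and> b \<le> i"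
    "\<And>a b. N a b \<in> affine_forms l"
    "\<And>b. b \<in> {1..i} \<Longrightarrow> \<gamma> b = (if b = s then 1 else 0) + (\<Sum>a\<in>{1..i}. \<gamma> a * N a b)"
    "\<gamma> i = g"
proof -
  obtain P where P: "wf_abp l P" "card (abp_vertices P) \<le> r" "abp_poly P = g"
    using assms(1) by (auto simp: abp_computable_def)
  interpret branching_program l P by unfold_locales (rule P(1))
  have "card (abp_vertices P) \<le> i" using P(2) assms(2) by simp
  from triangular_matrix[OF this] P(3) show thesis using that by blast
qed

section \<open>The generic matrix as a sum of wedge products\<close>

text \<open>The entry \<open>(j, k)\<close> of \<open>P Q\<^sup>T - Q P\<^sup>T\<close>, summed over
  a set \<open>A\<close> of columns so that columns can be discarded.\<close>

definition wedge_sum :: "nat set \<Rightarrow> (nat \<Rightarrow> nat \<Rightarrow> 'r::comm_ring_1) \<Rightarrow> (nat \<Rightarrow> nat \<Rightarrow> 'r) \<Rightarrow> nat \<times> nat \<Rightarrow> 'r" where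
  "wedge_sum A P Q = (\<lambda>(j, k). \<Sum>a\<in>A. P j a * Q k a - Q j a * P k a)"

definition generic_wedge :: "nat \<Rightarrow> nat \<times> nat \<Rightarrow> (bool \<times> nat \<times> nat, 'a::comm_ring_1) mpoly" where
  "generic_wedge m = wedge_sum {1..m} (\<lambda>j a. mvar (True, j, a)) (\<lambda>j a. mvar (False, j, a))"

lemma meval_generic_wedge:
  assumes "ring_morphism \<phi>"
  shows "meval \<phi> (generic_wedge m v) x = wedge_sum {1..m} (\<lambda>j a. x (True, j, a)) (\<lambda>j a. x (False, j, a)) v"
proof -
  note rm = ring_morphism_meval[OF assms, where x = x]
  show ?thesis
    by (cases v) (simp add: generic_wedge_def wedge_sum_def rm_sum[OF rm] rm_mult[OF rm] rm_diff[OF rm]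
        meval_mvar rm_zero[OF assms] rm_one[OF assms])
qed

lemma meval_wedge_pullback:
  assumes "ring_morphism \<phi>"
  shows "meval \<phi> (msubst f (generic_wedge m)) x =
    meval \<phi> f (wedge_sum {1..m} (\<lambda>j a. x (True, j, a)) (\<lambda>j a. x (False, j, a)))"
  by (simp add: meval_msubst[OF assms] meval_generic_wedge[OF assms])

text \<open>Each monomial of an entry couples one variable of \<open>P\<close> with one of
  \<open>Q\<close> in the same column, so only such pairs have to be weighed.\<close>

lemma generic_wedge_weight:
  assumes "\<And>j k a. 1 \<le> a \<Longrightarrow> a \<le> m \<Longrightarrow> w (True, j, a) + w (False, k, a) \<le> s"
  shows "(generic_wedge m v :: (bool \<times> nat \<times> nat, 'a::comm_ring_1) mpoly) \<in> weight_at_most w s"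
proof (cases v)
  case (Pair j k)
  have *: "mvar u * (mvar v :: (bool \<times> nat \<times> nat, 'a) mpoly) \<in> weight_at_most w s" if "w u + w v \<le> s" for u v
    by (rule weight_at_most_mono[where k = "w u + w v"])
       (intro weight_at_most_mult weight_at_most_mvar order_refl, rule that)
  have "mvar (True, j, a) * (mvar (False, k, a) :: (bool \<times> nat \<times> nat, 'a) mpoly) \<in> weight_at_most w s"
    and "mvar (False, j, a) * (mvar (True, k, a) :: (bool \<times> nat \<times> nat, 'a) mpoly) \<in> weight_at_most w s" if "a \<in> {1..m}" for j k a
    using that assms[of a j k] assms[of a k j] by (auto intro!: * simp: add.commute)
  then show ?thesis
    unfolding Pair generic_wedge_def wedge_sum_def prod.case
    by (intro weight_at_most_sum weight_at_most_diff)
qed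

lemma weight_wedge_pullback:
  fixes f :: "(nat \<times> nat, 'a::comm_ring_1) mpoly"
  assumes "\<And>j k a. 1 \<le> a \<Longrightarrow> a \<le> m \<Longrightarrow> w (True, j, a) + w (False, k, a) \<le> s"
    and "\<mu> \<in> Poly_Mapping.keys (msubst f (generic_wedge m))"
  shows "weight w \<mu> \<le> s * total_degree f"
proof -
  have "msubst f (generic_wedge m) \<in> weight_at_most w (s * total_degree f)"
    by (rule weight_at_most_msubst) (rule generic_wedge_weight[OF assms(1)])
  with assms(2) show ?thesis by (simp add: weight_at_most_def)
qed

lemma lookup_le_weight: "w v = 1 \<Longrightarrow> Poly_Mapping.lookup m v \<le> weight w m"
proof (cases "v \<in> Poly_Mapping.keys m")
  case True
  assume "w v = 1"
  then have "Poly_Mapping.lookup m v = w v * Poly_Mapping.lookup m v" by simp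
  also have "\<dots> \<le> weight w m" unfolding weight_def by (rule member_le_sum[OF True]) auto
  finally show ?thesis .
qed (simp add: in_keys_iff)

context
  fixes f :: "(nat \<times> nat, 'a::field) mpoly" and n r :: nat and A :: "'a set"
  assumes f: "f \<in> pfaffian_ideal n r" "f \<noteq> 0" and r: "1 \<le> r"
    and A: "total_degree f < card A"
begin

abbreviation "wedge_pullback \<equiv> msubst f (generic_wedge (2 * n))"

text \<open>Counting only the variables of \<open>P\<close>, or only those of \<open>Q\<close>,
  gives the entries of the generic matrix degree 1 instead of 2.\<close>

lemma wedge_pullback_lookup_le:
  assumes "\<mu> \<in> Poly_Mapping.keys wedge_pullback"
  shows "Poly_Mapping.lookup \<mu> v \<le> total_degree f"
proof -
  obtain b j a where v: "v = (b, j, a)" by (cases v)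
  have "weight (\<lambda>v. of_bool (fst v = b)) \<mu> \<le> 1 * total_degree f"
    by (rule weight_wedge_pullback[OF _ assms]) (cases b, auto)
  moreover have "Poly_Mapping.lookup \<mu> v \<le> weight (\<lambda>v. of_bool (fst v = b)) \<mu>"
    by (rule lookup_le_weight) (simp add: v)
  ultimately show ?thesis by simp
qed

lemma wedge_pullback_column:
  assumes "\<mu> \<in> Poly_Mapping.keys wedge_pullback" "(b, j, a) \<in> Poly_Mapping.keys \<mu>"
  shows "a \<in> {1..2 * n}"
proof (rule ccontr)
  assume *: "a \<notin> {1..2 * n}"
  have "weight (\<lambda>(b, j, a). of_bool (a \<notin> {1..2 * n})) \<mu> \<le> 0 * total_degree f"
    by (rule weight_wedge_pullback[OF _ assms(1)]) auto
  moreover have "Poly_Mapping.lookup \<mu> (b, j, a) \<le> weight (\<lambda>(b, j, a). of_bool (a \<notin> {1..2 * n})) \<mu>"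
    by (rule lookup_le_weight) (use * in simp)
  ultimately show False using assms(2) by (simp add: in_keys_iff)
qed

text \<open>With \<open>P\<close> the identity and \<open>Q\<close> the transpose of the strict
  upper triangle of a skew-symmetric matrix, the wedge sum is that matrix. So the substitution
  reaches every point, in particular one at which \<open>f\<close> does not vanish.\<close>

lemma wedge_pullback_nonzero: "Poly_Mapping.keys wedge_pullback \<noteq> {}"
proof
  assume empty: "Poly_Mapping.keys wedge_pullback = {}"
  obtain m\<^sub>0 where m\<^sub>0: "m\<^sub>0 \<in> Poly_Mapping.keys f" using f(2) by (metis ex_in_conv keys_eq_empty)
  have "Poly_Mapping.lookup m v \<le> total_degree f" if "m \<in> Poly_Mapping.keys f" for m v
  proof -
    have "Poly_Mapping.lookup m v \<le> monomial_degree m"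
      using lookup_le_weight[of "\<lambda>_. 1" v m] by (simp add: weight_def monomial_degree_def)
    with monomial_degree_le_total_degree[OF that] show ?thesis by simp
  qed
  then obtain x where "(\<Sum>m\<in>Poly_Mapping.keys f. Poly_Mapping.lookup f m * monomial_value x m) \<noteq> 0"
    using exists_nonvanishing_point_monomials[of "Poly_Mapping.keys f" m\<^sub>0 "Poly_Mapping.lookup f" "total_degree f" A]
      m\<^sub>0 A by (auto simp: in_keys_iff)
  then have x: "meval (\<lambda>c. c) f x \<noteq> 0" by (simp add: meval_def)
  define y where "y = (\<lambda>(b, j, a). if b then of_bool (j = a) else if a < j then x (a, j) else 0)"
  have "wedge_sum {1..2 * n} (\<lambda>j a. y (True, j, a)) (\<lambda>j a. y (False, j, a)) v = x v" if sv: "v \<in> skew_vars n" for v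
  proof -
    obtain j k where v: "v = (j, k)" "1 \<le> j" "j < k" "k \<le> 2 * n" using sv by (auto simp: skew_vars_def)
    have "(\<Sum>a\<in>{1..2 * n}. of_bool (j = a) * (if a < k then x (a, k) else 0)) = x (j, k)"
      using v by (subst sum.remove[of _ j]) auto
    moreover have "(\<Sum>a\<in>{1..2 * n}. (if a < j then x (a, j) else 0) * of_bool (k = a)) = 0"
      using v by (intro sum.neutral) auto
    ultimately show ?thesis by (simp add: v(1) wedge_sum_def y_def sum_subtractf)
  qed
  then have "meval (\<lambda>c. c) wedge_pullback y = meval (\<lambda>c. c) f x"
    unfolding meval_wedge_pullback[OF ring_morphism_id]
    using pfaffian_ideal_polys_in[OF f(1)] by (intro meval_cong) (auto simp: polys_in_def)
  with x empty show False by (simp add: meval_def)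
qed

text \<open>If all columns of \<open>P\<close> from \<open>r\<close> on vanish, the wedge sum has rank less than \<open>2 r\<close>.\<close>

lemma wedge_pullback_high_column:
  assumes "\<mu> \<in> Poly_Mapping.keys wedge_pullback"
  shows "\<exists>j a. (True, j, a) \<in> Poly_Mapping.keys \<mu> \<and> r \<le> a"
proof (rule ccontr)
  assume no: "\<not> ?thesis"
  \<comment> \<open>The part of the pullback that survives when the columns of \<open>P\<close> from
    \<open>r\<close> on are set to 0. If it contains \<open>\<mu>\<close>, it is a nonzero
    polynomial and has a point where it does not vanish.\<close>
  define M where "M = {m \<in> Poly_Mapping.keys wedge_pullback. \<forall>j a. (True, j, a) \<in> Poly_Mapping.keys m \<longrightarrow> a < r}"
  have "\<mu> \<in> M" using no assms by (auto simp: M_def not_le)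
  have "finite M" by (simp add: M_def)
  then obtain x where x: "(\<Sum>m\<in>M. Poly_Mapping.lookup wedge_pullback m * monomial_value x m) \<noteq> 0"
    using exists_nonvanishing_point_monomials[of M \<mu> "Poly_Mapping.lookup wedge_pullback" "total_degree f" A]
      \<open>\<mu> \<in> M\<close> A assms wedge_pullback_lookup_le by (auto simp: M_def in_keys_iff)
  define y where "y = (\<lambda>(b, j, a). if b \<and> r \<le> a then 0 else x (b, j, a))"
  have "monomial_value y m = 0" if m: "m \<in> Poly_Mapping.keys wedge_pullback - M" for m
  proof -
    obtain j a where ja: "(True, j, a) \<in> Poly_Mapping.keys m" "r \<le> a" using m by (auto simp: M_def not_less)
    then have "y (True, j, a) ^ Poly_Mapping.lookup m (True, j, a) = 0"
      by (simp add: y_def in_keys_iff)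
    then show ?thesis unfolding monomial_value_def using ja(1) by (intro prod_zero) auto
  qed
  then have "meval (\<lambda>c. c) wedge_pullback y = (\<Sum>m\<in>M. Poly_Mapping.lookup wedge_pullback m * monomial_value y m)"
    unfolding meval_def by (intro sum.mono_neutral_right) (auto simp: M_def)
  also have "\<dots> = (\<Sum>m\<in>M. Poly_Mapping.lookup wedge_pullback m * monomial_value x m)"
  proof (intro sum.cong refl arg_cong2[where f = "(*)"])
    fix m assume "m \<in> M"
    then have "y v = x v" if "v \<in> Poly_Mapping.keys m" for v
      using that by (cases v) (force simp: M_def y_def)
    then show "monomial_value y m = monomial_value x m"
      unfolding monomial_value_def by (intro prod.cong) auto
  qed
  finally have "meval (\<lambda>c. c) wedge_pullback y \<noteq> 0" using x by simp
  moreover have "wedge_sum {1..2 * n} (\<lambda>j a. y (True, j, a)) (\<lambda>j a. y (False, j, a)) =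
      wedge_sum {a \<in> {1..2 * n}. a < r} (\<lambda>j a. y (True, j, a)) (\<lambda>j a. y (False, j, a))"
    unfolding wedge_sum_def
    by (intro ext, clarify, intro sum.mono_neutral_right) (auto simp: y_def)
  moreover have "card {a \<in> {1..2 * n}. a < r} < r"
  proof -
    have "card {a \<in> {1..2 * n}. a < r} \<le> card {1..<r}" by (intro card_mono) auto
    then show ?thesis using r by simp
  qed
  ultimately show False
    using meval_pfaffian_ideal_eq_0[OF f(1), of "{a \<in> {1..2 * n}. a < r}"]
    unfolding meval_wedge_pullback[OF ring_morphism_id] by (simp add: wedge_sum_def)
qed

text \<open>The weight \<open>2 K a - [a = i]\<close> of column \<open>a\<close> first minimises \<open>\<Sum> a\<close> over the columns of \<open>P\<close> in
  a monomial and then maximises the degree in column \<open>i\<close>.\<close>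

lemma wedge_pullback_leading_part:
  assumes K: "K = Suc (total_degree f)"
  shows "\<exists>i N e x. r \<le> i \<and> i \<le> 2 * n \<and> 1 \<le> e \<and> e \<le> total_degree f \<and>
    (\<forall>\<mu>\<in>Poly_Mapping.keys wedge_pullback. N \<le> weight (\<lambda>(b, j, a). if b then 2 * K * a - of_bool (a = i) else 0) \<mu>) \<and>
    (\<forall>\<mu>\<in>Poly_Mapping.keys wedge_pullback. weight (\<lambda>(b, j, a). if b then 2 * K * a - of_bool (a = i) else 0) \<mu> = N \<longrightarrow>
      weight (\<lambda>(b, j, a). of_bool (b \<and> a = i)) \<mu> = e) \<and>
    (\<Sum>\<mu> | \<mu> \<in> Poly_Mapping.keys wedge_pullback \<and>
        weight (\<lambda>(b, j, a). if b then 2 * K * a - of_bool (a = i) else 0) \<mu> = N.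
      Poly_Mapping.lookup wedge_pullback \<mu> * monomial_value x \<mu>) \<noteq> 0"
proof -
  define wb :: "bool \<times> nat \<times> nat \<Rightarrow> nat" where "wb = (\<lambda>(b, j, a). if b then a else 0)"
  obtain \<mu>\<^sub>0 where \<mu>\<^sub>0: "\<mu>\<^sub>0 \<in> Poly_Mapping.keys wedge_pullback" "\<And>\<mu>. \<mu> \<in> Poly_Mapping.keys wedge_pullback \<Longrightarrow> weight wb \<mu>\<^sub>0 \<le> weight wb \<mu>"
    using ex_min_if_finite[of "weight wb ` Poly_Mapping.keys wedge_pullback"] wedge_pullback_nonzero
    by (auto simp: not_less)
  \<comment> \<open>\<open>i\<close> is taken from a monomial of least column sum. The monomials of
    least weight \<open>w\<close> then have at least its degree in column \<open>i\<close>, which is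
    positive.\<close>
  obtain j i where ji: "(True, j, i) \<in> Poly_Mapping.keys \<mu>\<^sub>0" "r \<le> i"
    using wedge_pullback_high_column[OF \<mu>\<^sub>0(1)] by blast
  have i: "1 \<le> i" "i \<le> 2 * n" using ji(2) r wedge_pullback_column[OF \<mu>\<^sub>0(1) ji(1)] by auto
  define w :: "bool \<times> nat \<times> nat \<Rightarrow> nat" where "w = (\<lambda>(b, j, a). if b then 2 * K * a - of_bool (a = i) else 0)"
  define wi :: "bool \<times> nat \<times> nat \<Rightarrow> nat" where "wi = (\<lambda>(b, j, a). of_bool (b \<and> a = i))"
  have "2 * K * wb v = w v + wi v" for v
    using i K by (cases v) (simp add: wb_def w_def wi_def)
  then have sum_w: "2 * K * weight wb \<mu> = weight w \<mu> + weight wi \<mu>" for \<mu>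
    unfolding weight_def sum_distrib_left sum.distrib[symmetric]
    by (intro sum.cong refl) (simp flip: mult.assoc distrib_right)
  have wi_le: "weight wi \<mu> \<le> total_degree f" if "\<mu> \<in> Poly_Mapping.keys wedge_pullback" for \<mu>
    using weight_wedge_pullback[of "2 * n" wi 1 \<mu> f] that by (auto simp: wi_def)
  have wi_pos: "1 \<le> weight wi \<mu>\<^sub>0"
    using lookup_le_weight[of wi "(True, j, i)" \<mu>\<^sub>0] ji(1) by (auto simp: wi_def in_keys_iff)
  obtain \<mu>\<^sub>1 where \<mu>\<^sub>1: "\<mu>\<^sub>1 \<in> Poly_Mapping.keys wedge_pullback" "\<And>\<mu>. \<mu> \<in> Poly_Mapping.keys wedge_pullback \<Longrightarrow> weight w \<mu>\<^sub>1 \<le> weight w \<mu>"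
    using ex_min_if_finite[of "weight w ` Poly_Mapping.keys wedge_pullback"] wedge_pullback_nonzero
    by (auto simp: not_less)
  define N where "N = weight w \<mu>\<^sub>1"
  \<comment> \<open>A larger column sum costs at least \<open>2 K\<close>, more than the
    \<open>total_degree f < K\<close> that column \<open>i\<close> can save.\<close>
  have same: "weight wb \<mu> = weight wb \<mu>\<^sub>0" if "\<mu> \<in> Poly_Mapping.keys wedge_pullback" "weight w \<mu> = N" for \<mu>
  proof (rule antisym[OF _ \<mu>\<^sub>0(2)[OF that(1)]])
    have "2 * K * weight wb \<mu> \<le> weight w \<mu>\<^sub>0 + total_degree f"
      using sum_w[of \<mu>] \<mu>\<^sub>1(2)[OF \<mu>\<^sub>0(1)] wi_le[OF that(1)] that(2) N_def by linarith
    also have "\<dots> < 2 * K * weight wb \<mu>\<^sub>0 + 2 * K" using sum_w[of \<mu>\<^sub>0] K by linarith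
    also have "\<dots> = 2 * K * Suc (weight wb \<mu>\<^sub>0)" by simp
    finally have "weight wb \<mu> < Suc (weight wb \<mu>\<^sub>0)" by (simp only: mult_less_cancel1)
    then show "weight wb \<mu> \<le> weight wb \<mu>\<^sub>0" by simp
  qed
  define e where "e = weight wi \<mu>\<^sub>1"
  have e_eq: "weight wi \<mu> = e" if "\<mu> \<in> Poly_Mapping.keys wedge_pullback" "weight w \<mu> = N" for \<mu>
    using sum_w[of \<mu>] sum_w[of \<mu>\<^sub>1] same[OF that] same[OF \<mu>\<^sub>1(1)] that(2) N_def e_def by simp
  have "1 \<le> e"
    using sum_w[of \<mu>\<^sub>0] sum_w[of \<mu>\<^sub>1] same[OF \<mu>\<^sub>1(1)] N_def e_def \<mu>\<^sub>1(2)[OF \<mu>\<^sub>0(1)] wi_pos by simp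
  have "e \<le> total_degree f" unfolding e_def by (rule wi_le[OF \<mu>\<^sub>1(1)])
  define M where "M = {\<mu>. \<mu> \<in> Poly_Mapping.keys wedge_pullback \<and> weight w \<mu> = N}"
  have "\<mu>\<^sub>1 \<in> M" "finite M" using \<mu>\<^sub>1(1) by (auto simp: M_def N_def)
  then obtain x where "(\<Sum>\<mu>\<in>M. Poly_Mapping.lookup wedge_pullback \<mu> * monomial_value x \<mu>) \<noteq> 0"
    using exists_nonvanishing_point_monomials[of M \<mu>\<^sub>1 "Poly_Mapping.lookup wedge_pullback" "total_degree f" A]
      A \<mu>\<^sub>1(1) wedge_pullback_lookup_le by (auto simp: M_def in_keys_iff)
  then show ?thesis
    using ji(2) i(2) \<open>1 \<le> e\<close> \<open>e \<le> total_degree f\<close> \<mu>\<^sub>1(2) e_eq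
    unfolding M_def N_def w_def wi_def by blast
qed

end

section \<open>Extraction of the leading coefficient\<close>

lemma dvd_diff_mult:
  fixes T :: "'r::comm_ring_1"
  assumes "T dvd a - b" "T dvd a' - b'"
  shows "T dvd a * a' - b * b'"
proof -
  have "a * a' - b * b' = (a - b) * a' + b * (a' - b')" by (simp add: algebra_simps)
  with assms show ?thesis by simp
qed

lemma dvd_diff_power: "T dvd a - b \<Longrightarrow> T dvd a ^ k - b ^ k" for T :: "'r::comm_ring_1"
  by (induction k) (simp_all add: dvd_diff_mult)

lemma dvd_diff_monomial_value:
  fixes T :: "'r::comm_ring_1"
  assumes "\<And>v. T dvd x v - y v"
  shows "T dvd monomial_value x m - monomial_value y m"
proof -
  have "T dvd (\<Prod>v\<in>V. x v ^ Poly_Mapping.lookup m v) - (\<Prod>v\<in>V. y v ^ Poly_Mapping.lookup m v)" for V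
    by (induction V rule: infinite_finite_induct) (simp_all add: dvd_diff_mult dvd_diff_power assms)
  then show ?thesis by (simp add: monomial_value_def)
qed

lemma coeff_eq_of_dvd_diff:
  fixes a b :: "'r::comm_ring_1 poly"
  assumes "monom 1 K dvd a - b" "q < K"
  shows "coeff a q = coeff b q"
proof -
  obtain c where "a - b = monom 1 K * c" using assms(1) by (rule dvdE)
  then have "coeff (a - b) q = 0" using assms(2) by (simp add: coeff_monom_mult)
  then show ?thesis by simp
qed

text \<open>Modulo \<open>u^K\<close>, \<open>z v\<close> is \<open>(1 + u g)^(wi v)\<close> times a
  constant. A monomial of weight \<open>N\<close> therefore contributes a constant times
  \<open>u^(K N) (1 + u g)^e\<close> up to terms divisible by \<open>u^(K N + K)\<close>, and any
  other monomial starts at \<open>u^(K N + K)\<close> or later. As \<open>q < K\<close>, the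
  coefficient at \<open>K * N + q\<close> sees only the former.\<close>

lemma coeff_leading_part:
  fixes h :: "('v, 'a::comm_ring_1) mpoly" and x :: "'v \<Rightarrow> 'a" and z :: "'v \<Rightarrow> (nat, 'a) mpoly poly"
  assumes z: "\<And>v. monom 1 K dvd z v - [:1, g:] ^ wi v * [:mconst (x v):]"
    and q: "q < K" "q \<le> e"
    and N: "\<And>m. m \<in> Poly_Mapping.keys h \<Longrightarrow> N \<le> weight w m"
    and e: "\<And>m. m \<in> Poly_Mapping.keys h \<Longrightarrow> weight w m = N \<Longrightarrow> weight wi m = e"
  shows "coeff (meval (\<lambda>a. [:mconst a:]) h (\<lambda>v. monom 1 (K * w v) * z v)) (K * N + q) =
    mconst (\<Sum>m | m \<in> Poly_Mapping.keys h \<and> weight w m = N. Poly_Mapping.lookup h m * monomial_value x m) *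
      (of_nat (e choose q) * g ^ q)"
proof -
  have rm: "ring_morphism (\<lambda>a :: 'a. [:mconst a :: (nat, 'a) mpoly:])"
    by (rule ring_morphism_comp[OF ring_morphism_const_poly ring_morphism_mconst])
  have summand: "coeff ([:mconst (Poly_Mapping.lookup h m):] * monomial_value (\<lambda>v. monom 1 (K * w v) * z v) m) (K * N + q) =
      (if weight w m = N then mconst (Poly_Mapping.lookup h m * monomial_value x m) * (of_nat (e choose q) * g ^ q) else 0)"
    if m: "m \<in> Poly_Mapping.keys h" for m
  proof -
    have "monomial_value (\<lambda>v. monom (1 :: (nat, 'a) mpoly) (K * w v)) m = monom 1 (K * weight w m)"
      using monomial_value_power[of "monom (1 :: (nat, 'a) mpoly) K" w m] by (simp add: monom_power)
    then have "monomial_value (\<lambda>v. monom 1 (K * w v) * z v) m = monom 1 (K * weight w m) * monomial_value z m"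
      by (simp add: monomial_value_mult)
    then have *: "coeff ([:mconst (Poly_Mapping.lookup h m):] * monomial_value (\<lambda>v. monom 1 (K * w v) * z v) m) (K * N + q) =
        mconst (Poly_Mapping.lookup h m) *
          (if K * N + q < K * weight w m then 0 else coeff (monomial_value z m) (K * N + q - K * weight w m))"
      by (simp add: coeff_monom_mult)
    show ?thesis
    proof (cases "weight w m = N")
      case True
      have "coeff (monomial_value z m) q = coeff (monomial_value (\<lambda>v. [:1, g:] ^ wi v * [:mconst (x v):]) m) q"
        by (rule coeff_eq_of_dvd_diff[OF dvd_diff_monomial_value[OF z] q(1)])
      also have "monomial_value (\<lambda>v. [:1, g:] ^ wi v * [:mconst (x v):]) m = [:1, g:] ^ e * [:mconst (monomial_value x m):]"
        using e[OF m True] rm_monomial_value[OF rm, of x m, symmetric]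
        by (simp only: monomial_value_mult monomial_value_power)
      also have "coeff \<dots> q = of_nat (e choose q) * g ^ q * mconst (monomial_value x m)"
        using coeff_linear_poly_power[OF q(2), of 1 g] by simp
      finally show ?thesis
        unfolding * using True by (simp add: rm_mult[OF ring_morphism_mconst] mult_ac)
    next
      case False
      then have "Suc N \<le> weight w m" using N[OF m] by simp
      then have "K * Suc N \<le> K * weight w m" by (rule mult_le_mono2)
      then have "K * N + q < K * weight w m" using q(1) by simp
      then show ?thesis unfolding * using False by simp
    qed
  qed
  have "coeff (meval (\<lambda>a. [:mconst a:]) h (\<lambda>v. monom 1 (K * w v) * z v)) (K * N + q) =
      (\<Sum>m\<in>Poly_Mapping.keys h. if weight w m = N
        then mconst (Poly_Mapping.lookup h m * monomial_value x m) * (of_nat (e choose q) * g ^ q) else 0)"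
    unfolding meval_def coeff_sum by (intro sum.cong refl summand)
  also have "\<dots> = (\<Sum>m | m \<in> Poly_Mapping.keys h \<and> weight w m = N.
      mconst (Poly_Mapping.lookup h m * monomial_value x m) * (of_nat (e choose q) * g ^ q))"
    by (rule sum.inter_filter[symmetric]) simp
  finally show ?thesis
    by (simp add: rm_sum[OF ring_morphism_mconst] sum_distrib_right)
qed

text \<open>This is \<open>B = L D U\<close> evaluated on two vectors: \<open>U = I - N\<close>, and \<open>u \<gamma>\<close> is added to row \<open>i\<close> of the
  identity to form \<open>L D\<close>.\<close>

lemma triangular_factorisation:
  fixes p q \<gamma> :: "nat \<Rightarrow> 'r::comm_ring_1"
  assumes i: "i \<le> m" and s: "s \<in> {1..i}"
    and N: "\<And>a b. N a b \<noteq> 0 \<Longrightarrow> 1 \<le> a \<and> a < b \<and> b \<le> i"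
    and \<gamma>: "\<And>b. b \<in> {1..i} \<Longrightarrow> \<gamma> b = (if b = s then 1 else 0) + (\<Sum>a\<in>{1..i}. \<gamma> a * N a b)"
  shows "(\<Sum>c\<in>{1..m}. (p c + (if c \<le> i then u * \<gamma> c * p i else 0)) * (q c - (\<Sum>b\<in>{1..m}. N c b * q b))) =
    (\<Sum>c\<in>{1..m}. p c * q c) - (\<Sum>c\<in>{1..m}. \<Sum>b\<in>{1..m}. N c b * (p c * q b)) + u * (p i * q s)"
proof -
  let ?Q = "\<lambda>c. q c - (\<Sum>b\<in>{1..m}. N c b * q b)"
  have sub: "{1..i} \<subseteq> {1..m}" using i by auto
  \<comment> \<open>The row \<open>\<gamma>\<close> is a left preimage of a unit vector under
    \<open>U\<close>; paired with \<open>U q\<close> it leaves the single entry \<open>q s\<close>,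
    and the non-affine \<open>\<gamma>\<close> disappears.\<close>
  have "(\<Sum>c\<in>{1..i}. \<gamma> c * ?Q c) = (\<Sum>c\<in>{1..i}. \<gamma> c * q c) - (\<Sum>c\<in>{1..i}. \<Sum>b\<in>{1..m}. \<gamma> c * N c b * q b)"
    by (simp add: right_diff_distrib sum_subtractf sum_distrib_left mult.assoc)
  also have "(\<Sum>c\<in>{1..i}. \<Sum>b\<in>{1..m}. \<gamma> c * N c b * q b) = (\<Sum>b\<in>{1..m}. (\<Sum>c\<in>{1..i}. \<gamma> c * N c b) * q b)"
    by (subst sum.swap) (simp only: sum_distrib_right)
  also have "\<dots> = (\<Sum>b\<in>{1..i}. (\<Sum>c\<in>{1..i}. \<gamma> c * N c b) * q b)"
  proof (rule sum.mono_neutral_right[OF _ sub], simp, rule ballI)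
    fix b assume "b \<in> {1..m} - {1..i}"
    then have "N c b = 0" for c using N[of c b] by fastforce
    then show "(\<Sum>c\<in>{1..i}. \<gamma> c * N c b) * q b = 0" by simp
  qed
  also have "(\<Sum>c\<in>{1..i}. \<gamma> c * q c) - \<dots> = (\<Sum>b\<in>{1..i}. if b = s then q b else 0)"
    unfolding sum_subtractf[symmetric] left_diff_distrib[symmetric]
  proof (rule sum.cong)
    fix b assume "b \<in> {1..i}"
    then have "\<gamma> b - (\<Sum>a\<in>{1..i}. \<gamma> a * N a b) = (if b = s then 1 else 0)" using \<gamma>[of b] by simp
    then show "(\<gamma> b - (\<Sum>a\<in>{1..i}. \<gamma> a * N a b)) * q b = (if b = s then q b else 0)" by simp
  qed simp
  also have "\<dots> = q s" using s by simp
  finally have row: "(\<Sum>c\<in>{1..i}. \<gamma> c * ?Q c) = q s" .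
  have "(\<Sum>c\<in>{1..m}. (if c \<le> i then u * \<gamma> c * p i else 0) * ?Q c) =
      (\<Sum>c\<in>{1..i}. (if c \<le> i then u * \<gamma> c * p i else 0) * ?Q c)"
    by (rule sum.mono_neutral_right[OF _ sub]) auto
  also have "\<dots> = (\<Sum>c\<in>{1..i}. u * p i * (\<gamma> c * ?Q c))"
    by (intro sum.cong) (simp_all add: mult_ac)
  also have "\<dots> = u * p i * q s" unfolding sum_distrib_left[symmetric] row ..
  finally have "(\<Sum>c\<in>{1..m}. (if c \<le> i then u * \<gamma> c * p i else 0) * ?Q c) = u * (p i * q s)"
    by (simp add: mult_ac)
  moreover have "(\<Sum>c\<in>{1..m}. p c * ?Q c) = (\<Sum>c\<in>{1..m}. p c * q c) - (\<Sum>c\<in>{1..m}. \<Sum>b\<in>{1..m}. N c b * (p c * q b))"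
    by (simp add: right_diff_distrib sum_subtractf sum_distrib_left mult.left_commute)
  ultimately show ?thesis by (simp only: distrib_right sum.distrib)
qed

text \<open>\<open>X\<close> is a skew-symmetric matrix over \<open>F[y][u]\<close>, and affinity is
  claimed for its values at scalars \<open>t\<close>, which the circuit feeds to the oracle. The
  degree bound is \<open>4 n K^2\<close> from the powers of \<open>u\<close> on two columns, plus 1
  for the factor \<open>u\<close> at the added entry.\<close>

lemma oracle_coefficient:
  fixes f :: "(nat \<times> nat, 'a::field) mpoly" and g :: "(nat, 'a) mpoly"
  assumes f: "f \<in> pfaffian_ideal n r" "f \<noteq> 0" and r: "1 \<le> r"
    and A: "total_degree f < card (A :: 'a set)"
    and g: "abp_computable l r g"
  obtains X :: "nat \<times> nat \<Rightarrow> (nat, 'a) mpoly poly" and e \<kappa> pos where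
    "1 \<le> e" "e \<le> total_degree f" "\<kappa> \<noteq> 0"
    "\<And>v. degree (X v) \<le> Suc (4 * n * Suc (total_degree f) ^ 2)"
    "\<And>v t. poly (X v) (mconst t) \<in> affine_forms l"
    "\<And>q. q \<le> e \<Longrightarrow> coeff (meval (\<lambda>a. [:mconst a:]) f X) (pos + q) = mconst \<kappa> * (of_nat (e choose q) * g ^ q)"
proof -
  define K where "K = Suc (total_degree f)"
  let ?h = "msubst f (generic_wedge (2 * n))"
  obtain i \<nu> e x where i: "r \<le> i" "i \<le> 2 * n" and e: "1 \<le> e" "e \<le> total_degree f"
    and \<nu>: "\<And>\<mu>. \<mu> \<in> Poly_Mapping.keys ?h \<Longrightarrow> \<nu> \<le> weight (\<lambda>(b, j, a). if b then 2 * K * a - of_bool (a = i) else 0) \<mu>"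
    and we: "\<And>\<mu>. \<mu> \<in> Poly_Mapping.keys ?h \<Longrightarrow> weight (\<lambda>(b, j, a). if b then 2 * K * a - of_bool (a = i) else 0) \<mu> = \<nu> \<Longrightarrow>
      weight (\<lambda>(b, j, a). of_bool (b \<and> a = i)) \<mu> = e"
    and nz: "(\<Sum>\<mu> | \<mu> \<in> Poly_Mapping.keys ?h \<and>
        weight (\<lambda>(b, j, a). if b then 2 * K * a - of_bool (a = i) else 0) \<mu> = \<nu>.
      Poly_Mapping.lookup ?h \<mu> * monomial_value x \<mu>) \<noteq> 0"
    using wedge_pullback_leading_part[OF f r A K_def] by blast
  define w :: "bool \<times> nat \<times> nat \<Rightarrow> nat" where "w = (\<lambda>(b, j, a). if b then 2 * K * a - of_bool (a = i) else 0)"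
  define wi :: "bool \<times> nat \<times> nat \<Rightarrow> nat" where "wi = (\<lambda>(b, j, a). of_bool (b \<and> a = i))"
  define \<kappa> where "\<kappa> = (\<Sum>\<mu> | \<mu> \<in> Poly_Mapping.keys ?h \<and> weight w \<mu> = \<nu>.
      Poly_Mapping.lookup ?h \<mu> * monomial_value x \<mu>)"
  obtain s N \<gamma> where s: "s \<in> {1..i}" and N: "\<And>a b. N a b \<noteq> 0 \<Longrightarrow> 1 \<le> a \<and> a < b \<and> b \<le> i"
    and N_aff: "\<And>a b. N a b \<in> affine_forms l"
    and \<gamma>: "\<And>b. b \<in> {1..i} \<Longrightarrow> \<gamma> b = (if b = s then 1 else 0) + (\<Sum>a\<in>{1..i}. \<gamma> a * N a b)"
    and \<gamma>_i: "\<gamma> i = g"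
    using abp_computable_triangular[OF g i(1)] by blast
  have K: "2 \<le> K" using e by (simp add: K_def)
  \<comment> \<open>The weight \<open>K (2 K c - [c = i])\<close> of column \<open>c\<close> is
    shared between \<open>P\<close> and \<open>Q\<close>, because both triangular factors need gaps
    between the columns on which they act.\<close>
  define \<alpha> where "\<alpha> c = K * (K * c - of_bool (c = i))" for c
  define \<beta> where "\<beta> c = K * (K * c)" for c
  define p :: "nat \<Rightarrow> nat \<Rightarrow> (nat, 'a) mpoly poly" where "p j c = monom (mconst (x (True, j, c))) (\<alpha> c)" for j c
  define q :: "nat \<Rightarrow> nat \<Rightarrow> (nat, 'a) mpoly poly" where "q k c = monom (mconst (x (False, k, c))) (\<beta> c)" for k c
  define W where "W j k = (\<Sum>c\<in>{1..2 * n}. p j c * q k c) -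
    (\<Sum>c\<in>{1..2 * n}. \<Sum>b\<in>{1..2 * n}. [:N c b:] * (p j c * q k b)) + monom 1 1 * (p j i * q k s)" for j k
  define X where "X = (\<lambda>(j, k). W j k - W k j)"
  \<comment> \<open>The columns after the triangular factors have acted, with the powers
    \<open>\<alpha> c\<close> and \<open>\<beta> c\<close> divided out. The natural differences are
    genuine wherever the coefficient is nonzero.\<close>
  define z where "z = (\<lambda>(b, j, c). if b
    then [:mconst (x (True, j, c)):] + (if c \<le> i then monom (\<gamma> c * mconst (x (True, j, i))) (1 + \<alpha> i - \<alpha> c) else 0)
    else [:mconst (x (False, j, c)):] - (\<Sum>b\<in>{1..2 * n}. monom (N c b * mconst (x (False, j, b))) (\<beta> b - \<beta> c)))"
  \<comment> \<open>The \<open>- 1\<close> at \<open>c = i\<close> eats into the gap of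
    \<open>K\<close>; \<open>K \<ge> 2\<close> keeps enough of it.\<close>
  have \<alpha>_gap: "\<alpha> c + K \<le> 1 + \<alpha> i" if "c < i" for c
  proof -
    have "K * Suc c \<le> K * i" using that by (intro mult_le_mono2) simp
    then have "K * c + 1 \<le> K * i - 1" using K by simp
    then have "K * (K * c + 1) \<le> K * (K * i - 1)" by (rule mult_le_mono2)
    then show ?thesis using that by (simp add: \<alpha>_def algebra_simps)
  qed
  have \<beta>_gap: "\<beta> c + K \<le> \<beta> b" if "c < b" for b c
  proof -
    have "K * Suc c \<le> K * b" using that by (intro mult_le_mono2) simp
    then have "K * c + 1 \<le> K * b" using K by simp
    then have "K * (K * c + 1) \<le> K * (K * b)" by (rule mult_le_mono2)
    then show ?thesis by (simp add: \<beta>_def algebra_simps)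
  qed
  have dvd_monom: "monom 1 K dvd monom c k" if "K \<le> k" for c :: "(nat, 'a) mpoly" and k
  proof -
    have "monom c k = monom 1 K * monom c (k - K)" using that by (simp add: mult_monom)
    then show ?thesis by simp
  qed
  have cong: "monom 1 K dvd z v - [:1, g:] ^ wi v * [:mconst (x v):]" for v
  proof -
    obtain b j c where v: "v = (b, j, c)" by (cases v)
    show ?thesis
    proof (cases b)
      case True
      consider "c < i" | "c = i" | "i < c" by linarith
      then show ?thesis
      proof cases
        case 1
        then show ?thesis using True \<alpha>_gap[OF 1] by (simp add: v z_def wi_def dvd_monom)
      next
        case 2
        then show ?thesis using True \<gamma>_i by (simp add: v z_def wi_def monom_Suc monom_0 mult.commute)
      next
        case 3
        then show ?thesis using True by (simp add: v z_def wi_def)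
      qed
    next
      case False
      have "monom 1 K dvd monom (N c b * mconst (x (False, j, b))) (\<beta> b - \<beta> c)" for b
      proof (cases "N c b = 0")
        case False
        then show ?thesis using N[of c b] \<beta>_gap[of c b] by (intro dvd_monom) simp
      qed simp
      then have "monom 1 K dvd (\<Sum>b\<in>{1..2 * n}. monom (N c b * mconst (x (False, j, b))) (\<beta> b - \<beta> c))"
        by (intro dvd_sum) auto
      then show ?thesis using False by (simp add: v z_def wi_def)
    qed
  qed
  have coeff_h: "coeff (meval (\<lambda>a. [:mconst a:]) ?h (\<lambda>v. monom 1 (K * w v) * z v)) (K * \<nu> + t) =
      mconst \<kappa> * (of_nat (e choose t) * g ^ t)" if "t \<le> e" for t
    unfolding \<kappa>_def
  proof (rule coeff_leading_part[where wi = wi, OF cong])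
    show "t < K" using that e by (simp add: K_def)
  qed (use that \<nu> we in \<open>simp_all add: w_def wi_def\<close>)
  have rows: "monom 1 (\<alpha> c) * z (True, j, c) = p j c + (if c \<le> i then monom 1 1 * [:\<gamma> c:] * p j i else 0)" for j c
  proof -
    have "\<alpha> c \<le> 1 + \<alpha> i" if "c \<le> i"
      using \<alpha>_gap[of c] that by (cases "c = i") auto
    then show ?thesis
      by (simp add: z_def p_def distrib_left mult_monom smult_monom mult.assoc flip: monom_0)
  qed
  have cols: "monom 1 (\<beta> c) * z (False, k, c) = q k c - (\<Sum>b\<in>{1..2 * n}. [:N c b:] * q k b)" for k c
  proof -
    have "monom 1 (\<beta> c) * monom (N c b * mconst (x (False, k, b))) (\<beta> b - \<beta> c) = [:N c b:] * q k b" for b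
    proof (cases "N c b = 0")
      case False
      then show ?thesis using N[of c b] \<beta>_gap[of c b] by (simp add: q_def mult_monom smult_monom)
    qed simp
    then show ?thesis
      by (simp add: z_def right_diff_distrib sum_distrib_left) (simp add: q_def smult_monom)
  qed
  \<comment> \<open>The bilinear form with affine coefficients, rewritten in factored form. The
    powers divided out of both sides are collected on the \<open>P\<close> side, since
    \<open>w\<close> is 0 on \<open>Q\<close>.\<close>
  have W_eq: "W j k = (\<Sum>c\<in>{1..2 * n}. (monom 1 (K * w (True, j, c)) * z (True, j, c)) * z (False, k, c))" for j k
  proof -
    have \<gamma>': "[:\<gamma> b:] = (if b = s then 1 else 0) + (\<Sum>a\<in>{1..i}. [:\<gamma> a:] * [:N a b:])" if "b \<in> {1..i}" for b
      by (subst \<gamma>[OF that]) (simp add: rm_sum[OF ring_morphism_const_poly, symmetric] one_pCons mult.commute)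
    have "W j k = (\<Sum>c\<in>{1..2 * n}. (p j c + (if c \<le> i then monom 1 1 * [:\<gamma> c:] * p j i else 0)) *
        (q k c - (\<Sum>b\<in>{1..2 * n}. [:N c b:] * q k b)))"
      unfolding W_def
      by (rule triangular_factorisation[symmetric, OF i(2) s _ \<gamma>']) (use N in auto)
    also have "\<dots> = (\<Sum>c\<in>{1..2 * n}. (monom 1 (K * w (True, j, c)) * z (True, j, c)) * z (False, k, c))"
    proof (rule sum.cong)
      fix c assume c: "c \<in> {1..2 * n}"
      then have "1 \<le> K * c" using K by simp
      moreover have "of_bool (c = i) \<le> (1::nat)" by simp
      ultimately have "2 * K * c - of_bool (c = i) = (K * c - of_bool (c = i)) + K * c" by linarith
      then have "K * w (True, j, c) = \<alpha> c + \<beta> c"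
        unfolding w_def \<alpha>_def \<beta>_def prod.case by (simp only: if_True distrib_left)
      then have "monom 1 (K * w (True, j, c)) = monom (1 :: (nat, 'a) mpoly) (\<alpha> c) * monom 1 (\<beta> c)"
        by (simp add: mult_monom)
      then show "(p j c + (if c \<le> i then monom 1 1 * [:\<gamma> c:] * p j i else 0)) *
          (q k c - (\<Sum>b\<in>{1..2 * n}. [:N c b:] * q k b)) =
          (monom 1 (K * w (True, j, c)) * z (True, j, c)) * z (False, k, c)"
        unfolding rows[symmetric] cols[symmetric] by (simp only: mult_ac)
    qed simp
    finally show ?thesis .
  qed
  define y where "y v = monom 1 (K * w v) * z v" for v
  have "wedge_sum {1..2 * n} (\<lambda>j a. y (True, j, a)) (\<lambda>j a. y (False, j, a)) = X"
  proof
    fix v show "wedge_sum {1..2 * n} (\<lambda>j a. y (True, j, a)) (\<lambda>j a. y (False, j, a)) v = X v"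
    proof (cases v)
      case (Pair j k)
      have F: "y (False, j, a) = z (False, j, a)" for j a by (simp add: y_def w_def)
      show ?thesis
        unfolding Pair wedge_sum_def X_def prod.case W_eq sum_subtractf F
        by (simp only: y_def mult.commute)
    qed
  qed
  then have "meval (\<lambda>a. [:mconst a:]) f X = meval (\<lambda>a. [:mconst a:]) ?h y"
    by (simp add: meval_wedge_pullback[OF ring_morphism_comp[OF ring_morphism_const_poly ring_morphism_mconst]])
  then have coeff_f: "coeff (meval (\<lambda>a. [:mconst a:]) f X) (K * \<nu> + t) = mconst \<kappa> * (of_nat (e choose t) * g ^ t)"
    if "t \<le> e" for t
    using coeff_h[OF that] by (simp add: y_def[abs_def])
  have bound: "\<alpha> c \<le> 2 * n * K ^ 2" "\<beta> c \<le> 2 * n * K ^ 2" if "c \<le> 2 * n" for c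
  proof -
    have "K * (K * c) \<le> K * (K * (2 * n))" using that by (intro mult_le_mono2)
    also have "\<dots> = 2 * n * K ^ 2" by (simp add: power2_eq_square)
    finally have *: "K * (K * c) \<le> 2 * n * K ^ 2" .
    then show "\<beta> c \<le> 2 * n * K ^ 2" by (simp only: \<beta>_def)
    have "\<alpha> c \<le> K * (K * c)" by (simp add: \<alpha>_def)
    with * show "\<alpha> c \<le> 2 * n * K ^ 2" by (rule order.trans[rotated])
  qed
  have deg_pq: "degree (p j c * q k b) \<le> 4 * n * K ^ 2" if "c \<le> 2 * n" "b \<le> 2 * n" for j k b c
  proof -
    have "degree (p j c * q k b) \<le> \<alpha> c + \<beta> b"
      unfolding p_def q_def mult_monom by (rule degree_monom_le)
    with bound(1)[OF that(1)] bound(2)[OF that(2)] show ?thesis by linarith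
  qed
  have deg_W: "degree (W j k) \<le> Suc (4 * n * K ^ 2)" for j k
    unfolding W_def
  proof (intro degree_add_le degree_diff_le degree_sum_le)
    show "degree (p j c * q k c) \<le> Suc (4 * n * K ^ 2)" if "c \<in> {1..2 * n}" for c
      using deg_pq[of c c] that by (simp add: le_SucI)
    show "degree ([:N c b:] * (p j c * q k b)) \<le> Suc (4 * n * K ^ 2)" if "c \<in> {1..2 * n}" "b \<in> {1..2 * n}" for c b
      using degree_mult_le[of "[:N c b:]" "p j c * q k b"] deg_pq[of c b j k] that by simp
    have "s \<le> 2 * n" using s i by simp
    then show "degree (monom 1 1 * (p j i * q k s)) \<le> Suc (4 * n * K ^ 2)"
      using degree_mult_le[of "monom 1 1" "p j i * q k s"] deg_pq[of i s j k] i
        degree_monom_le[of "1 :: (nat, 'a) mpoly" 1] by linarith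
  qed simp_all
  have aff_W: "poly (W j k) (mconst t) \<in> affine_forms l" for j k t
  proof -
    note rm = ring_morphism_mconst
    have P: "poly (p j c) (mconst t) = mconst (x (True, j, c) * t ^ \<alpha> c)" for j c
      by (simp add: p_def poly_monom rm_mult[OF rm] rm_power[OF rm])
    have Q: "poly (q k c) (mconst t) = mconst (x (False, k, c) * t ^ \<beta> c)" for k c
      by (simp add: q_def poly_monom rm_mult[OF rm] rm_power[OF rm])
    have "N c b * mconst a \<in> affine_forms l" for c b a
      using affine_forms_cmult[OF N_aff, of a c b] by (simp add: mult.commute)
    then show ?thesis
      unfolding W_def
      by (simp add: poly_sum poly_monom P Q flip: rm_mult[OF rm])
         (intro affine_forms_add affine_forms_diff affine_forms_sum affine_forms_const | assumption)+
  qed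
  have "degree (X v) \<le> Suc (4 * n * K ^ 2)" for v
    by (cases v) (simp add: X_def degree_diff_le deg_W)
  moreover have "poly (X v) (mconst t) \<in> affine_forms l" for v t
  proof (cases v)
    case (Pair j k)
    then have "poly (X v) (mconst t) = poly (W j k) (mconst t) - poly (W k j) (mconst t)"
      by (simp add: X_def)
    then show ?thesis by (simp only: affine_forms_diff aff_W)
  qed
  moreover have "\<kappa> \<noteq> 0" using nz by (simp add: \<kappa>_def w_def)
  ultimately show thesis
    using that[of e \<kappa> X "K * \<nu>"] e coeff_f by (simp add: K_def)
qed

section \<open>Exponents and sizes\<close>

text \<open>In characteristic \<open>p\<close>, let \<open>q\<close> be the exact power of
  \<open>p\<close> in \<open>e\<close>: then \<open>e choose q\<close> and \<open>e / q\<close> have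
  the same multiplicity of \<open>p\<close>, namely 0. In characteristic 0,
  \<open>e choose 1 = e\<close> is nonzero.\<close>

lemma binomial_prime_power_nonzero:
  assumes "1 \<le> e"
  obtains q where "q \<le> e" "(of_nat (e choose q) :: 'a::field) \<noteq> 0"
    "CHAR('a) = 0 \<longrightarrow> q = 1" "CHAR('a) > 0 \<longrightarrow> (\<exists>k. q = CHAR('a) ^ k)"
proof (cases "CHAR('a) = 0")
  case True
  then show thesis using assms by (intro that[of 1]) (simp_all add: of_nat_eq_0_iff_char_dvd)
next
  case False
  define p where "p = CHAR('a)"
  have p: "prime p" using False prime_CHAR_semidom[where 'a = 'a] by (simp add: p_def)
  obtain k e' where e: "e = p ^ k * e'" "\<not> p dvd e'"
    using multiplicity_decompose'[of e p] assms p by (metis not_prime_unit not_one_le_zero)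
  have "0 < e'" using assms e(1) by (cases e') auto
  have "multiplicity p (e choose p ^ k) = multiplicity p e'"
    unfolding e(1) by (rule const_p_fac[OF \<open>0 < e'\<close> p])
  also have "\<dots> = 0" using e(2) by (rule not_dvd_imp_multiplicity_0)
  finally have mult: "multiplicity p (e choose p ^ k) = 0" .
  have le: "p ^ k \<le> e" unfolding e(1) using \<open>0 < e'\<close> by simp
  then have "e choose p ^ k \<noteq> 0" by simp
  then have "\<not> p dvd (e choose p ^ k)"
    using mult p by (metis not_prime_unit multiplicity_eq_zero_iff)
  then have "(of_nat (e choose p ^ k) :: 'a) \<noteq> 0"
    by (simp add: of_nat_eq_0_iff_char_dvd p_def)
  with le False show thesis unfolding p_def by (intro that[of "CHAR('a) ^ k"]) auto
qed

lemma exists_distinct_points: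
  assumes "infinite (UNIV :: 'a set) \<or> D < card (UNIV :: 'a set)"
  shows "\<exists>u :: nat \<Rightarrow> 'a. inj_on u {..D}"
proof (cases "infinite (UNIV :: 'a set)")
  case True
  then obtain u :: "nat \<Rightarrow> 'a" where "inj u" using infinite_countable_subset by blast
  then show ?thesis using inj_on_subset by blast
next
  case False
  then have "card {..D} \<le> card (UNIV :: 'a set)" using assms by simp
  then show ?thesis using False card_le_inj[of "{..D}" "UNIV :: 'a set"] by auto
qed

text \<open>The interpolated coefficient is \<open>\<kappa> (e choose q) g^q\<close>. Its scalar
  factor is invertible, and the inverse is merged with the interpolation weights on the wires of the
  top gate.\<close>

lemma power_computed_by_circuit:
  fixes f :: "(nat \<times> nat, 'a::field) mpoly" and g :: "(nat, 'a) mpoly"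
  assumes f: "f \<in> pfaffian_ideal n r" "f \<noteq> 0" and r: "1 \<le> r" and n: "1 \<le> n" and l: "1 \<le> l"
    and g: "abp_computable l r g"
    and F: "infinite (UNIV :: 'a set) \<or>
      Suc (4 * n * Suc (total_degree f) ^ 2) * total_degree f < card (UNIV :: 'a set)"
  obtains \<Phi> :: "(nat \<times> nat, 'a) circuit" and q where
    "wf_circuit (skew_vars n) l \<Phi>" "circuit_depth (skew_vars n) \<Phi> = 3"
    "is_addition (gates \<Phi> ! out_gate \<Phi>)" "computes (skew_vars n) f \<Phi> (g ^ q)"
    "circuit_size (skew_vars n) \<Phi> = l + 2 +
      Suc (Suc (4 * n * Suc (total_degree f) ^ 2) * total_degree f) * (card (skew_vars n) * (l + 3) + 2)"
    "q \<le> total_degree f" "CHAR('a) = 0 \<longrightarrow> q = 1" "CHAR('a) > 0 \<longrightarrow> (\<exists>k. q = CHAR('a) ^ k)"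
    "1 \<le> total_degree f"
proof -
  define D where "D = Suc (4 * n * Suc (total_degree f) ^ 2) * total_degree f"
  let ?V = "skew_vars n"
  let ?\<phi> = "\<lambda>a :: 'a. [:mconst a :: (nat, 'a) mpoly:]"
  note rm = ring_morphism_mconst
  obtain u :: "nat \<Rightarrow> 'a" where u: "inj_on u {..D}"
    using exists_distinct_points[of D] F by (auto simp: D_def)
  have "card (u ` {..D}) = Suc D" by (simp add: card_image u)
  then have lt: "total_degree f < card (u ` {..D})" by (simp add: D_def)
  obtain X e \<kappa> pos where e: "1 \<le> e" "e \<le> total_degree f" and \<kappa>: "\<kappa> \<noteq> 0"
    and deg: "\<And>v. degree (X v) \<le> Suc (4 * n * Suc (total_degree f) ^ 2)"
    and aff: "\<And>v t. poly (X v) (mconst t) \<in> affine_forms l"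
    and coeff: "\<And>q. q \<le> e \<Longrightarrow> coeff (meval ?\<phi> f X) (pos + q) = mconst \<kappa> * (of_nat (e choose q) * g ^ q)"
    by (rule oracle_coefficient[OF f r lt g]) (rule that)
  obtain q where q: "q \<le> e" "(of_nat (e choose q) :: 'a) \<noteq> 0" "CHAR('a) = 0 \<longrightarrow> q = 1"
    "CHAR('a) > 0 \<longrightarrow> (\<exists>k. q = CHAR('a) ^ k)"
    by (rule binomial_prime_power_nonzero[OF e(1), where 'a = 'a])
  define \<rho> where "\<rho> = \<kappa> * of_nat (e choose q)"
  have \<rho>: "\<rho> \<noteq> 0" using \<kappa> q(2) by (simp add: \<rho>_def)
  \<comment> \<open>Matches the circuit, which supplies 0 outside the variables of \<open>f\<close>;
    the value of \<open>f\<close> is unchanged.\<close>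
  define X' where "X' v = (if v \<in> ?V then X v else 0)" for v
  define H where "H = meval ?\<phi> f X'"
  have "mvars f \<subseteq> ?V" using pfaffian_ideal_polys_in[OF f(1)] by (simp add: polys_in_def)
  then have "H = meval ?\<phi> f X"
    unfolding H_def by (intro meval_cong) (auto simp: X'_def)
  then have coeff_H: "coeff H (pos + q) = mconst \<rho> * g ^ q"
    using coeff[OF q(1)] by (simp add: \<rho>_def rm_mult[OF rm] rm_of_nat[OF rm] mult.assoc)
  have "degree H \<le> D" unfolding H_def D_def
    by (rule degree_meval_le) (simp_all add: X'_def deg)
  have poly_H: "poly H (mconst t) = msubst f (\<lambda>v. poly (X' v) (mconst t))" for t
    unfolding H_def msubst_eq_meval by (subst rm_meval[OF ring_morphism_poly]) simp
  from coeff_interpolation[OF u, of "pos + q"] obtain c where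
    "\<forall>H :: (nat, 'a) mpoly poly. degree H \<le> D \<longrightarrow>
      coeff H (pos + q) = (\<Sum>k\<le>D. mconst (c k) * poly H (mconst (u k)))" ..
  with \<open>degree H \<le> D\<close> have c: "coeff H (pos + q) = (\<Sum>k\<le>D. mconst (c k) * poly H (mconst (u k)))"
    by simp
  define \<alpha> where "\<alpha> k v = (SOME a. poly (X v) (mconst (u k)) = affine_form l a)" for k v
  have \<alpha>: "poly (X v) (mconst (u k)) = affine_form l (\<alpha> k v)" for k v
  proof -
    have "\<exists>a. poly (X v) (mconst (u k)) = affine_form l a"
      using aff[of v "u k"] by (auto simp: affine_forms_def)
    then show ?thesis unfolding \<alpha>_def by (rule someI_ex)
  qed
  have X'_eval: "(\<lambda>v. poly (X' v) (mconst (u k))) = (\<lambda>v. if v \<in> ?V then affine_form l (\<alpha> k v) else 0)" for k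
    by (auto simp: X'_def \<alpha>)
  have "mconst (inverse \<rho>) * mconst \<rho> = (1 :: (nat, 'a) mpoly)"
    using \<rho> by (simp flip: rm_mult[OF rm])
  then have "g ^ q = mconst (inverse \<rho>) * (mconst \<rho> * g ^ q)" by (simp flip: mult.assoc)
  also have "\<dots> = (\<Sum>k\<le>D. mconst (inverse \<rho>) * (mconst (c k) * poly H (mconst (u k))))"
    unfolding coeff_H[symmetric] c sum_distrib_left ..
  also have "\<dots> = (\<Sum>k<Suc D. mconst (inverse \<rho> * c k) *
      msubst f (\<lambda>v. if v \<in> ?V then affine_form l (\<alpha> k v) else 0))"
    unfolding lessThan_Suc_atMost poly_H X'_eval rm_mult[OF rm] by (simp only: mult.assoc)
  finally have gq: "g ^ q = \<dots>" .
  have "?V \<subseteq> {1..2 * n} \<times> {1..2 * n}" by (auto simp: skew_vars_def)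
  then have "finite ?V" by (rule finite_subset) simp
  have "(1, 2) \<in> ?V" using n by (simp add: skew_vars_def)
  then have "?V \<noteq> {}" by blast
  have "0 < l" using l by simp
  from depth_three_circuit[OF \<open>finite ?V\<close> \<open>?V \<noteq> {}\<close> zero_less_Suc[of D] this, of f "\<lambda>k. inverse \<rho> * c k" \<alpha>]
  obtain \<Phi> where "wf_circuit ?V l \<Phi>" "circuit_depth ?V \<Phi> = 3" "is_addition (gates \<Phi> ! out_gate \<Phi>)"
    "computes ?V f \<Phi> (g ^ q)" "circuit_size ?V \<Phi> = l + 2 + Suc D * (card ?V * (l + 3) + 2)"
    unfolding gq[symmetric] by blast
  then show thesis by (intro that[of \<Phi> q]) (use q e in \<open>simp_all add: D_def\<close>)
qed

text \<open>The number of oracle calls is at most \<open>18 n d^3\<close> and the cost of each at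
  most \<open>18 n^2 l\<close>; the product \<open>324 n^3 d^3 l\<close> and the remaining
  \<open>l + 2\<close> fit into the bound with room to spare.\<close>

lemma circuit_size_bound:
  fixes n d l r N :: nat
  assumes "1 \<le> n" "1 \<le> d" "1 \<le> l" "1 \<le> r" "N \<le> 4 * n ^ 2"
  shows "l + 2 + Suc (Suc (4 * n * Suc d ^ 2) * d) * (N * (l + 3) + 2) \<le> 1000 * d ^ 4 * l * n ^ 5 * r"
proof -
  have "Suc d ^ 2 \<le> (2 * d) ^ 2" using assms by (intro power_mono) auto
  then have "Suc (4 * n * Suc d ^ 2) * d \<le> Suc (4 * n * (4 * d ^ 2)) * d"
    by (intro mult_right_mono) (simp_all add: power_mult_distrib)
  also have "\<dots> = 16 * (n * d ^ 3) + d" by (simp add: power2_eq_square power3_eq_cube)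
  finally have D: "Suc (4 * n * Suc d ^ 2) * d \<le> 16 * (n * d ^ 3) + d" .
  have "d ^ 1 \<le> d ^ 3" using assms by (intro power_increasing) auto
  also have "\<dots> \<le> n * d ^ 3" using assms by simp
  finally have d: "d \<le> n * d ^ 3" by simp
  then have E: "Suc (Suc (4 * n * Suc d ^ 2) * d) \<le> 18 * (n * d ^ 3)" using D assms by linarith
  have "1 \<le> n ^ 2" "1 \<le> n ^ 2 * l" using assms by auto
  have "N * (l + 3) \<le> 4 * n ^ 2 * (4 * l)" using assms by (intro mult_le_mono) auto
  also have "\<dots> = 16 * (n ^ 2 * l)" by simp
  finally have "N * (l + 3) + 2 \<le> 18 * (n ^ 2 * l)" using \<open>1 \<le> n ^ 2 * l\<close> by linarith
  then have "Suc (Suc (4 * n * Suc d ^ 2) * d) * (N * (l + 3) + 2) \<le> 18 * (n * d ^ 3) * (18 * (n ^ 2 * l))"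
    by (rule mult_le_mono[OF E])
  also have "\<dots> = 324 * (n ^ 3 * d ^ 3 * l)" by (simp add: power2_eq_square power3_eq_cube)
  finally have 1: "Suc (Suc (4 * n * Suc d ^ 2) * d) * (N * (l + 3) + 2) \<le> 324 * (n ^ 3 * d ^ 3 * l)" .
  have "1 \<le> n ^ 3 * d ^ 3" using assms by simp
  then have 2: "1 * l \<le> n ^ 3 * d ^ 3 * l" by (rule mult_le_mono1)
  have "n ^ 3 * d ^ 3 * l \<le> n ^ 5 * d ^ 4 * l"
    using assms by (intro mult_le_mono power_increasing) auto
  also have "\<dots> \<le> n ^ 5 * d ^ 4 * l * r" using assms by simp
  finally have 3: "n ^ 3 * d ^ 3 * l \<le> n ^ 5 * d ^ 4 * l * r" .
  have "l + 2 + Suc (Suc (4 * n * Suc d ^ 2) * d) * (N * (l + 3) + 2) \<le> 1000 * (n ^ 5 * d ^ 4 * l * r)"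
    using 1 2 3 assms by linarith
  also have "\<dots> = 1000 * d ^ 4 * l * n ^ 5 * r" by (simp add: mult_ac)
  finally show ?thesis .
qed

text \<open>The left side bounds the degree in \<open>u\<close> of the value of \<open>f\<close>;
  interpolation needs one point more, hence the strict inequality. It is at most
  \<open>17 n d^3\<close> for \<open>d \<ge> 1\<close>, and for \<open>d = 0\<close> it is
  0.\<close>

lemma field_size_bound:
  fixes n d c :: nat
  assumes "1 \<le> n" "0 < c" "100 * d ^ 3 * n ^ 3 \<le> c"
  shows "Suc (4 * n * Suc d ^ 2) * d < c"
proof (cases "d = 0")
  case False
  then have d: "1 \<le> d" by simp
  have "Suc d ^ 2 \<le> (2 * d) ^ 2" using d by (intro power_mono) auto
  then have "4 * n * Suc d ^ 2 \<le> 4 * n * (4 * d ^ 2)" by (simp add: power_mult_distrib)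
  moreover have "1 \<le> n * d ^ 2" using d assms by simp
  ultimately have "Suc (4 * n * Suc d ^ 2) \<le> 17 * (n * d ^ 2)" by linarith
  then have "Suc (4 * n * Suc d ^ 2) * d \<le> 17 * (n * d ^ 2) * d" by (rule mult_le_mono1)
  also have "\<dots> = 17 * (n ^ 1 * d ^ 3)" by (simp add: power2_eq_square power3_eq_cube)
  also have "\<dots> \<le> 17 * (n ^ 3 * d ^ 3)"
    using assms d by (intro mult_le_mono power_increasing) auto
  also have "\<dots> < 100 * (n ^ 3 * d ^ 3)" using d assms by simp
  also have "\<dots> \<le> c" using assms(3) by (simp add: mult_ac)
  finally show ?thesis .
qed (use assms in simp)

theorem theorem4p10:
  "\<exists>c\<^sub>0 C :: real. 0 < c\<^sub>0 \<and> c\<^sub>0 \<le> constant_bound \<and> 0 < C \<and> C \<le> constant_bound \<and>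
    (\<forall>(n::nat) (r::nat) (l::nat) (d::nat)
        (f :: (nat \<times> nat, 'a::field) mpoly) (g :: (nat, 'a) mpoly).
      1 \<le> r \<and> r \<le> n \<and> 1 \<le> l \<and>
      f \<in> pfaffian_ideal n r \<and> f \<noteq> 0 \<and> total_degree f = d \<and>
      g \<in> polys_in {1..l} \<and> abp_computable l r g \<and>
      (infinite (UNIV :: 'a set) \<or> c\<^sub>0 * real d ^ 3 * real n ^ 3 \<le> real (card (UNIV :: 'a set)))
      \<longrightarrow>
      (\<exists>\<Phi> :: (nat \<times> nat, 'a) circuit.
        wf_circuit (skew_vars n) l \<Phi> \<and>
        circuit_depth (skew_vars n) \<Phi> = 3 \<and>
        is_addition (gates \<Phi> ! out_gate \<Phi>) \<and>
        real (circuit_size (skew_vars n) \<Phi>) \<le> C * real d ^ 4 * real l * real n ^ 5 * real r \<and>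
        (CHAR('a) = 0 \<longrightarrow> computes (skew_vars n) f \<Phi> g) \<and>
        (CHAR('a) > 0 \<longrightarrow>
          (\<exists>k. int k \<le> \<lfloor>log (real CHAR('a)) (real d)\<rfloor> \<and>
            computes (skew_vars n) f \<Phi> (g ^ (CHAR('a) ^ k))))))"
proof (rule exI[of _ 100], rule exI[of _ 1000], intro conjI allI impI)
  fix n r l d :: nat and f :: "(nat \<times> nat, 'a) mpoly" and g :: "(nat, 'a) mpoly"
  assume asm: "1 \<le> r \<and> r \<le> n \<and> 1 \<le> l \<and> f \<in> pfaffian_ideal n r \<and> f \<noteq> 0 \<and> total_degree f = d \<and>
    g \<in> polys_in {1..l} \<and> abp_computable l r g \<and>
    (infinite (UNIV :: 'a set) \<or> 100 * real d ^ 3 * real n ^ 3 \<le> real (card (UNIV :: 'a set)))"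
  then have r: "1 \<le> r" and n: "1 \<le> n" and l: "1 \<le> l" and f: "f \<in> pfaffian_ideal n r" "f \<noteq> 0"
    and d: "total_degree f = d" and g: "abp_computable l r g" by auto
  have F: "infinite (UNIV :: 'a set) \<or>
      Suc (4 * n * Suc (total_degree f) ^ 2) * total_degree f < card (UNIV :: 'a set)"
  proof (cases "infinite (UNIV :: 'a set)")
    case False
    then have "real (100 * d ^ 3 * n ^ 3) \<le> real (card (UNIV :: 'a set))" using asm by simp
    then have "100 * d ^ 3 * n ^ 3 \<le> card (UNIV :: 'a set)" by (simp only: of_nat_le_iff)
    moreover have "0 < card (UNIV :: 'a set)" using False by (simp add: card_gt_0_iff)
    ultimately show ?thesis using field_size_bound[OF n] d by blast
  qed simp
  obtain \<Phi> :: "(nat \<times> nat, 'a) circuit" and q where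
      \<Phi>: "wf_circuit (skew_vars n) l \<Phi>" "circuit_depth (skew_vars n) \<Phi> = 3"
      "is_addition (gates \<Phi> ! out_gate \<Phi>)" "computes (skew_vars n) f \<Phi> (g ^ q)"
    and size: "circuit_size (skew_vars n) \<Phi> =
      l + 2 + Suc (Suc (4 * n * Suc d ^ 2) * d) * (card (skew_vars n) * (l + 3) + 2)"
    and q: "q \<le> d" "CHAR('a) = 0 \<longrightarrow> q = 1" "CHAR('a) > 0 \<longrightarrow> (\<exists>k. q = CHAR('a) ^ k)"
    and d1: "1 \<le> d"
    by (rule power_computed_by_circuit[OF f r n l g F, unfolded d]) (rule that)
  have "card (skew_vars n) \<le> card ({1..2 * n} \<times> {1..2 * n})"
    by (intro card_mono) (auto simp: skew_vars_def)
  also have "\<dots> = 4 * n ^ 2" by (simp add: power2_eq_square)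
  finally have "circuit_size (skew_vars n) \<Phi> \<le> 1000 * d ^ 4 * l * n ^ 5 * r"
    unfolding size using n d1 l r by (intro circuit_size_bound)
  then have "real (circuit_size (skew_vars n) \<Phi>) \<le> real (1000 * d ^ 4 * l * n ^ 5 * r)"
    by (simp only: of_nat_le_iff)
  then have bound: "real (circuit_size (skew_vars n) \<Phi>) \<le> 1000 * real d ^ 4 * real l * real n ^ 5 * real r"
    by simp
  \<comment> \<open>The bound on \<open>k\<close> is \<open>q \<le> d\<close> in logarithmic form;
    \<open>q\<close> divides the degree \<open>e \<le> d\<close> in column \<open>i\<close>.\<close>
  have power: "\<exists>k. int k \<le> \<lfloor>log (real CHAR('a)) (real d)\<rfloor> \<and>
      computes (skew_vars n) f \<Phi> (g ^ (CHAR('a) ^ k))" if char: "CHAR('a) > 0"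
  proof -
    obtain k where k: "q = CHAR('a) ^ k" using q(3) char by blast
    have "prime CHAR('a)" using prime_CHAR_semidom[where 'a = 'a] char by simp
    then have "1 < real CHAR('a)" using prime_gt_1_nat by simp
    moreover have "real CHAR('a) ^ k \<le> real d"
      using q(1) unfolding k by (simp only: of_nat_power[symmetric] of_nat_le_iff)
    ultimately have "real k \<le> log (real CHAR('a)) (real d)" by (intro le_log_of_power)
    then have "int k \<le> \<lfloor>log (real CHAR('a)) (real d)\<rfloor>" by (simp add: le_floor_iff)
    then show ?thesis using \<Phi>(4) unfolding k by blast
  qed
  have char_0: "computes (skew_vars n) f \<Phi> g" if "CHAR('a) = 0" using \<Phi>(4) q(2) that by simp
  show "\<exists>\<Phi> :: (nat \<times> nat, 'a) circuit.
        wf_circuit (skew_vars n) l \<Phi> \<and>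
        circuit_depth (skew_vars n) \<Phi> = 3 \<and>
        is_addition (gates \<Phi> ! out_gate \<Phi>) \<and>
        real (circuit_size (skew_vars n) \<Phi>) \<le> 1000 * real d ^ 4 * real l * real n ^ 5 * real r \<and>
        (CHAR('a) = 0 \<longrightarrow> computes (skew_vars n) f \<Phi> g) \<and>
        (CHAR('a) > 0 \<longrightarrow>
          (\<exists>k. int k \<le> \<lfloor>log (real CHAR('a)) (real d)\<rfloor> \<and>
            computes (skew_vars n) f \<Phi> (g ^ (CHAR('a) ^ k))))"
    by (intro exI[of _ \<Phi>] conjI impI) (rule \<Phi> bound | erule char_0 power)+
qed (simp_all add: constant_bound_def)

end
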